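(* Let $G$ be a group, $A=\bigoplus_{g\in G}A_g$ an epsilon-strongly $G$-graded ring and $R=A_1$. The map $\Phi:G\to \mathtt{PicS}(R)$ defined by $\Phi(g)=[A_g]$ for all $g\in G$ is a unital partial representation of $G$ on $\mathtt{PicS}(R)$ such that $\Phi(g)\Phi(g^{-1})=[R\epsilon_g]$ for all $g\in G$.
   Context: Rings are associative and unital; modules and bimodules are unital. For subsets $X,Y$ of a ring, $XY$ is the set of finite sums of products $xy$. A $G$-graded unital ring $A=\bigoplus_{g\in G}A_g$ (so $A_gA_h\subseteq A_{gh}$) is epsilon-strongly graded if for every $g\in G$ there is $\epsilon_g\in A_gA_{g^{-1}}$ with $\epsilon_ga=a=a\epsilon_{g^{-1}}$ for all $a\in A_g$ (equivalently, each $A_gA_{g^{-1}}$ is a unital ideal of $A_1$ and $A_g$ is a unital $(A_gA_{g^{-1}},A_{g^{-1}}A_g)$-bimodule). The element $\epsilon_g$ is unique; it is the identity of the ideal $A_gA_{g^{-1}}=R\epsilon_g$ and a central idempotent of $R=A_1$. For an $R$-bimodule $P$, let $l:R\to\operatorname{End}(P_R)$, $l(a)(x)=ax$, and $r:R\to\operatorname{End}({}_RP)$, $r(a)(x)=xa$. $P$ is partially invertible if it is finitely generated projective as a left and as a right $R$-module and $l$ and $r$ are epimorphisms of $R$-bimodules (with $(af)(x)=af(x)$, $(fa)(x)=f(ax)$ on $\operatorname{End}(P_R)$ and $(af)(x)=f(xa)$, $(fa)(x)=f(x)a$ on $\operatorname{End}({}_RP)$). $\mathtt{PicS}(R)$ is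 the monoid of isomorphism classes $[P]$ of partially invertible $R$-bimodules, with product $[P][Q]=[P\otimes_RQ]$ and identity $[R]$. A unital partial representation of $G$ into a monoid $S$ is a map $\Phi:G\to S$ with $\Phi(1_G)=1_S$, $\Phi(g^{-1})\Phi(g)\Phi(h)=\Phi(g^{-1})\Phi(gh)$ and $\Phi(g)\Phi(h)\Phi(h^{-1})=\Phi(gh)\Phi(h^{-1})$ for all $g,h\in G$. *)

theory Defs
  imports "HOL-Algebra.Free_Abelian_Groups" "HOL-Algebra.Module" "HOL-Algebra.AbelCoset"
begin

section \<open>Bimodules\<close>

text \<open>The library locale \<^locale>\<open>module\<close> requires a commutative base ring, so only its record is reused;
  as there, the inherited fields \<open>mult\<close> and \<open>one\<close> carry no meaning for a (bi)module.\<close>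

record ('a, 'm) bimod = "('a, 'm) module" +
  rsmult :: "'m \<Rightarrow> 'a \<Rightarrow> 'm"  (infixl \<open>\<odot>\<^sub>r\<index>\<close> 70)

locale bimodule = R?: ring R + M?: abelian_group M
  for R :: "('a, 'r) ring_scheme" (structure) and M :: "('a, 'm, 'e) bimod_scheme" (structure) +
  assumes smult_closed: "\<lbrakk>a \<in> carrier R; x \<in> carrier M\<rbrakk> \<Longrightarrow> a \<odot>\<^bsub>M\<^esub> x \<in> carrier M"
    and smult_l_distr: "\<lbrakk>a \<in> carrier R; b \<in> carrier R; x \<in> carrier M\<rbrakk>
      \<Longrightarrow> (a \<oplus>\<^bsub>R\<^esub> b) \<odot>\<^bsub>M\<^esub> x = a \<odot>\<^bsub>M\<^esub> x \<oplus>\<^bsub>M\<^esub> b \<odot>\<^bsub>M\<^esub> x"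
    and smult_r_distr: "\<lbrakk>a \<in> carrier R; x \<in> carrier M; y \<in> carrier M\<rbrakk>
      \<Longrightarrow> a \<odot>\<^bsub>M\<^esub> (x \<oplus>\<^bsub>M\<^esub> y) = a \<odot>\<^bsub>M\<^esub> x \<oplus>\<^bsub>M\<^esub> a \<odot>\<^bsub>M\<^esub> y"
    and smult_assoc: "\<lbrakk>a \<in> carrier R; b \<in> carrier R; x \<in> carrier M\<rbrakk>
      \<Longrightarrow> (a \<otimes>\<^bsub>R\<^esub> b) \<odot>\<^bsub>M\<^esub> x = a \<odot>\<^bsub>M\<^esub> (b \<odot>\<^bsub>M\<^esub> x)"
    and smult_one: "x \<in> carrier M \<Longrightarrow> \<one>\<^bsub>R\<^esub> \<odot>\<^bsub>M\<^esub> x = x"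
    and rsmult_closed: "\<lbrakk>x \<in> carrier M; a \<in> carrier R\<rbrakk> \<Longrightarrow> x \<odot>\<^sub>r\<^bsub>M\<^esub> a \<in> carrier M"
    and rsmult_l_distr: "\<lbrakk>x \<in> carrier M; y \<in> carrier M; a \<in> carrier R\<rbrakk>
      \<Longrightarrow> (x \<oplus>\<^bsub>M\<^esub> y) \<odot>\<^sub>r\<^bsub>M\<^esub> a = x \<odot>\<^sub>r\<^bsub>M\<^esub> a \<oplus>\<^bsub>M\<^esub> y \<odot>\<^sub>r\<^bsub>M\<^esub> a"
    and rsmult_r_distr: "\<lbrakk>x \<in> carrier M; a \<in> carrier R; b \<in> carrier R\<rbrakk>
      \<Longrightarrow> x \<odot>\<^sub>r\<^bsub>M\<^esub> (a \<oplus>\<^bsub>R\<^esub> b) = x \<odot>\<^sub>r\<^bsub>M\<^esub> a \<oplus>\<^bsub>M\<^esub> x \<odot>\<^sub>r\<^bsub>M\<^esub> b"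
    and rsmult_assoc: "\<lbrakk>x \<in> carrier M; a \<in> carrier R; b \<in> carrier R\<rbrakk>
      \<Longrightarrow> x \<odot>\<^sub>r\<^bsub>M\<^esub> (a \<otimes>\<^bsub>R\<^esub> b) = (x \<odot>\<^sub>r\<^bsub>M\<^esub> a) \<odot>\<^sub>r\<^bsub>M\<^esub> b"
    and rsmult_one: "x \<in> carrier M \<Longrightarrow> x \<odot>\<^sub>r\<^bsub>M\<^esub> \<one>\<^bsub>R\<^esub> = x"
    and smult_rsmult: "\<lbrakk>a \<in> carrier R; x \<in> carrier M; b \<in> carrier R\<rbrakk>
      \<Longrightarrow> (a \<odot>\<^bsub>M\<^esub> x) \<odot>\<^sub>r\<^bsub>M\<^esub> b = a \<odot>\<^bsub>M\<^esub> (x \<odot>\<^sub>r\<^bsub>M\<^esub> b)"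

definition left_hom ::
  "('a, 'r) ring_scheme \<Rightarrow> ('a, 'm, 'e) module_scheme \<Rightarrow> ('a, 'n, 'f) module_scheme \<Rightarrow> ('m \<Rightarrow> 'n) set"
  where "left_hom R M N = {f \<in> carrier M \<rightarrow> carrier N.
    (\<forall>x\<in>carrier M. \<forall>y\<in>carrier M. f (x \<oplus>\<^bsub>M\<^esub> y) = f x \<oplus>\<^bsub>N\<^esub> f y) \<and>
    (\<forall>a\<in>carrier R. \<forall>x\<in>carrier M. f (a \<odot>\<^bsub>M\<^esub> x) = a \<odot>\<^bsub>N\<^esub> f x)}"

text \<open>Right \<open>R\<close>-modules are treated as left modules over the opposite ring.\<close>

definition op_ring :: "('a, 'r) ring_scheme \<Rightarrow> ('a, 'r) ring_scheme"
  where "op_ring R = R\<lparr>monoid.mult := (\<lambda>a b. b \<otimes>\<^bsub>R\<^esub> a)\<rparr>"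

definition right_module :: "('a, 'm, 'e) bimod_scheme \<Rightarrow> ('a, 'm, 'e) bimod_scheme"
  where "right_module M = M\<lparr>smult := (\<lambda>a x. x \<odot>\<^sub>r\<^bsub>M\<^esub> a)\<rparr>"

definition right_hom ::
  "('a, 'r) ring_scheme \<Rightarrow> ('a, 'm, 'e) bimod_scheme \<Rightarrow> ('a, 'n, 'f) bimod_scheme \<Rightarrow> ('m \<Rightarrow> 'n) set"
  where "right_hom R M N = left_hom (op_ring R) (right_module M) (right_module N)"

definition bimod_hom ::
  "('a, 'r) ring_scheme \<Rightarrow> ('a, 'm, 'e) bimod_scheme \<Rightarrow> ('a, 'n, 'f) bimod_scheme \<Rightarrow> ('m \<Rightarrow> 'n) set"
  where "bimod_hom R M N = left_hom R M N \<inter> right_hom R M N"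

definition bimod_epi ::
  "('a, 'r) ring_scheme \<Rightarrow> ('a, 'm, 'e) bimod_scheme \<Rightarrow> ('a, 'n, 'f) bimod_scheme \<Rightarrow> ('m \<Rightarrow> 'n) set"
  where "bimod_epi R M N = {f \<in> bimod_hom R M N. f ` carrier M = carrier N}"

definition bimod_isomorphic ::
  "('a, 'r) ring_scheme \<Rightarrow> ('a, 'm, 'e) bimod_scheme \<Rightarrow> ('a, 'n, 'f) bimod_scheme \<Rightarrow> bool"
  where "bimod_isomorphic R M N \<longleftrightarrow> (\<exists>f\<in>bimod_hom R M N. bij_betw f (carrier M) (carrier N))"

text \<open>A subset of a ring, with all operations inherited from the ring.\<close>

definition sub_bimod :: "('a, 'r) ring_scheme \<Rightarrow> 'a set \<Rightarrow> ('a, 'a) bimod"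
  where "sub_bimod A X = \<lparr>carrier = X, monoid.mult = monoid.mult A, one = monoid.one A,
    ring.zero = ring.zero A, add = ring.add A,
    smult = monoid.mult A, rsmult = monoid.mult A\<rparr>"

abbreviation regular_bimod :: "('a, 'r) ring_scheme \<Rightarrow> ('a, 'a) bimod"
  where "regular_bimod R \<equiv> sub_bimod R (carrier R)"


section \<open>Finitely generated projective modules\<close>

definition finitely_generated :: "('a, 'r) ring_scheme \<Rightarrow> ('a, 'm, 'e) module_scheme \<Rightarrow> bool"
  where "finitely_generated R M \<longleftrightarrow> (\<exists>X. finite X \<and> X \<subseteq> carrier M \<and>
    (\<forall>m\<in>carrier M. \<exists>c\<in>X \<rightarrow> carrier R. m = (\<Oplus>\<^bsub>M\<^esub>x\<in>X. c x \<odot>\<^bsub>M\<^esub> x)))"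

text \<open>The free left module on a set, as finitely supported functions.\<close>

definition free_module :: "('a, 'r) ring_scheme \<Rightarrow> 'x set \<Rightarrow> ('a, 'x \<Rightarrow> 'a) module"
  where "free_module R X = \<lparr>carrier = {f \<in> X \<rightarrow>\<^sub>E carrier R. finite {x \<in> X. f x \<noteq> \<zero>\<^bsub>R\<^esub>}},
    monoid.mult = undefined, one = undefined,
    ring.zero = (\<lambda>x\<in>X. \<zero>\<^bsub>R\<^esub>), add = (\<lambda>f g. \<lambda>x\<in>X. f x \<oplus>\<^bsub>R\<^esub> g x), smult = (\<lambda>a f. \<lambda>x\<in>X. a \<otimes>\<^bsub>R\<^esub> f x)\<rparr>"

text \<open>Projective means (isomorphic to) a direct summand of a free module. Taking the basis to be a subset of
  the type of \<open>M\<close> is no restriction: if \<open>M\<close> is projective, the canonical map onto \<open>M\<close> from the free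
  module on \<open>carrier M\<close> splits.\<close>

definition projective :: "('a, 'r) ring_scheme \<Rightarrow> ('a, 'm, 'e) module_scheme \<Rightarrow> bool"
  where "projective R M \<longleftrightarrow> (\<exists>X :: 'm set. \<exists>i\<in>left_hom R M (free_module R X).
    \<exists>p\<in>left_hom R (free_module R X) M. \<forall>m\<in>carrier M. p (i m) = m)"


section \<open>Partially invertible bimodules\<close>

text \<open>Endomorphisms are represented by their extensional restrictions to the carrier, so that equality of
  functions is equality on the carrier.\<close>

definition End_right :: "('a, 'r) ring_scheme \<Rightarrow> ('a, 'm, 'e) bimod_scheme \<Rightarrow> ('a, 'm \<Rightarrow> 'm) bimod"
  where "End_right R P = \<lparr>carrier = right_hom R P P \<inter> extensional (carrier P),
    monoid.mult = undefined, one = undefined,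
    ring.zero = (\<lambda>x\<in>carrier P. \<zero>\<^bsub>P\<^esub>), add = (\<lambda>f g. \<lambda>x\<in>carrier P. f x \<oplus>\<^bsub>P\<^esub> g x),
    smult = (\<lambda>a f. \<lambda>x\<in>carrier P. a \<odot>\<^bsub>P\<^esub> f x), rsmult = (\<lambda>f a. \<lambda>x\<in>carrier P. f (a \<odot>\<^bsub>P\<^esub> x))\<rparr>"

definition End_left :: "('a, 'r) ring_scheme \<Rightarrow> ('a, 'm, 'e) bimod_scheme \<Rightarrow> ('a, 'm \<Rightarrow> 'm) bimod"
  where "End_left R P = \<lparr>carrier = left_hom R P P \<inter> extensional (carrier P),
    monoid.mult = undefined, one = undefined,
    ring.zero = (\<lambda>x\<in>carrier P. \<zero>\<^bsub>P\<^esub>), add = (\<lambda>f g. \<lambda>x\<in>carrier P. f x \<oplus>\<^bsub>P\<^esub> g x),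
    smult = (\<lambda>a f. \<lambda>x\<in>carrier P. f (x \<odot>\<^sub>r\<^bsub>P\<^esub> a)), rsmult = (\<lambda>f a. \<lambda>x\<in>carrier P. f x \<odot>\<^sub>r\<^bsub>P\<^esub> a)\<rparr>"

definition partially_invertible :: "('a, 'r) ring_scheme \<Rightarrow> ('a, 'm, 'e) bimod_scheme \<Rightarrow> bool"
  where "partially_invertible R P \<longleftrightarrow> bimodule R P \<and>
    finitely_generated R P \<and> projective R P \<and>
    finitely_generated (op_ring R) (right_module P) \<and> projective (op_ring R) (right_module P) \<and>
    (\<lambda>a. \<lambda>x\<in>carrier P. a \<odot>\<^bsub>P\<^esub> x) \<in> bimod_epi R (regular_bimod R) (End_right R P) \<and>
    (\<lambda>a. \<lambda>x\<in>carrier P. x \<odot>\<^sub>r\<^bsub>P\<^esub> a) \<in> bimod_epi R (regular_bimod R) (End_left R P)"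


section \<open>Tensor products\<close>

definition tensor_relations ::
  "('a, 'r) ring_scheme \<Rightarrow> ('a, 'p, 'e) bimod_scheme \<Rightarrow> ('a, 'q, 'f) bimod_scheme \<Rightarrow> ('p \<times> 'q \<Rightarrow>\<^sub>0 int) set"
  where "tensor_relations R P Q =
    {frag_of (p \<oplus>\<^bsub>P\<^esub> p', q) - frag_of (p, q) - frag_of (p', q) | p p' q.
      p \<in> carrier P \<and> p' \<in> carrier P \<and> q \<in> carrier Q} \<union>
    {frag_of (p, q \<oplus>\<^bsub>Q\<^esub> q') - frag_of (p, q) - frag_of (p, q') | p q q'.
      p \<in> carrier P \<and> q \<in> carrier Q \<and> q' \<in> carrier Q} \<union>
    {frag_of (p \<odot>\<^sub>r\<^bsub>P\<^esub> a, q) - frag_of (p, a \<odot>\<^bsub>Q\<^esub> q) | p a q.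
      p \<in> carrier P \<and> a \<in> carrier R \<and> q \<in> carrier Q}"

definition tensor_kernel ::
  "('a, 'r) ring_scheme \<Rightarrow> ('a, 'p, 'e) bimod_scheme \<Rightarrow> ('a, 'q, 'f) bimod_scheme \<Rightarrow> ('p \<times> 'q \<Rightarrow>\<^sub>0 int) set"
  where "tensor_kernel R P Q =
    generate (free_Abelian_group (carrier P \<times> carrier Q)) (tensor_relations R P Q)"

text \<open>The quotient of the free abelian group on \<open>P \<times> Q\<close> by the bilinearity and balancing relations. Its elements
  are cosets; the actions are induced by \<open>a (p, q) = (a p, q)\<close> and \<open>(p, q) a = (p, q a)\<close> on generators, and the
  union in their definitions is over representatives, each giving the same coset.\<close>

definition tensor ::
  "('a, 'r) ring_scheme \<Rightarrow> ('a, 'p, 'e) bimod_scheme \<Rightarrow> ('a, 'q, 'f) bimod_scheme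
    \<Rightarrow> ('a, ('p \<times> 'q \<Rightarrow>\<^sub>0 int) set) bimod"
  where "tensor R P Q = (let F = free_Abelian_group (carrier P \<times> carrier Q); K = tensor_kernel R P Q in
    \<lparr>carrier = carrier (F Mod K), monoid.mult = undefined, one = undefined,
     ring.zero = monoid.one (F Mod K), add = monoid.mult (F Mod K),
     smult = (\<lambda>a C. \<Union>c\<in>C. K #>\<^bsub>F\<^esub> frag_extend (\<lambda>(p, q). frag_of (a \<odot>\<^bsub>P\<^esub> p, q)) c),
     rsmult = (\<lambda>C a. \<Union>c\<in>C. K #>\<^bsub>F\<^esub> frag_extend (\<lambda>(p, q). frag_of (p, q \<odot>\<^sub>r\<^bsub>Q\<^esub> a)) c)\<rparr>)"


section \<open>The monoid of isomorphism classes\<close>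

text \<open>HOL cannot collect the bimodules over all types into one class, so classes consist of bimodules whose
  elements are of type \<open>nat \<Rightarrow> 'a\<close>. For the bimodules at issue nothing is lost: one that is finitely generated
  projective as a left module embeds as such in some \<open>R\<^sup>n\<close>, hence is isomorphic to a bimodule
  of this type. The bimodule \<open>M\<close> itself may live on any type.\<close>

definition iso_class :: "('a, 'r) ring_scheme \<Rightarrow> ('a, 'm, 'e) bimod_scheme \<Rightarrow> ('a, nat \<Rightarrow> 'a) bimod set"
  where "iso_class R M = {P. bimodule R P \<and> bimod_isomorphic R P M}"

text \<open>The product is the class of \<open>P \<otimes> Q\<close>, for any representatives \<open>P\<close> and \<open>Q\<close>; it is written as a union over
  all representatives, each giving the same class.\<close>

definition PicS :: "('a, 'r) ring_scheme \<Rightarrow> ('a, nat \<Rightarrow> 'a) bimod set monoid"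
  where "PicS R = \<lparr>carrier = {iso_class R P | P :: ('a, nat \<Rightarrow> 'a) bimod. partially_invertible R P},
    monoid.mult = (\<lambda>C D. \<Union>P\<in>C. \<Union>Q\<in>D. iso_class R (tensor R P Q)),
    one = iso_class R (regular_bimod R)\<rparr>"


section \<open>Unital partial representations\<close>

locale unital_partial_representation = G: group G + S: monoid S
  for G :: "('g, 'h) monoid_scheme" and S :: "('s, 't) monoid_scheme" and \<Phi> :: "'g \<Rightarrow> 's" +
  assumes closed: "\<Phi> \<in> carrier G \<rightarrow> carrier S"
    and unital: "\<Phi> \<one>\<^bsub>G\<^esub> = \<one>\<^bsub>S\<^esub>"
    and left_mult: "\<lbrakk>g \<in> carrier G; h \<in> carrier G\<rbrakk>
      \<Longrightarrow> \<Phi> (inv\<^bsub>G\<^esub> g) \<otimes>\<^bsub>S\<^esub> \<Phi> g \<otimes>\<^bsub>S\<^esub> \<Phi> h = \<Phi> (inv\<^bsub>G\<^esub> g) \<otimes>\<^bsub>S\<^esub> \<Phi> (g \<otimes>\<^bsub>G\<^esub> h)"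
    and right_mult: "\<lbrakk>g \<in> carrier G; h \<in> carrier G\<rbrakk>
      \<Longrightarrow> \<Phi> g \<otimes>\<^bsub>S\<^esub> \<Phi> h \<otimes>\<^bsub>S\<^esub> \<Phi> (inv\<^bsub>G\<^esub> h) = \<Phi> (g \<otimes>\<^bsub>G\<^esub> h) \<otimes>\<^bsub>S\<^esub> \<Phi> (inv\<^bsub>G\<^esub> h)"


section \<open>Epsilon-strongly graded rings\<close>

locale graded_ring = G: group G + A: ring A
  for G :: "('g, 'h) monoid_scheme" and A :: "('a, 'r) ring_scheme" and \<A> :: "'g \<Rightarrow> 'a set" +
  assumes component: "g \<in> carrier G \<Longrightarrow> additive_subgroup (\<A> g) A"
    and direct_sum: "a \<in> carrier A \<Longrightarrow> \<exists>!f. f \<in> (\<Pi>\<^sub>E g\<in>carrier G. \<A> g) \<and>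
      finite {g \<in> carrier G. f g \<noteq> \<zero>\<^bsub>A\<^esub>} \<and> a = (\<Oplus>\<^bsub>A\<^esub>g\<in>{g \<in> carrier G. f g \<noteq> \<zero>\<^bsub>A\<^esub>}. f g)"
    and component_mult: "\<lbrakk>g \<in> carrier G; h \<in> carrier G; x \<in> \<A> g; y \<in> \<A> h\<rbrakk>
      \<Longrightarrow> x \<otimes>\<^bsub>A\<^esub> y \<in> \<A> (g \<otimes>\<^bsub>G\<^esub> h)"

definition sums_of_products :: "('a, 'r) ring_scheme \<Rightarrow> 'a set \<Rightarrow> 'a set \<Rightarrow> 'a set"
  where "sums_of_products A X Y =
    {\<Oplus>\<^bsub>A\<^esub>i\<in>{..<n}. x i \<otimes>\<^bsub>A\<^esub> y i | (n::nat) x y. x \<in> {..<n} \<rightarrow> X \<and> y \<in> {..<n} \<rightarrow> Y}"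

definition epsilon_family ::
  "('g, 'h) monoid_scheme \<Rightarrow> ('a, 'r) ring_scheme \<Rightarrow> ('g \<Rightarrow> 'a set) \<Rightarrow> ('g \<Rightarrow> 'a) \<Rightarrow> bool"
  where "epsilon_family G A \<A> \<epsilon> \<longleftrightarrow> (\<forall>g\<in>carrier G.
    \<epsilon> g \<in> sums_of_products A (\<A> g) (\<A> (inv\<^bsub>G\<^esub> g)) \<and>
    (\<forall>a\<in>\<A> g. \<epsilon> g \<otimes>\<^bsub>A\<^esub> a = a \<and> a = a \<otimes>\<^bsub>A\<^esub> \<epsilon> (inv\<^bsub>G\<^esub> g)))"

definition epsilon_strongly_graded ::
  "('g, 'h) monoid_scheme \<Rightarrow> ('a, 'r) ring_scheme \<Rightarrow> ('g \<Rightarrow> 'a set) \<Rightarrow> bool"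
  where "epsilon_strongly_graded G A \<A> \<longleftrightarrow> graded_ring G A \<A> \<and> (\<exists>\<epsilon>. epsilon_family G A \<A> \<epsilon>)"

definition principal_component ::
  "('g, 'h) monoid_scheme \<Rightarrow> ('a, 'r) ring_scheme \<Rightarrow> ('g \<Rightarrow> 'a set) \<Rightarrow> ('a, 'r) ring_scheme"
  where "principal_component G A \<A> = A\<lparr>carrier := \<A> \<one>\<^bsub>G\<^esub>\<rparr>"

end

theory Submission
  imports Defs
begin

text \<open>If \<open>\<epsilon> g = \<Sum>\<^sub>i a\<^sub>i b\<^sub>i\<close> with \<open>a\<^sub>i \<in> \<A> g\<close> and \<open>b\<^sub>i \<in> \<A> (inv g)\<close>, then the \<open>a\<^sub>i\<close> with
  coordinates \<open>x \<mapsto> b\<^sub>i x\<close> form a right dual basis of \<open>\<A> g\<close>, the \<open>b\<^sub>i\<close> with coordinates \<open>x \<mapsto> x a\<^sub>i\<close> a left dual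
  basis of \<open>\<A> (inv g)\<close>, which makes the components partially invertible, and \<open>z \<mapsto> \<Sum>\<^sub>i a\<^sub>i \<otimes> b\<^sub>i z\<close> inverts the multiplication
  map \<open>\<A> g \<otimes> \<A> h \<rightarrow> \<epsilon> g \<A> (g h)\<close>. Both sides of each identity of a partial representation thus become the
  class of the same sub-bimodule, for instance \<open>\<epsilon> (inv g) \<A> h\<close>. That isomorphism classes form a monoid
  rests on the fact that a right endomorphism of \<open>P \<otimes> Q\<close>, read through a right dual basis of \<open>P\<close>, is a matrix
  of right endomorphisms of \<open>Q\<close>, that is of left multiplications.\<close>

section \<open>Additive maps and dual bases\<close>

text \<open>The product in \<open>PicS\<close> is a union over representatives of type
  \<open>nat \<Rightarrow> 'a\<close>, so it would be empty if one of the classes had no member. A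
  class can be computed with only once its bimodule has been injected into that type, and the
  injection is given by the coordinates in a left dual basis. Hence every bimodule that occurs as a
  factor, including \<open>P \<otimes> Q\<close> inside a triple product, has to be shown partially
  invertible first. The sub-bimodules \<open>\<epsilon> g \<A> h\<close> enter only through
  isomorphisms, and for them it is enough to be bimodules. Partial invertibility is two-sided. One
  half is isolated as a property of the right structure, the other is the same property of the
  opposite bimodule; passing to the opposite reverses the factors of a tensor product, so for tensor
  products one half implies the other. That the unit of \<open>A\<close> lies in
  \<open>\<A> \<one>\<close> is itself a consequence of the grading, and this is the one place where
  the direct sum decomposition enters.\<close>

definition add_hom :: "('m, 'e) ring_scheme \<Rightarrow> ('n, 'f) ring_scheme \<Rightarrow> ('m \<Rightarrow> 'n) set"
  where "add_hom M N = {f \<in> carrier M \<rightarrow> carrier N.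
    \<forall>x\<in>carrier M. \<forall>y\<in>carrier M. f (x \<oplus>\<^bsub>M\<^esub> y) = f x \<oplus>\<^bsub>N\<^esub> f y}"

lemma add_homI:
  assumes "\<And>x. x \<in> carrier M \<Longrightarrow> f x \<in> carrier N"
    and "\<And>x y. \<lbrakk>x \<in> carrier M; y \<in> carrier M\<rbrakk> \<Longrightarrow> f (x \<oplus>\<^bsub>M\<^esub> y) = f x \<oplus>\<^bsub>N\<^esub> f y"
  shows "f \<in> add_hom M N"
  using assms by (auto simp: add_hom_def)

lemma add_hom_closed: "\<lbrakk>f \<in> add_hom M N; x \<in> carrier M\<rbrakk> \<Longrightarrow> f x \<in> carrier N"
  by (auto simp: add_hom_def)

lemma add_hom_add:
  "\<lbrakk>f \<in> add_hom M N; x \<in> carrier M; y \<in> carrier M\<rbrakk> \<Longrightarrow> f (x \<oplus>\<^bsub>M\<^esub> y) = f x \<oplus>\<^bsub>N\<^esub> f y"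
  by (auto simp: add_hom_def)

lemma add_hom_compose: "\<lbrakk>f \<in> add_hom L M; g \<in> add_hom M N\<rbrakk> \<Longrightarrow> (\<lambda>x. g (f x)) \<in> add_hom L N"
  by (auto simp: add_hom_def Pi_def)

lemma add_hom_zero:
  assumes "f \<in> add_hom M N" "abelian_group M" "abelian_group N"
  shows "f \<zero>\<^bsub>M\<^esub> = \<zero>\<^bsub>N\<^esub>"
proof -
  interpret M: abelian_group M by fact
  interpret N: abelian_group N by fact
  have "f \<zero>\<^bsub>M\<^esub> \<oplus>\<^bsub>N\<^esub> f \<zero>\<^bsub>M\<^esub> = f \<zero>\<^bsub>M\<^esub>"
    using add_hom_add[OF assms(1), of "\<zero>\<^bsub>M\<^esub>" "\<zero>\<^bsub>M\<^esub>"] by simp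
  then show ?thesis
    using add_hom_closed[OF assms(1) M.zero_closed] by (metis N.add.l_cancel_one')
qed

text \<open>Only carrier, zero and addition of the records enter, so the same transfer of sums
  serves rings, modules and bimodules: scalars acting, coordinate functionals and maps out of tensor
  products.\<close>

lemma add_hom_finsum:
  assumes f: "f \<in> add_hom M N" "abelian_group M" "abelian_group N"
    and "finite I" "\<And>i. i \<in> I \<Longrightarrow> x i \<in> carrier M"
  shows "f (\<Oplus>\<^bsub>M\<^esub>i\<in>I. x i) = (\<Oplus>\<^bsub>N\<^esub>i\<in>I. f (x i))"
proof -
  interpret M: abelian_group M by fact
  interpret N: abelian_group N by fact
  show ?thesis
    using assms(4,5)
  proof (induction I)
    case empty
    then show ?case by (simp add: add_hom_zero[OF f])
  next
    case (insert i I)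
    then show ?case
      by (simp add: Pi_def add_hom_add[OF f(1)] add_hom_closed[OF f(1)])
  qed
qed

lemma add_hom_sum:
  assumes "abelian_group N" "\<And>i. i \<in> I \<Longrightarrow> f i \<in> add_hom M N"
  shows "(\<lambda>x. \<Oplus>\<^bsub>N\<^esub>i\<in>I. f i x) \<in> add_hom M N"
proof -
  interpret N: abelian_group N by fact
  show ?thesis
    using add_hom_closed[OF assms(2)]
    by (intro add_homI)
      (auto simp: Pi_def add_hom_add[OF assms(2)] simp flip: N.finsum_addf intro!: N.finsum_cong')
qed

lemma (in abelian_group) finsum_cartesian:
  assumes "finite I" "finite J" "\<And>i j. \<lbrakk>i \<in> I; j \<in> J\<rbrakk> \<Longrightarrow> g i j \<in> carrier G"
  shows "(\<Oplus>i\<in>I. \<Oplus>j\<in>J. g i j) = finsum G (\<lambda>(i, j). g i j) (I \<times> J)"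
  using assms
proof (induction I)
  case empty
  then show ?case by simp
next
  case (insert i I)
  have "finsum G (\<lambda>(i, j). g i j) (insert i I \<times> J)
      = finsum G (\<lambda>(i, j). g i j) ({i} \<times> J) \<oplus> finsum G (\<lambda>(i, j). g i j) (I \<times> J)"
    using insert by (subst finsum_Un_disjoint[symmetric]) (auto simp: insert_Times_insert intro!: arg_cong[where f = "finsum _ _"])
  also have "finsum G (\<lambda>(i, j). g i j) ({i} \<times> J) = (\<Oplus>j\<in>J. g i j)"
    using finsum_reindex[of "\<lambda>(i', j). g i' j" "\<lambda>j. (i, j)" J] insert
    by (auto simp: inj_on_def Pi_def image_def Times_insert_left intro!: arg_cong[where f = "finsum _ _"])
  finally show ?case
    using insert by (simp add: Pi_def finsum_closed)
qed

lemma (in abelian_group) finsum_fibres: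
  assumes "finite I" "\<And>i. i \<in> I \<Longrightarrow> g i \<in> carrier G"
  shows "(\<Oplus>y\<in>p ` I. \<Oplus>i\<in>{i \<in> I. p i = y}. g i) = (\<Oplus>i\<in>I. g i)"
proof -
  have "finsum G g (\<Union>y\<in>p ` I. {i \<in> I. p i = y}) = (\<Oplus>y\<in>p ` I. \<Oplus>i\<in>{i \<in> I. p i = y}. g i)"
    using assms by (intro add.finprod_UN_disjoint) (auto simp: pairwise_def disjnt_def)
  moreover have "(\<Union>y\<in>p ` I. {i \<in> I. p i = y}) = I"
    by auto
  ultimately show ?thesis by simp
qed

text \<open>The one-sided interface of a bimodule. A right module is an instance over the opposite
  ring, so facts about dual bases are proved once and apply to both sides.\<close>

locale left_module = R?: ring R + M?: abelian_group M
  for R :: "('a, 'r) ring_scheme" (structure) and M :: "('a, 'm, 'e) module_scheme" (structure) +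
  assumes smult_closed: "\<lbrakk>a \<in> carrier R; x \<in> carrier M\<rbrakk> \<Longrightarrow> a \<odot>\<^bsub>M\<^esub> x \<in> carrier M"
    and smult_l_distr: "\<lbrakk>a \<in> carrier R; b \<in> carrier R; x \<in> carrier M\<rbrakk>
      \<Longrightarrow> (a \<oplus>\<^bsub>R\<^esub> b) \<odot>\<^bsub>M\<^esub> x = a \<odot>\<^bsub>M\<^esub> x \<oplus>\<^bsub>M\<^esub> b \<odot>\<^bsub>M\<^esub> x"
    and smult_r_distr: "\<lbrakk>a \<in> carrier R; x \<in> carrier M; y \<in> carrier M\<rbrakk>
      \<Longrightarrow> a \<odot>\<^bsub>M\<^esub> (x \<oplus>\<^bsub>M\<^esub> y) = a \<odot>\<^bsub>M\<^esub> x \<oplus>\<^bsub>M\<^esub> a \<odot>\<^bsub>M\<^esub> y"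
    and smult_assoc: "\<lbrakk>a \<in> carrier R; b \<in> carrier R; x \<in> carrier M\<rbrakk>
      \<Longrightarrow> (a \<otimes>\<^bsub>R\<^esub> b) \<odot>\<^bsub>M\<^esub> x = a \<odot>\<^bsub>M\<^esub> (b \<odot>\<^bsub>M\<^esub> x)"
    and smult_one: "x \<in> carrier M \<Longrightarrow> \<one>\<^bsub>R\<^esub> \<odot>\<^bsub>M\<^esub> x = x"
begin

lemma smult_add_hom: "a \<in> carrier R \<Longrightarrow> (\<lambda>x. a \<odot>\<^bsub>M\<^esub> x) \<in> add_hom M M"
  by (simp add: add_homI smult_closed smult_r_distr)

lemma scalar_add_hom: "x \<in> carrier M \<Longrightarrow> (\<lambda>a. a \<odot>\<^bsub>M\<^esub> x) \<in> add_hom R M"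
  by (simp add: add_homI smult_closed smult_l_distr)

lemma smult_zero_l: "x \<in> carrier M \<Longrightarrow> \<zero>\<^bsub>R\<^esub> \<odot>\<^bsub>M\<^esub> x = \<zero>\<^bsub>M\<^esub>"
  using add_hom_zero[OF scalar_add_hom] R.abelian_group_axioms M.abelian_group_axioms by blast

lemma smult_finsum:
  assumes "finite I" "a \<in> carrier R" "\<And>i. i \<in> I \<Longrightarrow> x i \<in> carrier M"
  shows "a \<odot>\<^bsub>M\<^esub> (\<Oplus>\<^bsub>M\<^esub>i\<in>I. x i) = (\<Oplus>\<^bsub>M\<^esub>i\<in>I. a \<odot>\<^bsub>M\<^esub> x i)"
  using add_hom_finsum[OF smult_add_hom M.abelian_group_axioms M.abelian_group_axioms] assms by blast

lemma finsum_smult: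
  assumes "finite I" "x \<in> carrier M" "\<And>i. i \<in> I \<Longrightarrow> a i \<in> carrier R"
  shows "(\<Oplus>\<^bsub>R\<^esub>i\<in>I. a i) \<odot>\<^bsub>M\<^esub> x = (\<Oplus>\<^bsub>M\<^esub>i\<in>I. a i \<odot>\<^bsub>M\<^esub> x)"
  using add_hom_finsum[OF scalar_add_hom R.abelian_group_axioms M.abelian_group_axioms] assms by blast

end

section \<open>Homomorphisms, opposite rings and right modules\<close>

lemma left_hom_iff:
  "f \<in> left_hom R M N \<longleftrightarrow> f \<in> add_hom M N \<and>
    (\<forall>a\<in>carrier R. \<forall>x\<in>carrier M. f (a \<odot>\<^bsub>M\<^esub> x) = a \<odot>\<^bsub>N\<^esub> f x)"
  by (auto simp: left_hom_def add_hom_def)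

lemma carrier_op_ring [simp]: "carrier (op_ring R) = carrier R"
  and add_op_ring [simp]: "x \<oplus>\<^bsub>op_ring R\<^esub> y = x \<oplus>\<^bsub>R\<^esub> y"
  and zero_op_ring [simp]: "\<zero>\<^bsub>op_ring R\<^esub> = \<zero>\<^bsub>R\<^esub>"
  and one_op_ring [simp]: "\<one>\<^bsub>op_ring R\<^esub> = \<one>\<^bsub>R\<^esub>"
  and mult_op_ring [simp]: "x \<otimes>\<^bsub>op_ring R\<^esub> y = y \<otimes>\<^bsub>R\<^esub> x"
  by (simp_all add: op_ring_def)

lemma carrier_right_module [simp]: "carrier (right_module M) = carrier M"
  and add_right_module [simp]: "x \<oplus>\<^bsub>right_module M\<^esub> y = x \<oplus>\<^bsub>M\<^esub> y"
  and zero_right_module [simp]: "\<zero>\<^bsub>right_module M\<^esub> = \<zero>\<^bsub>M\<^esub>"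
  and smult_right_module [simp]: "a \<odot>\<^bsub>right_module M\<^esub> x = x \<odot>\<^sub>r\<^bsub>M\<^esub> a"
  and finsum_right_module [simp]: "finsum (right_module M) = finsum M"
  by (simp_all add: right_module_def finsum_def)

lemma carrier_sub_bimod [simp]: "carrier (sub_bimod A X) = X"
  and add_sub_bimod [simp]: "x \<oplus>\<^bsub>sub_bimod A X\<^esub> y = x \<oplus>\<^bsub>A\<^esub> y"
  and zero_sub_bimod [simp]: "\<zero>\<^bsub>sub_bimod A X\<^esub> = \<zero>\<^bsub>A\<^esub>"
  and smult_sub_bimod [simp]: "x \<odot>\<^bsub>sub_bimod A X\<^esub> y = x \<otimes>\<^bsub>A\<^esub> y"
  and rsmult_sub_bimod [simp]: "x \<odot>\<^sub>r\<^bsub>sub_bimod A X\<^esub> y = x \<otimes>\<^bsub>A\<^esub> y"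
  by (simp_all add: sub_bimod_def)

lemma add_hom_regular [simp]: "add_hom M (regular_bimod R) = add_hom M R"
  by (simp add: add_hom_def)

lemma add_hom_from_right_module [simp]: "add_hom (right_module M) N = add_hom M N"
  by (simp add: add_hom_def)

lemma add_hom_to_right_module [simp]: "add_hom M (right_module N) = add_hom M N"
  by (simp add: add_hom_def)

lemma right_hom_iff:
  "f \<in> right_hom R M N \<longleftrightarrow> f \<in> add_hom M N \<and>
    (\<forall>a\<in>carrier R. \<forall>x\<in>carrier M. f (x \<odot>\<^sub>r\<^bsub>M\<^esub> a) = f x \<odot>\<^sub>r\<^bsub>N\<^esub> a)"
  by (auto simp: right_hom_def left_hom_iff)

lemma ring_op_ring: "ring R \<Longrightarrow> ring (op_ring R)"
proof -
  assume "ring R"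
  then interpret ring R .
  show ?thesis
    by (intro ringI abelian_groupI monoidI)
      (auto simp: a_ac m_assoc l_distr r_distr intro: add.l_inv_ex)
qed

context bimodule
begin

lemma left_module: "left_module R M"
  by unfold_locales
    (auto simp: smult_closed smult_l_distr smult_r_distr smult_assoc smult_one)

lemma left_module_right_module: "left_module (op_ring R) (right_module M)"
proof (intro left_module.intro left_module_axioms.intro ring_op_ring abelian_groupI)
  show "ring R" by unfold_locales
qed (auto simp: rsmult_closed rsmult_l_distr rsmult_r_distr rsmult_assoc rsmult_one
    M.a_ac intro: M.add.l_inv_ex)

end

section \<open>Dual bases and finitely generated projective modules\<close>

definition left_dual_basis ::
  "('a, 'r) ring_scheme \<Rightarrow> ('a, 'm, 'e) module_scheme \<Rightarrow> 'i set \<Rightarrow> ('i \<Rightarrow> 'm) \<Rightarrow> ('i \<Rightarrow> 'm \<Rightarrow> 'a) \<Rightarrow> bool"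
  where "left_dual_basis R M I p f \<longleftrightarrow> finite I \<and> p \<in> I \<rightarrow> carrier M \<and>
    (\<forall>i\<in>I. f i \<in> left_hom R M (regular_bimod R)) \<and>
    (\<forall>x\<in>carrier M. (\<Oplus>\<^bsub>M\<^esub>i\<in>I. f i x \<odot>\<^bsub>M\<^esub> p i) = x)"

context left_module
begin

text \<open>\<open>finitely_generated\<close> and \<open>projective\<close> speak of sets of
  elements of \<open>M\<close>, while the dual bases met later are indexed by numbers or pairs and
  may repeat an element. Adding up the coordinates that belong to equal elements leaves every
  expansion unchanged.\<close>

lemma left_dual_basis_collate:
  assumes "left_dual_basis R M I p f"
  shows "left_dual_basis R M (p ` I) (\<lambda>x. x) (\<lambda>y m. \<Oplus>\<^bsub>R\<^esub>i\<in>{i \<in> I. p i = y}. f i m)"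
proof -
  have fin: "finite I" and p: "\<And>i. i \<in> I \<Longrightarrow> p i \<in> carrier M"
    and f: "\<And>i. i \<in> I \<Longrightarrow> f i \<in> add_hom M R"
    and fs: "\<And>i a x. \<lbrakk>i \<in> I; a \<in> carrier R; x \<in> carrier M\<rbrakk> \<Longrightarrow> f i (a \<odot>\<^bsub>M\<^esub> x) = a \<otimes>\<^bsub>R\<^esub> f i x"
    and sum: "\<And>x. x \<in> carrier M \<Longrightarrow> (\<Oplus>\<^bsub>M\<^esub>i\<in>I. f i x \<odot>\<^bsub>M\<^esub> p i) = x"
    using assms by (auto simp: left_dual_basis_def left_hom_iff)
  note fc = add_hom_closed[OF f]
  show ?thesis
    unfolding left_dual_basis_def
  proof (intro conjI ballI)
    fix y
    show "(\<lambda>m. \<Oplus>\<^bsub>R\<^esub>i\<in>{i \<in> I. p i = y}. f i m) \<in> left_hom R M (regular_bimod R)"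
      using fin f fc
      by (auto simp: left_hom_iff fs R.finsum_rdistr Pi_def intro!: add_hom_sum R.abelian_group_axioms R.finsum_cong')
  next
    fix x assume x: "x \<in> carrier M"
    have "(\<Oplus>\<^bsub>M\<^esub>y\<in>p ` I. (\<Oplus>\<^bsub>R\<^esub>i\<in>{i \<in> I. p i = y}. f i x) \<odot>\<^bsub>M\<^esub> y)
        = (\<Oplus>\<^bsub>M\<^esub>y\<in>p ` I. \<Oplus>\<^bsub>M\<^esub>i\<in>{i \<in> I. p i = y}. f i x \<odot>\<^bsub>M\<^esub> p i)"
      using fin p fc x
      by (intro M.finsum_cong')
        (auto simp: finsum_smult smult_closed simp del: M.finsum_closed intro!: M.finsum_cong' M.finsum_closed
          trans[OF finsum_smult])
    then show "(\<Oplus>\<^bsub>M\<^esub>y\<in>p ` I. (\<Oplus>\<^bsub>R\<^esub>i\<in>{i \<in> I. p i = y}. f i x) \<odot>\<^bsub>M\<^esub> y) = x"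
      using M.finsum_fibres[of I "\<lambda>i. f i x \<odot>\<^bsub>M\<^esub> p i" p] fin p fc x sum by (simp add: smult_closed)
  qed (use fin p in auto)
qed

text \<open>The coordinates map \<open>M\<close> into the free module on the basis, and evaluation
  of formal combinations maps back; the expansion formula says that the composite is the
  identity.\<close>

lemma left_dual_basis_imp_fgp:
  assumes "left_dual_basis R M I p f"
  shows "finitely_generated R M \<and> projective R M"
proof -
  obtain X F where *: "left_dual_basis R M X (\<lambda>x. x) F"
    using left_dual_basis_collate[OF assms] by blast
  then have fin: "finite X" and X: "\<And>i. i \<in> X \<Longrightarrow> i \<in> carrier M"
    and F: "\<And>i. i \<in> X \<Longrightarrow> F i \<in> add_hom M R"
    and Fs: "\<And>i a x. \<lbrakk>i \<in> X; a \<in> carrier R; x \<in> carrier M\<rbrakk> \<Longrightarrow> F i (a \<odot>\<^bsub>M\<^esub> x) = a \<otimes>\<^bsub>R\<^esub> F i x"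
    and sum: "\<And>x. x \<in> carrier M \<Longrightarrow> (\<Oplus>\<^bsub>M\<^esub>i\<in>X. F i x \<odot>\<^bsub>M\<^esub> i) = x"
    by (auto simp: left_dual_basis_def left_hom_iff)
  note Fc = add_hom_closed[OF F]
  have "finitely_generated R M"
    unfolding finitely_generated_def
  proof (intro exI[of _ X] conjI ballI)
    fix m assume "m \<in> carrier M"
    then show "\<exists>c\<in>X \<rightarrow> carrier R. m = (\<Oplus>\<^bsub>M\<^esub>x\<in>X. c x \<odot>\<^bsub>M\<^esub> x)"
      using sum Fc by (intro bexI[of _ "\<lambda>x. F x m"]) auto
  qed (use fin X in auto)
  moreover have "projective R M"
    unfolding projective_def
  proof (intro exI[of _ X] bexI ballI)
    show "(\<lambda>m. \<lambda>x\<in>X. F x m) \<in> left_hom R M (free_module R X)"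
      using fin Fc by (auto simp: left_hom_def free_module_def add_hom_add[OF F] Fs)
    show "(\<lambda>g. \<Oplus>\<^bsub>M\<^esub>x\<in>X. g x \<odot>\<^bsub>M\<^esub> x) \<in> left_hom R (free_module R X) M"
      using X fin
      by (auto simp: left_hom_def free_module_def smult_finsum smult_closed PiE_def Pi_def smult_l_distr
          simp flip: smult_assoc M.finsum_addf intro!: M.finsum_cong')
    show "(\<Oplus>\<^bsub>M\<^esub>x\<in>X. (\<lambda>x\<in>X. F x m) x \<odot>\<^bsub>M\<^esub> x) = m" if "m \<in> carrier M" for m
    proof -
      have "(\<Oplus>\<^bsub>M\<^esub>x\<in>X. (\<lambda>x\<in>X. F x m) x \<odot>\<^bsub>M\<^esub> x) = (\<Oplus>\<^bsub>M\<^esub>x\<in>X. F x m \<odot>\<^bsub>M\<^esub> x)"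
        using that X Fc by (intro M.finsum_cong') (auto simp: smult_closed)
      then show ?thesis using sum that by simp
    qed
  qed
  ultimately show ?thesis ..
qed

text \<open>A homomorphism out of a free module is determined by the unit vectors. The finite set
  \<open>S\<close> is any set outside of which \<open>g\<close> vanishes, not the exact support, so
  that the induction can erase one coordinate at a time.\<close>

lemma free_module_hom_expansion:
  assumes p: "p \<in> left_hom R (free_module R Y) M"
    and "finite S" "S \<subseteq> Y" "g \<in> Y \<rightarrow>\<^sub>E carrier R" "\<And>y. y \<in> Y - S \<Longrightarrow> g y = \<zero>\<^bsub>R\<^esub>"
  shows "p g = (\<Oplus>\<^bsub>M\<^esub>y\<in>S. g y \<odot>\<^bsub>M\<^esub> p (\<lambda>x\<in>Y. if x = y then \<one>\<^bsub>R\<^esub> else \<zero>\<^bsub>R\<^esub>))"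
proof -
  define e where "e y = (\<lambda>x\<in>Y. if x = y then \<one>\<^bsub>R\<^esub> else \<zero>\<^bsub>R\<^esub>)" for y
  let ?F = "free_module R Y"
  have e: "e y \<in> carrier ?F" if "y \<in> Y" for y
    using that by (auto simp: e_def free_module_def intro: finite_subset[of _ "{y}"])
  have pc: "p g \<in> carrier M" if "g \<in> carrier ?F" for g
    using p that by (auto simp: left_hom_def)
  have padd: "p (\<lambda>x\<in>Y. g x \<oplus>\<^bsub>R\<^esub> h x) = p g \<oplus>\<^bsub>M\<^esub> p h" if "g \<in> carrier ?F" "h \<in> carrier ?F" for g h
    using p that by (auto simp: left_hom_def free_module_def)
  have psm: "p (\<lambda>x\<in>Y. a \<otimes>\<^bsub>R\<^esub> g x) = a \<odot>\<^bsub>M\<^esub> p g" if "g \<in> carrier ?F" "a \<in> carrier R" for g a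
    using p that by (auto simp: left_hom_def free_module_def)
  show ?thesis
    unfolding e_def[symmetric]
    using assms(2-5)
  proof (induction S arbitrary: g)
    case empty
    \<comment> \<open>A function that vanishes everywhere is \<open>\<zero>\<close> times itself, so
      homogeneity of \<open>p\<close> alone gives the value zero.\<close>
    then have "g = (\<lambda>x\<in>Y. \<zero>\<^bsub>R\<^esub> \<otimes>\<^bsub>R\<^esub> g x)"
      by (auto intro!: PiE_ext[of _ Y "\<lambda>_. carrier R"])
    moreover have g: "g \<in> carrier ?F"
      using empty by (auto simp: free_module_def intro: finite_subset[of _ "{}"])
    ultimately have "p g = \<zero>\<^bsub>M\<^esub>"
      using psm[of g "\<zero>\<^bsub>R\<^esub>"] pc[OF g] by (simp add: smult_zero_l)
    then show ?case by simp
  next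
    case (insert y S)
    have y: "y \<in> Y" "g y \<in> carrier R" using insert by auto
    \<comment> \<open>\<open>h\<close> is \<open>g\<close> with the coordinate at \<open>y\<close>
      erased: \<open>g\<close> is \<open>g y\<close> times a unit vector plus \<open>h\<close>, and
      \<open>h\<close> vanishes outside \<open>S\<close>.\<close>
    define h where "h = (\<lambda>x\<in>Y. if x = y then \<zero>\<^bsub>R\<^esub> else g x)"
    have h: "h \<in> Y \<rightarrow>\<^sub>E carrier R" "\<And>z. z \<in> Y - S \<Longrightarrow> h z = \<zero>\<^bsub>R\<^esub>"
      using insert.prems by (auto simp: h_def)
    then have hF: "h \<in> carrier ?F"
      using \<open>finite S\<close> by (auto simp: free_module_def intro: finite_subset[of _ S])
    have eF: "(\<lambda>x\<in>Y. g y \<otimes>\<^bsub>R\<^esub> e y x) \<in> carrier ?F"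
      using y by (auto simp: e_def free_module_def intro: finite_subset[of _ "{y}"])
    have "g = (\<lambda>x\<in>Y. (\<lambda>x\<in>Y. g y \<otimes>\<^bsub>R\<^esub> e y x) x \<oplus>\<^bsub>R\<^esub> h x)"
      using insert.prems y by (intro PiE_ext[of g Y "\<lambda>_. carrier R"]) (auto simp: h_def e_def PiE_def Pi_def)
    then have "p g = g y \<odot>\<^bsub>M\<^esub> p (e y) \<oplus>\<^bsub>M\<^esub> p h"
      using padd[OF eF hF] psm[OF e[OF y(1)] y(2)] by simp
    also have "p h = (\<Oplus>\<^bsub>M\<^esub>z\<in>S. h z \<odot>\<^bsub>M\<^esub> p (e z))"
      using insert h by auto
    also have "\<dots> = (\<Oplus>\<^bsub>M\<^esub>z\<in>S. g z \<odot>\<^bsub>M\<^esub> p (e z))"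
      using insert.hyps insert.prems
      by (intro M.finsum_cong') (auto simp: h_def Pi_def PiE_def smult_closed pc e)
    finally show ?case
      using insert.hyps insert.prems y
      by (subst M.finsum_insert) (auto simp: Pi_def PiE_def smult_closed pc e)
  qed
qed

text \<open>The splitting \<open>i\<close> may land in a free module of infinite rank. Each of the
  finitely many generators has finite support there, so every \<open>i m\<close> is supported in one
  finite set \<open>S\<close>. The coordinates in \<open>S\<close> and the images under
  \<open>p\<close> of the unit vectors then form a dual basis.\<close>

lemma fgp_imp_left_dual_basis:
  assumes "finitely_generated R M" "projective R M"
  shows "\<exists>(I :: 'm set) p f. left_dual_basis R M I p f"
proof -
  obtain X where X: "finite X" "X \<subseteq> carrier M"
    and gen: "\<And>m. m \<in> carrier M \<Longrightarrow> \<exists>c\<in>X \<rightarrow> carrier R. m = (\<Oplus>\<^bsub>M\<^esub>x\<in>X. c x \<odot>\<^bsub>M\<^esub> x)"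
    using assms(1) by (auto simp: finitely_generated_def)
  obtain Y :: "'m set" and i p where i: "i \<in> left_hom R M (free_module R Y)"
    and p: "p \<in> left_hom R (free_module R Y) M" and pi: "\<And>m. m \<in> carrier M \<Longrightarrow> p (i m) = m"
    using assms(2) by (auto simp: projective_def)
  have ic: "i m \<in> carrier (free_module R Y)" if "m \<in> carrier M" for m
    using i that by (auto simp: left_hom_def)
  have iy: "(\<lambda>m. i m y) \<in> left_hom R M (regular_bimod R)" if "y \<in> Y" for y
    using i that by (auto simp: left_hom_def free_module_def)
  then have iyh: "(\<lambda>m. i m y) \<in> add_hom M R" if "y \<in> Y" for y
    using that by (auto simp: left_hom_iff)
  define S where "S = (\<Union>x\<in>X. {y \<in> Y. i x y \<noteq> \<zero>\<^bsub>R\<^esub>})"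
  have "finite S" "S \<subseteq> Y"
    using X ic by (auto simp: S_def free_module_def)
  have supp: "i m y = \<zero>\<^bsub>R\<^esub>" if m: "m \<in> carrier M" and y: "y \<in> Y - S" for m y
  proof -
    obtain c where c: "c \<in> X \<rightarrow> carrier R" "m = (\<Oplus>\<^bsub>M\<^esub>x\<in>X. c x \<odot>\<^bsub>M\<^esub> x)"
      using gen[OF m] by auto
    have "i m y = (\<Oplus>\<^bsub>R\<^esub>x\<in>X. i (c x \<odot>\<^bsub>M\<^esub> x) y)"
      unfolding c(2) using y c X
      by (intro add_hom_finsum[OF iyh M.abelian_group_axioms R.abelian_group_axioms]) (auto intro!: smult_closed)
    also have "\<dots> = (\<Oplus>\<^bsub>R\<^esub>x\<in>X. \<zero>\<^bsub>R\<^esub>)"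
      using y c(1) X iy[of y] by (intro R.finsum_cong') (auto simp: left_hom_iff S_def Pi_def subset_iff)
    finally show ?thesis by simp
  qed
  let ?e = "\<lambda>y. p (\<lambda>x\<in>Y. if x = y then \<one>\<^bsub>R\<^esub> else \<zero>\<^bsub>R\<^esub>)"
  have e: "?e y \<in> carrier M" if "y \<in> Y" for y
  proof -
    have "(\<lambda>x\<in>Y. if x = y then \<one>\<^bsub>R\<^esub> else \<zero>\<^bsub>R\<^esub>) \<in> carrier (free_module R Y)"
      using that by (auto simp: free_module_def intro: finite_subset[of _ "{y}"])
    then show ?thesis using p by (auto simp: left_hom_def)
  qed
  have "left_dual_basis R M S ?e (\<lambda>y m. i m y)"
    unfolding left_dual_basis_def
  proof (intro conjI ballI)
    fix m assume m: "m \<in> carrier M"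
    then have "i m \<in> Y \<rightarrow>\<^sub>E carrier R"
      using ic[OF m] by (simp add: free_module_def)
    then show "(\<Oplus>\<^bsub>M\<^esub>y\<in>S. i m y \<odot>\<^bsub>M\<^esub> ?e y) = m"
      using free_module_hom_expansion[OF p \<open>finite S\<close> \<open>S \<subseteq> Y\<close>, of "i m"] supp[OF m] pi[OF m] by simp
  qed (use \<open>finite S\<close> \<open>S \<subseteq> Y\<close> e iy in auto)
  then show ?thesis by blast
qed

text \<open>Expand \<open>g y\<close> in \<open>M\<close> and apply \<open>f\<close>. This carries a
  dual basis over to a direct summand, in particular along an isomorphism.\<close>

lemma left_dual_basis_retract:
  assumes N: "left_module R N" and f: "f \<in> left_hom R M N" and g: "g \<in> left_hom R N M"
    and fg: "\<And>y. y \<in> carrier N \<Longrightarrow> f (g y) = y"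
    and db: "left_dual_basis R M I p h"
  shows "left_dual_basis R N I (\<lambda>i. f (p i)) (\<lambda>i y. h i (g y))"
proof -
  interpret N: left_module R N by fact
  have fin: "finite I" and p: "\<And>i. i \<in> I \<Longrightarrow> p i \<in> carrier M"
    and h: "\<And>i. i \<in> I \<Longrightarrow> h i \<in> add_hom M R"
    and hs: "\<And>i a x. \<lbrakk>i \<in> I; a \<in> carrier R; x \<in> carrier M\<rbrakk> \<Longrightarrow> h i (a \<odot>\<^bsub>M\<^esub> x) = a \<otimes>\<^bsub>R\<^esub> h i x"
    and sum: "\<And>x. x \<in> carrier M \<Longrightarrow> (\<Oplus>\<^bsub>M\<^esub>i\<in>I. h i x \<odot>\<^bsub>M\<^esub> p i) = x"
    using db by (auto simp: left_dual_basis_def left_hom_iff)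
  have f': "f \<in> add_hom M N" "\<And>a x. \<lbrakk>a \<in> carrier R; x \<in> carrier M\<rbrakk> \<Longrightarrow> f (a \<odot>\<^bsub>M\<^esub> x) = a \<odot>\<^bsub>N\<^esub> f x"
    and g': "g \<in> add_hom N M" "\<And>a x. \<lbrakk>a \<in> carrier R; x \<in> carrier N\<rbrakk> \<Longrightarrow> g (a \<odot>\<^bsub>N\<^esub> x) = a \<odot>\<^bsub>M\<^esub> g x"
    using f g by (auto simp: left_hom_iff)
  note [simp] = add_hom_closed[OF h] add_hom_closed[OF f'(1)] add_hom_closed[OF g'(1)]
  show ?thesis
    unfolding left_dual_basis_def
  proof (intro conjI ballI)
    show "finite I" "(\<lambda>i. f (p i)) \<in> I \<rightarrow> carrier N"
      using fin p by auto
    show "(\<lambda>y. h i (g y)) \<in> left_hom R N (regular_bimod R)" if "i \<in> I" for i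
      using that h hs g' by (auto simp: left_hom_iff intro: add_hom_compose)
    fix y assume y: "y \<in> carrier N"
    have "y = f (\<Oplus>\<^bsub>M\<^esub>i\<in>I. h i (g y) \<odot>\<^bsub>M\<^esub> p i)"
      using y by (simp add: sum fg)
    also have "\<dots> = (\<Oplus>\<^bsub>N\<^esub>i\<in>I. f (h i (g y) \<odot>\<^bsub>M\<^esub> p i))"
      using y p fin by (intro add_hom_finsum[OF f'(1) M.abelian_group_axioms N.M.abelian_group_axioms]) (auto simp: smult_closed)
    also have "\<dots> = (\<Oplus>\<^bsub>N\<^esub>i\<in>I. h i (g y) \<odot>\<^bsub>N\<^esub> f (p i))"
      using y p by (intro N.M.finsum_cong') (auto simp: f'(2) N.smult_closed)
    finally show "(\<Oplus>\<^bsub>N\<^esub>i\<in>I. h i (g y) \<odot>\<^bsub>N\<^esub> f (p i)) = y" by simp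
  qed
qed

end

section \<open>Tensor products of bimodules\<close>

text \<open>The pure tensor, as the coset of a generator.\<close>

definition ten ::
  "('a, 'r) ring_scheme \<Rightarrow> ('a, 'p, 'e) bimod_scheme \<Rightarrow> ('a, 'q, 'f) bimod_scheme
    \<Rightarrow> 'p \<Rightarrow> 'q \<Rightarrow> ('p \<times> 'q \<Rightarrow>\<^sub>0 int) set"
  where "ten R P Q p q =
    tensor_kernel R P Q #>\<^bsub>free_Abelian_group (carrier P \<times> carrier Q)\<^esub> frag_of (p, q)"

text \<open>The target is only an abelian group: among the maps to be lifted are coordinates into
  \<open>R\<close> and maps with one tensor factor held fixed, which in general are additive without
  being bimodule maps.\<close>

definition balanced ::
  "('a, 'r) ring_scheme \<Rightarrow> ('a, 'p, 'e) bimod_scheme \<Rightarrow> ('a, 'q, 'f) bimod_scheme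
    \<Rightarrow> ('n, 'g) ring_scheme \<Rightarrow> ('p \<Rightarrow> 'q \<Rightarrow> 'n) \<Rightarrow> bool"
  where "balanced R P Q N \<beta> \<longleftrightarrow>
    (\<forall>q\<in>carrier Q. (\<lambda>p. \<beta> p q) \<in> add_hom P N) \<and> (\<forall>p\<in>carrier P. \<beta> p \<in> add_hom Q N) \<and>
    (\<forall>p\<in>carrier P. \<forall>a\<in>carrier R. \<forall>q\<in>carrier Q. \<beta> (p \<odot>\<^sub>r\<^bsub>P\<^esub> a) q = \<beta> p (a \<odot>\<^bsub>Q\<^esub> q))"

locale bimodule_pair = P: bimodule R P + Q: bimodule R Q
  for R :: "('a, 'r) ring_scheme" and P :: "('a, 'p, 'e) bimod_scheme" and Q :: "('a, 'q, 'f) bimod_scheme"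
begin

abbreviation F :: "('p \<times> 'q \<Rightarrow>\<^sub>0 int) monoid"
  where "F \<equiv> free_Abelian_group (carrier P \<times> carrier Q)"

abbreviation K :: "('p \<times> 'q \<Rightarrow>\<^sub>0 int) set"
  where "K \<equiv> tensor_kernel R P Q"

abbreviation T :: "('a, ('p \<times> 'q \<Rightarrow>\<^sub>0 int) set) bimod"
  where "T \<equiv> tensor R P Q"

abbreviation tensor_elem :: "'p \<Rightarrow> 'q \<Rightarrow> ('p \<times> 'q \<Rightarrow>\<^sub>0 int) set" (infixl \<open>\<otimes>\<^sub>t\<close> 75)
  where "p \<otimes>\<^sub>t q \<equiv> ten R P Q p q"

interpretation F: comm_group F
  by (rule abelian_free_Abelian_group)

lemma relations_in_free: "tensor_relations R P Q \<subseteq> carrier F"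
proof -
  have 1: "frag_of x - frag_of y \<in> carrier F"
    if "x \<in> carrier P \<times> carrier Q" "y \<in> carrier P \<times> carrier Q" for x y
    using that F.m_closed[of "frag_of x" "- frag_of y"] by auto
  have 2: "frag_of x - frag_of y - frag_of z \<in> carrier F"
    if "x \<in> carrier P \<times> carrier Q" "y \<in> carrier P \<times> carrier Q" "z \<in> carrier P \<times> carrier Q" for x y z
    using that 1[of x y] F.m_closed[of "frag_of x - frag_of y" "- frag_of z"] by auto
  show ?thesis
    by (auto simp: tensor_relations_def simp del: carrier_free_Abelian_group_iff
        intro!: 1 2 P.smult_closed P.rsmult_closed Q.smult_closed Q.rsmult_closed)
qed

lemma keys_relations: "x \<in> tensor_relations R P Q \<Longrightarrow> Poly_Mapping.keys x \<subseteq> carrier P \<times> carrier Q"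
  using subsetD[OF relations_in_free] by simp

lemma kernel_subgroup: "subgroup K F"
  unfolding tensor_kernel_def by (rule F.generate_is_subgroup[OF relations_in_free])

lemma kernel_normal: "K \<lhd> F"
  using kernel_subgroup by (simp add: F.normal_iff_subgroup)

lemma keys_kernel: "k \<in> K \<Longrightarrow> Poly_Mapping.keys k \<subseteq> carrier P \<times> carrier Q"
  using subgroup.mem_carrier[OF kernel_subgroup] by simp

lemma coset_eqI:
  assumes "Poly_Mapping.keys c \<subseteq> carrier P \<times> carrier Q" "c' - c \<in> K"
  shows "K #>\<^bsub>F\<^esub> c = K #>\<^bsub>F\<^esub> c'"
proof (rule F.repr_independence[OF _ _ kernel_subgroup])
  show "c' \<in> K #>\<^bsub>F\<^esub> c"
    using assms(2) by (force simp: r_coset_def)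
qed (use assms(1) in simp)

lemma mem_cosetD: "c' \<in> K #>\<^bsub>F\<^esub> c \<Longrightarrow> \<exists>k\<in>K. c' = k + c"
  by (auto simp: r_coset_def)

lemma mem_coset_self: "Poly_Mapping.keys c \<subseteq> carrier P \<times> carrier Q \<Longrightarrow> c \<in> K #>\<^bsub>F\<^esub> c"
  using F.rcos_self[OF _ kernel_subgroup] by simp

text \<open>\<open>generate\<close> adjoins the relations and their inverses, so negation is to be
  handled for relations only and not for arbitrary elements of the kernel.\<close>

lemma kernel_induct [consumes 1, case_names zero relation minus add]:
  assumes "k \<in> K"
    and "S 0" "\<And>k. k \<in> tensor_relations R P Q \<Longrightarrow> S k"
    and "\<And>k. k \<in> tensor_relations R P Q \<Longrightarrow> S (- k)"
    and "\<And>k k'. \<lbrakk>k \<in> K; k' \<in> K; S k; S k'\<rbrakk> \<Longrightarrow> S (k + k')"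
  shows "S k"
  using assms(1) unfolding tensor_kernel_def
proof (induction rule: generate.induct)
  case (inv h)
  then show ?case using assms(4) keys_relations by simp
next
  case (eng h1 h2)
  then show ?case using assms(5)[unfolded tensor_kernel_def] by simp
qed (use assms in auto)

section \<open>The two actions on cosets\<close>

lemma frag_extend_kernel:
  assumes "\<And>x. x \<in> tensor_relations R P Q \<Longrightarrow> frag_extend h x \<in> tensor_relations R P Q" "k \<in> K"
  shows "frag_extend h k \<in> K"
  using assms(2)
proof (induction rule: kernel_induct)
  case zero
  then show ?case using subgroup.one_closed[OF kernel_subgroup] by simp
next
  case (relation k)
  then show ?case using assms(1) by (simp add: tensor_kernel_def generate.incl)
next
  case (minus k)
  then have *: "frag_extend h k \<in> K" "Poly_Mapping.keys (frag_extend h k) \<subseteq> carrier P \<times> carrier Q"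
    using assms(1) keys_relations by (simp_all add: tensor_kernel_def generate.incl)
  show ?case using subgroup.m_inv_closed[OF kernel_subgroup *(1)] *(2) by (simp add: frag_extend_minus)
next
  case (add k k')
  then show ?case using subgroup.m_closed[OF kernel_subgroup, of "frag_extend h k" "frag_extend h k'"]
    by (simp add: frag_extend_add)
qed

lemma keys_frag_extend_of:
  assumes "\<And>x. x \<in> carrier P \<times> carrier Q \<Longrightarrow> h x \<in> carrier P \<times> carrier Q"
    and "Poly_Mapping.keys c \<subseteq> carrier P \<times> carrier Q"
  shows "Poly_Mapping.keys (frag_extend (\<lambda>x. frag_of (h x)) c) \<subseteq> carrier P \<times> carrier Q"
proof (rule subset_trans[OF keys_frag_extend], rule UN_least)
  fix x assume "x \<in> Poly_Mapping.keys c"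
  then have "h x \<in> carrier P \<times> carrier Q"
    using assms by blast
  then show "Poly_Mapping.keys (frag_of (h x)) \<subseteq> carrier P \<times> carrier Q"
    by simp
qed

text \<open>The actions are defined by a union over the representatives of a coset. A map of
  generators that preserves the relations preserves the kernel, so all representatives give the same
  coset and the union collapses to it.\<close>

lemma coset_extend:
  assumes rel: "\<And>x. x \<in> tensor_relations R P Q \<Longrightarrow> frag_extend (\<lambda>x. frag_of (h x)) x \<in> tensor_relations R P Q"
    and h: "\<And>x. x \<in> carrier P \<times> carrier Q \<Longrightarrow> h x \<in> carrier P \<times> carrier Q"
    and c: "Poly_Mapping.keys c \<subseteq> carrier P \<times> carrier Q"
  shows "(\<Union>c\<in>K #>\<^bsub>F\<^esub> c. K #>\<^bsub>F\<^esub> frag_extend (\<lambda>x. frag_of (h x)) c)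
    = K #>\<^bsub>F\<^esub> frag_extend (\<lambda>x. frag_of (h x)) c"
proof -
  let ?h = "frag_extend (\<lambda>x. frag_of (h x))"
  have "K #>\<^bsub>F\<^esub> ?h c' = K #>\<^bsub>F\<^esub> ?h c" if "c' \<in> K #>\<^bsub>F\<^esub> c" for c'
  proof -
    obtain k where k: "k \<in> K" "c' = k + c" using mem_cosetD[OF \<open>c' \<in> K #>\<^bsub>F\<^esub> c\<close>] by blast
    have "?h c' - ?h c \<in> K"
      using frag_extend_kernel[OF rel k(1)] k(2) by (simp add: frag_extend_add)
    then show ?thesis
      by (intro coset_eqI[OF keys_frag_extend_of[OF h c], symmetric])
  qed
  then show ?thesis using mem_coset_self[OF c] by blast
qed

text \<open>Each of the three kinds of relation goes to one of the same kind: additivity in the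
  factor acted on by distributivity, the balancing relation because the two actions on
  \<open>P\<close> commute.\<close>

lemma smult_relations:
  assumes "a \<in> carrier R" "x \<in> tensor_relations R P Q"
  shows "frag_extend (\<lambda>x. frag_of (case x of (p, q) \<Rightarrow> (a \<odot>\<^bsub>P\<^esub> p, q))) x \<in> tensor_relations R P Q"
  using assms(2) unfolding tensor_relations_def Un_iff
proof (elim disjE, goal_cases)
  case 1
  then obtain p p' q where x: "x = frag_of (p \<oplus>\<^bsub>P\<^esub> p', q) - frag_of (p, q) - frag_of (p', q)"
    and "p \<in> carrier P" "p' \<in> carrier P" "q \<in> carrier Q" by blast
  then show ?case
    using assms(1) P.smult_closed[of a p] P.smult_closed[of a p']
    by (intro disjI1 CollectI exI[of _ "a \<odot>\<^bsub>P\<^esub> p"] exI[of _ "a \<odot>\<^bsub>P\<^esub> p'"] exI[of _ q])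
      (simp add: frag_extend_diff P.smult_r_distr)
next
  case 2
  then obtain p q q' where x: "x = frag_of (p, q \<oplus>\<^bsub>Q\<^esub> q') - frag_of (p, q) - frag_of (p, q')"
    and "p \<in> carrier P" "q \<in> carrier Q" "q' \<in> carrier Q" by blast
  then show ?case
    using assms(1) P.smult_closed[of a p]
    by (intro disjI1 disjI2 CollectI exI[of _ "a \<odot>\<^bsub>P\<^esub> p"] exI[of _ q] exI[of _ q'])
      (simp add: frag_extend_diff)
next
  case 3
  then obtain p b q where x: "x = frag_of (p \<odot>\<^sub>r\<^bsub>P\<^esub> b, q) - frag_of (p, b \<odot>\<^bsub>Q\<^esub> q)"
    and "p \<in> carrier P" "b \<in> carrier R" "q \<in> carrier Q" by blast
  then show ?case
    using assms(1) P.smult_closed[of a p]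
    by (intro disjI2 CollectI exI[of _ "a \<odot>\<^bsub>P\<^esub> p"] exI[of _ b] exI[of _ q])
      (simp add: frag_extend_diff P.smult_rsmult)
qed

lemma rsmult_relations:
  assumes "a \<in> carrier R" "x \<in> tensor_relations R P Q"
  shows "frag_extend (\<lambda>x. frag_of (case x of (p, q) \<Rightarrow> (p, q \<odot>\<^sub>r\<^bsub>Q\<^esub> a))) x \<in> tensor_relations R P Q"
  using assms(2) unfolding tensor_relations_def Un_iff
proof (elim disjE, goal_cases)
  case 1
  then obtain p p' q where x: "x = frag_of (p \<oplus>\<^bsub>P\<^esub> p', q) - frag_of (p, q) - frag_of (p', q)"
    and "p \<in> carrier P" "p' \<in> carrier P" "q \<in> carrier Q" by blast
  then show ?case
    using assms(1) Q.rsmult_closed[of q a]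
    by (intro disjI1 CollectI exI[of _ p] exI[of _ p'] exI[of _ "q \<odot>\<^sub>r\<^bsub>Q\<^esub> a"])
      (simp add: frag_extend_diff)
next
  case 2
  then obtain p q q' where x: "x = frag_of (p, q \<oplus>\<^bsub>Q\<^esub> q') - frag_of (p, q) - frag_of (p, q')"
    and "p \<in> carrier P" "q \<in> carrier Q" "q' \<in> carrier Q" by blast
  then show ?case
    using assms(1) Q.rsmult_closed[of q a] Q.rsmult_closed[of q' a]
    by (intro disjI1 disjI2 CollectI exI[of _ p] exI[of _ "q \<odot>\<^sub>r\<^bsub>Q\<^esub> a"] exI[of _ "q' \<odot>\<^sub>r\<^bsub>Q\<^esub> a"])
      (simp add: frag_extend_diff Q.rsmult_l_distr)
next
  case 3
  then obtain p b q where x: "x = frag_of (p \<odot>\<^sub>r\<^bsub>P\<^esub> b, q) - frag_of (p, b \<odot>\<^bsub>Q\<^esub> q)"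
    and "p \<in> carrier P" "b \<in> carrier R" "q \<in> carrier Q" by blast
  then show ?case
    using assms(1) Q.rsmult_closed[of q a]
    by (intro disjI2 CollectI exI[of _ p] exI[of _ b] exI[of _ "q \<odot>\<^sub>r\<^bsub>Q\<^esub> a"])
      (simp add: frag_extend_diff Q.smult_rsmult)
qed

section \<open>The additive group of the tensor product\<close>

lemma carrier_tensor: "carrier T = (\<lambda>c. K #>\<^bsub>F\<^esub> c) ` {c. Poly_Mapping.keys c \<subseteq> carrier P \<times> carrier Q}"
  unfolding tensor_def Let_def by (auto simp: carrier_FactGroup)

lemma zero_tensor: "\<zero>\<^bsub>T\<^esub> = K #>\<^bsub>F\<^esub> 0"
  using F.coset_join2[OF F.one_closed kernel_subgroup] subgroup.one_closed[OF kernel_subgroup]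
  by (simp add: tensor_def Let_def)

lemma add_tensor:
  assumes "Poly_Mapping.keys c \<subseteq> carrier P \<times> carrier Q" "Poly_Mapping.keys d \<subseteq> carrier P \<times> carrier Q"
  shows "(K #>\<^bsub>F\<^esub> c) \<oplus>\<^bsub>T\<^esub> (K #>\<^bsub>F\<^esub> d) = K #>\<^bsub>F\<^esub> (c + d)"
  using normal.rcos_sum[OF kernel_normal, of c d] assms by (simp add: tensor_def Let_def)

lemma smult_tensor_coset:
  assumes "a \<in> carrier R" "Poly_Mapping.keys c \<subseteq> carrier P \<times> carrier Q"
  shows "a \<odot>\<^bsub>T\<^esub> (K #>\<^bsub>F\<^esub> c) = K #>\<^bsub>F\<^esub> frag_extend (\<lambda>x. frag_of (case x of (p, q) \<Rightarrow> (a \<odot>\<^bsub>P\<^esub> p, q))) c"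
proof -
  have "a \<odot>\<^bsub>T\<^esub> (K #>\<^bsub>F\<^esub> c) = (\<Union>c\<in>K #>\<^bsub>F\<^esub> c. K #>\<^bsub>F\<^esub> frag_extend (\<lambda>x. frag_of (case x of (p, q) \<Rightarrow> (a \<odot>\<^bsub>P\<^esub> p, q))) c)"
    by (simp add: tensor_def Let_def prod.case_distrib[of frag_of])
  also have "\<dots> = K #>\<^bsub>F\<^esub> frag_extend (\<lambda>x. frag_of (case x of (p, q) \<Rightarrow> (a \<odot>\<^bsub>P\<^esub> p, q))) c"
    using assms by (intro coset_extend smult_relations) (auto simp: P.smult_closed)
  finally show ?thesis .
qed

lemma rsmult_tensor_coset:
  assumes "a \<in> carrier R" "Poly_Mapping.keys c \<subseteq> carrier P \<times> carrier Q"
  shows "(K #>\<^bsub>F\<^esub> c) \<odot>\<^sub>r\<^bsub>T\<^esub> a = K #>\<^bsub>F\<^esub> frag_extend (\<lambda>x. frag_of (case x of (p, q) \<Rightarrow> (p, q \<odot>\<^sub>r\<^bsub>Q\<^esub> a))) c"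
proof -
  have "(K #>\<^bsub>F\<^esub> c) \<odot>\<^sub>r\<^bsub>T\<^esub> a = (\<Union>c\<in>K #>\<^bsub>F\<^esub> c. K #>\<^bsub>F\<^esub> frag_extend (\<lambda>x. frag_of (case x of (p, q) \<Rightarrow> (p, q \<odot>\<^sub>r\<^bsub>Q\<^esub> a))) c)"
    by (simp add: tensor_def Let_def prod.case_distrib[of frag_of])
  also have "\<dots> = K #>\<^bsub>F\<^esub> frag_extend (\<lambda>x. frag_of (case x of (p, q) \<Rightarrow> (p, q \<odot>\<^sub>r\<^bsub>Q\<^esub> a))) c"
    using assms by (intro coset_extend rsmult_relations) (auto simp: Q.rsmult_closed)
  finally show ?thesis .
qed

lemma keys_add_closed:
  fixes c d :: "'p \<times> 'q \<Rightarrow>\<^sub>0 int"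
  shows "\<lbrakk>Poly_Mapping.keys c \<subseteq> carrier P \<times> carrier Q; Poly_Mapping.keys d \<subseteq> carrier P \<times> carrier Q\<rbrakk>
    \<Longrightarrow> Poly_Mapping.keys (c + d) \<subseteq> carrier P \<times> carrier Q"
  using F.m_closed[of c d] by simp

lemma abelian_group_tensor: "abelian_group T"
proof (rule abelian_groupI, goal_cases)
  case (6 x)
  then obtain c where c: "x = K #>\<^bsub>F\<^esub> c" "Poly_Mapping.keys c \<subseteq> carrier P \<times> carrier Q"
    by (auto simp: carrier_tensor)
  then show ?case
    by (intro bexI[of _ "K #>\<^bsub>F\<^esub> (- c)"]) (auto simp: carrier_tensor zero_tensor add_tensor)
qed (auto simp: carrier_tensor zero_tensor add_tensor keys_add_closed add_ac)

lemma smult_add_hom_tensor: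
  assumes "a \<in> carrier R"
  shows "(\<lambda>x. a \<odot>\<^bsub>T\<^esub> x) \<in> add_hom T T"
proof -
  have *: "Poly_Mapping.keys (frag_extend (\<lambda>x. frag_of (case x of (p, q) \<Rightarrow> (a \<odot>\<^bsub>P\<^esub> p, q))) c)
      \<subseteq> carrier P \<times> carrier Q" if "Poly_Mapping.keys c \<subseteq> carrier P \<times> carrier Q" for c
    using that assms by (intro keys_frag_extend_of) (auto simp: P.smult_closed)
  show ?thesis
    by (intro add_homI)
      (auto simp: carrier_tensor smult_tensor_coset[OF assms] add_tensor keys_add_closed frag_extend_add * )
qed

lemma rsmult_add_hom_tensor:
  assumes "a \<in> carrier R"
  shows "(\<lambda>x. x \<odot>\<^sub>r\<^bsub>T\<^esub> a) \<in> add_hom T T"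
proof -
  have *: "Poly_Mapping.keys (frag_extend (\<lambda>x. frag_of (case x of (p, q) \<Rightarrow> (p, q \<odot>\<^sub>r\<^bsub>Q\<^esub> a))) c)
      \<subseteq> carrier P \<times> carrier Q" if "Poly_Mapping.keys c \<subseteq> carrier P \<times> carrier Q" for c
    using that assms by (intro keys_frag_extend_of) (auto simp: Q.rsmult_closed)
  show ?thesis
    by (intro add_homI)
      (auto simp: carrier_tensor rsmult_tensor_coset[OF assms] add_tensor keys_add_closed frag_extend_add * )
qed

section \<open>Pure tensors\<close>

lemma ten_closed: "\<lbrakk>p \<in> carrier P; q \<in> carrier Q\<rbrakk> \<Longrightarrow> p \<otimes>\<^sub>t q \<in> carrier T"
  by (auto simp: ten_def carrier_tensor)

lemma smult_ten: "\<lbrakk>a \<in> carrier R; p \<in> carrier P; q \<in> carrier Q\<rbrakk> \<Longrightarrow> a \<odot>\<^bsub>T\<^esub> (p \<otimes>\<^sub>t q) = (a \<odot>\<^bsub>P\<^esub> p) \<otimes>\<^sub>t q"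
  by (simp add: ten_def smult_tensor_coset)

lemma rsmult_ten: "\<lbrakk>a \<in> carrier R; p \<in> carrier P; q \<in> carrier Q\<rbrakk> \<Longrightarrow> (p \<otimes>\<^sub>t q) \<odot>\<^sub>r\<^bsub>T\<^esub> a = p \<otimes>\<^sub>t (q \<odot>\<^sub>r\<^bsub>Q\<^esub> a)"
  by (simp add: ten_def rsmult_tensor_coset)

lemma relation_in_kernel: "x \<in> tensor_relations R P Q \<Longrightarrow> x \<in> K"
  by (simp add: tensor_kernel_def generate.incl)

lemma ten_add_l:
  assumes "p \<in> carrier P" "p' \<in> carrier P" "q \<in> carrier Q"
  shows "(p \<oplus>\<^bsub>P\<^esub> p') \<otimes>\<^sub>t q = p \<otimes>\<^sub>t q \<oplus>\<^bsub>T\<^esub> p' \<otimes>\<^sub>t q"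
proof -
  have "frag_of (p \<oplus>\<^bsub>P\<^esub> p', q) - (frag_of (p, q) + frag_of (p', q)) \<in> K"
    unfolding diff_diff_add[symmetric]
    by (rule relation_in_kernel) (use assms in \<open>unfold tensor_relations_def, blast\<close>)
  then show ?thesis
    using assms coset_eqI[of "frag_of (p, q) + frag_of (p', q)" "frag_of (p \<oplus>\<^bsub>P\<^esub> p', q)"]
    by (simp add: ten_def add_tensor keys_add_closed)
qed

lemma ten_add_r:
  assumes "p \<in> carrier P" "q \<in> carrier Q" "q' \<in> carrier Q"
  shows "p \<otimes>\<^sub>t (q \<oplus>\<^bsub>Q\<^esub> q') = p \<otimes>\<^sub>t q \<oplus>\<^bsub>T\<^esub> p \<otimes>\<^sub>t q'"
proof -
  have "frag_of (p, q \<oplus>\<^bsub>Q\<^esub> q') - (frag_of (p, q) + frag_of (p, q')) \<in> K"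
    unfolding diff_diff_add[symmetric]
    by (rule relation_in_kernel) (use assms in \<open>unfold tensor_relations_def, blast\<close>)
  then show ?thesis
    using assms coset_eqI[of "frag_of (p, q) + frag_of (p, q')" "frag_of (p, q \<oplus>\<^bsub>Q\<^esub> q')"]
    by (simp add: ten_def add_tensor keys_add_closed)
qed

lemma ten_balanced:
  assumes "p \<in> carrier P" "a \<in> carrier R" "q \<in> carrier Q"
  shows "(p \<odot>\<^sub>r\<^bsub>P\<^esub> a) \<otimes>\<^sub>t q = p \<otimes>\<^sub>t (a \<odot>\<^bsub>Q\<^esub> q)"
proof -
  have "frag_of (p \<odot>\<^sub>r\<^bsub>P\<^esub> a, q) - frag_of (p, a \<odot>\<^bsub>Q\<^esub> q) \<in> K"
    by (rule relation_in_kernel) (use assms in \<open>unfold tensor_relations_def, blast\<close>)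
  then show ?thesis
    using assms coset_eqI[of "frag_of (p, a \<odot>\<^bsub>Q\<^esub> q)" "frag_of (p \<odot>\<^sub>r\<^bsub>P\<^esub> a, q)"]
    by (simp add: ten_def Q.smult_closed)
qed

lemma balanced_ten: "balanced R P Q T (\<otimes>\<^sub>t)"
  by (auto simp: balanced_def ten_closed ten_add_l ten_add_r ten_balanced intro!: add_homI)

lemma ten_add_hom_l: "q \<in> carrier Q \<Longrightarrow> (\<lambda>p. p \<otimes>\<^sub>t q) \<in> add_hom P T"
  and ten_add_hom_r: "p \<in> carrier P \<Longrightarrow> (\<lambda>q. p \<otimes>\<^sub>t q) \<in> add_hom Q T"
  using balanced_ten by (auto simp: balanced_def)

lemma ten_zero_l: "q \<in> carrier Q \<Longrightarrow> \<zero>\<^bsub>P\<^esub> \<otimes>\<^sub>t q = \<zero>\<^bsub>T\<^esub>"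
  by (rule add_hom_zero[OF ten_add_hom_l P.M.abelian_group_axioms abelian_group_tensor])

text \<open>Negatives need no separate case, since \<open>\<ominus> (p \<otimes> q) = (\<ominus> p) \<otimes> q\<close>.\<close>

lemma tensor_induct [consumes 1, case_names ten add]:
  assumes "x \<in> carrier T"
    and ten: "\<And>p q. \<lbrakk>p \<in> carrier P; q \<in> carrier Q\<rbrakk> \<Longrightarrow> S (p \<otimes>\<^sub>t q)"
    and add: "\<And>x y. \<lbrakk>x \<in> carrier T; y \<in> carrier T; S x; S y\<rbrakk> \<Longrightarrow> S (x \<oplus>\<^bsub>T\<^esub> y)"
  shows "S x"
proof -
  interpret T: abelian_group T by (rule abelian_group_tensor)
  obtain c where c: "x = K #>\<^bsub>F\<^esub> c" "Poly_Mapping.keys c \<subseteq> carrier P \<times> carrier Q"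
    using assms(1) by (auto simp: carrier_tensor)
  have zero: "S \<zero>\<^bsub>T\<^esub>"
    using ten[of "\<zero>\<^bsub>P\<^esub>" "\<zero>\<^bsub>Q\<^esub>"] by (simp add: ten_zero_l)
  have minus_ten: "\<ominus>\<^bsub>T\<^esub> (p \<otimes>\<^sub>t q) = (\<ominus>\<^bsub>P\<^esub> p) \<otimes>\<^sub>t q" if "p \<in> carrier P" "q \<in> carrier Q" for p q
    using ten_add_l[of "\<ominus>\<^bsub>P\<^esub> p" p q] that
    by (intro T.minus_equality) (auto simp: P.M.l_neg ten_zero_l ten_closed)
  \<comment> \<open>The induction principle of the free abelian group builds elements by
    differences, so the property is carried along for a coset together with its negative.\<close>
  have "S (K #>\<^bsub>F\<^esub> c) \<and> S (\<ominus>\<^bsub>T\<^esub> (K #>\<^bsub>F\<^esub> c))"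
    using c(2)
  proof (induction rule: free_Abelian_group_induct[consumes 1, case_names zero diff of])
    case zero
    show ?case using \<open>S \<zero>\<^bsub>T\<^esub>\<close> T.add.inv_one by (simp add: zero_tensor[symmetric] a_inv_def)
  next
    case (diff c d)
    have cT: "K #>\<^bsub>F\<^esub> c \<in> carrier T" "K #>\<^bsub>F\<^esub> d \<in> carrier T"
      using diff by (auto simp: carrier_tensor)
    have "\<ominus>\<^bsub>T\<^esub> (K #>\<^bsub>F\<^esub> d) = K #>\<^bsub>F\<^esub> (- d)"
      using diff cT by (intro T.minus_equality) (auto simp: add_tensor zero_tensor carrier_tensor)
    then have eq: "K #>\<^bsub>F\<^esub> (c - d) = (K #>\<^bsub>F\<^esub> c) \<oplus>\<^bsub>T\<^esub> \<ominus>\<^bsub>T\<^esub> (K #>\<^bsub>F\<^esub> d)"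
      using diff by (simp add: add_tensor)
    then have "\<ominus>\<^bsub>T\<^esub> (K #>\<^bsub>F\<^esub> (c - d)) = \<ominus>\<^bsub>T\<^esub> (K #>\<^bsub>F\<^esub> c) \<oplus>\<^bsub>T\<^esub> (K #>\<^bsub>F\<^esub> d)"
      using cT by (simp add: T.minus_add)
    then show ?case
      using eq diff cT add by simp
  next
    case (of x)
    then show ?case
      using ten minus_ten by (cases x) (auto simp: ten_def[symmetric])
  qed
  then show ?thesis using c by simp
qed

section \<open>Universal property and bimodule structure\<close>

lemma tensor_lift:
  assumes N: "abelian_group N" and \<beta>: "balanced R P Q N \<beta>"
  obtains \<phi> where "\<phi> \<in> add_hom T N" "\<And>p q. \<lbrakk>p \<in> carrier P; q \<in> carrier Q\<rbrakk> \<Longrightarrow> \<phi> (p \<otimes>\<^sub>t q) = \<beta> p q"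
proof -
  interpret N: abelian_group N by fact
  have \<beta>c: "\<beta> p q \<in> carrier N" if "p \<in> carrier P" "q \<in> carrier Q" for p q
    using \<beta> that by (auto simp: balanced_def intro: add_hom_closed)
  have "(\<lambda>(p, q). \<beta> p q) ` (carrier P \<times> carrier Q) \<subseteq> carrier N"
    using \<beta>c by auto
  \<comment> \<open>\<open>h\<close> extends \<open>\<beta>\<close> to the free abelian group. It
    kills the relations because \<open>\<beta>\<close> is balanced, hence it kills the kernel and
    factors through the cosets.\<close>
  then obtain h where h: "h \<in> hom F (add_monoid N)"
    and h_of': "\<And>x. x \<in> carrier P \<times> carrier Q \<Longrightarrow> h (frag_of x) = (case x of (p, q) \<Rightarrow> \<beta> p q)"
    by (rule N.add.free_Abelian_group_universal) blast
  have h_of: "h (frag_of (p, q)) = \<beta> p q" if "p \<in> carrier P" "q \<in> carrier Q" for p q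
    using h_of' that by simp
  have hc: "h c \<in> carrier N" if "Poly_Mapping.keys c \<subseteq> carrier P \<times> carrier Q" for c
    using hom_in_carrier[OF h, of c] that by simp
  have h_add: "h (c + d) = h c \<oplus>\<^bsub>N\<^esub> h d"
    if "Poly_Mapping.keys c \<subseteq> carrier P \<times> carrier Q" "Poly_Mapping.keys d \<subseteq> carrier P \<times> carrier Q" for c d
    using hom_mult[OF h, of c d] that by simp
  have h_0: "h 0 = \<zero>\<^bsub>N\<^esub>"
    using h_add[of 0 0] hc[of 0] by (simp add: N.add.l_cancel_one)
  have h_minus: "h (- c) = \<ominus>\<^bsub>N\<^esub> h c" if "Poly_Mapping.keys c \<subseteq> carrier P \<times> carrier Q" for c
    using that h_add[of "- c" c] hc by (intro N.minus_equality[symmetric]) (auto simp: h_0)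
  have h_diff: "h (c - d) = h c \<ominus>\<^bsub>N\<^esub> h d"
    if "Poly_Mapping.keys c \<subseteq> carrier P \<times> carrier Q" "Poly_Mapping.keys d \<subseteq> carrier P \<times> carrier Q" for c d
    using h_add[of c "- d"] that by (simp add: h_minus N.minus_eq)
  have keys_diff: "Poly_Mapping.keys (c - d) \<subseteq> carrier P \<times> carrier Q"
    if "Poly_Mapping.keys c \<subseteq> carrier P \<times> carrier Q" "Poly_Mapping.keys d \<subseteq> carrier P \<times> carrier Q" for c d :: "'p \<times> 'q \<Rightarrow>\<^sub>0 int"
    using keys_add_closed[of c "- d"] that by simp
  have cancel: "u \<oplus>\<^bsub>N\<^esub> v \<ominus>\<^bsub>N\<^esub> u \<ominus>\<^bsub>N\<^esub> v = \<zero>\<^bsub>N\<^esub>" if "u \<in> carrier N" "v \<in> carrier N" for u v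
    using that N.r_neg[of "u \<oplus>\<^bsub>N\<^esub> v"] by (simp add: N.minus_eq N.minus_add N.a_assoc)
  have rel: "h x = \<zero>\<^bsub>N\<^esub>" if "x \<in> tensor_relations R P Q" for x
    using that unfolding tensor_relations_def Un_iff
  proof (elim disjE, goal_cases)
    case 1
    then obtain p p' q where x: "x = frag_of (p \<oplus>\<^bsub>P\<^esub> p', q) - frag_of (p, q) - frag_of (p', q)"
      and *: "p \<in> carrier P" "p' \<in> carrier P" "q \<in> carrier Q" by blast
    have "\<beta> (p \<oplus>\<^bsub>P\<^esub> p') q = \<beta> p q \<oplus>\<^bsub>N\<^esub> \<beta> p' q"
      using \<beta> * by (auto simp: balanced_def add_hom_def)
    then show ?case
      using * \<beta>c[of p q] \<beta>c[of p' q] unfolding x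
      by (simp add: h_diff keys_diff h_of cancel)
  next
    case 2
    then obtain p q q' where x: "x = frag_of (p, q \<oplus>\<^bsub>Q\<^esub> q') - frag_of (p, q) - frag_of (p, q')"
      and *: "p \<in> carrier P" "q \<in> carrier Q" "q' \<in> carrier Q" by blast
    have "\<beta> p (q \<oplus>\<^bsub>Q\<^esub> q') = \<beta> p q \<oplus>\<^bsub>N\<^esub> \<beta> p q'"
      using \<beta> * by (auto simp: balanced_def add_hom_def)
    then show ?case
      using * \<beta>c[of p q] \<beta>c[of p q'] unfolding x
      by (simp add: h_diff keys_diff h_of cancel)
  next
    case 3
    then obtain p b q where x: "x = frag_of (p \<odot>\<^sub>r\<^bsub>P\<^esub> b, q) - frag_of (p, b \<odot>\<^bsub>Q\<^esub> q)"
      and *: "p \<in> carrier P" "b \<in> carrier R" "q \<in> carrier Q" by blast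
    have "\<beta> (p \<odot>\<^sub>r\<^bsub>P\<^esub> b) q = \<beta> p (b \<odot>\<^bsub>Q\<^esub> q)"
      using \<beta> * by (auto simp: balanced_def)
    then show ?case
      using * \<beta>c[of p "b \<odot>\<^bsub>Q\<^esub> q"] unfolding x
      by (simp add: h_diff h_of P.rsmult_closed Q.smult_closed N.minus_eq N.r_neg)
  qed
  have ker: "h k = \<zero>\<^bsub>N\<^esub>" if "k \<in> K" for k
    using that
  proof (induction rule: kernel_induct)
    case (minus k)
    then show ?case by (simp add: h_minus rel keys_relations)
  qed (auto simp: h_0 rel h_add keys_kernel)
  have "h x = h y" if xy: "x \<in> carrier F" "y \<in> carrier F" and eq: "K #>\<^bsub>F\<^esub> x = K #>\<^bsub>F\<^esub> y" for x y
  proof -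
    obtain k where k: "k \<in> K" "x = k + y"
      using mem_cosetD[of x y] mem_coset_self[of x] xy eq by auto
    then show ?thesis using xy hc[of y] h_add[of k y] keys_kernel[OF k(1)] ker[OF k(1)] by simp
  qed
  then obtain g where g: "g \<in> hom (F Mod K) (add_monoid N)" "\<And>x. x \<in> carrier F \<Longrightarrow> g (K #>\<^bsub>F\<^esub> x) = h x"
    using FactGroup_universal[OF h kernel_normal] by blast
  show thesis
  proof (rule that[of g])
    show "g \<in> add_hom T N"
    proof (rule add_homI)
      fix x y assume "x \<in> carrier T" "y \<in> carrier T"
      then show "g x \<in> carrier N" "g (x \<oplus>\<^bsub>T\<^esub> y) = g x \<oplus>\<^bsub>N\<^esub> g y"
        using g(2) by (auto simp: carrier_tensor add_tensor keys_add_closed h_add hc)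
    qed
    show "g (p \<otimes>\<^sub>t q) = \<beta> p q" if "p \<in> carrier P" "q \<in> carrier Q" for p q
      using that g(2) h_of by (simp add: ten_def)
  qed
qed

lemma tensor_hom_eqI:
  assumes "f \<in> add_hom T N" "g \<in> add_hom T N"
    and "\<And>p q. \<lbrakk>p \<in> carrier P; q \<in> carrier Q\<rbrakk> \<Longrightarrow> f (p \<otimes>\<^sub>t q) = g (p \<otimes>\<^sub>t q)" "x \<in> carrier T"
  shows "f x = g x"
  using assms(4) by (induction rule: tensor_induct)
    (auto simp: assms(3) add_hom_add[OF assms(1)] add_hom_add[OF assms(2)])

lemma bimodule_tensor: "bimodule R T"
proof -
  interpret T: abelian_group T by (rule abelian_group_tensor)
  note sh = smult_add_hom_tensor and rh = rsmult_add_hom_tensor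
  note cl = add_hom_closed[OF sh] add_hom_closed[OF rh]
  note ad = add_hom_add[OF sh] add_hom_add[OF rh]
  note sm = smult_ten rsmult_ten P.smult_closed Q.rsmult_closed
  \<comment> \<open>Interchange of the two middle summands, as needed in the inductive step for a
    sum of tensors when the scalar is a sum as well.\<close>
  have ac: "(x \<oplus>\<^bsub>T\<^esub> y) \<oplus>\<^bsub>T\<^esub> (z \<oplus>\<^bsub>T\<^esub> w) = (x \<oplus>\<^bsub>T\<^esub> z) \<oplus>\<^bsub>T\<^esub> (y \<oplus>\<^bsub>T\<^esub> w)"
    if "x \<in> carrier T" "y \<in> carrier T" "z \<in> carrier T" "w \<in> carrier T" for x y z w
    using that by (simp add: T.a_ac)
  show ?thesis
  proof (intro bimodule.intro bimodule_axioms.intro)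
    fix a x assume "a \<in> carrier R" "x \<in> carrier T"
    then show "a \<odot>\<^bsub>T\<^esub> x \<in> carrier T" "x \<odot>\<^sub>r\<^bsub>T\<^esub> a \<in> carrier T"
      by (auto simp: cl)
  next
    fix a x y assume "a \<in> carrier R" "x \<in> carrier T" "y \<in> carrier T"
    then show "a \<odot>\<^bsub>T\<^esub> (x \<oplus>\<^bsub>T\<^esub> y) = a \<odot>\<^bsub>T\<^esub> x \<oplus>\<^bsub>T\<^esub> a \<odot>\<^bsub>T\<^esub> y"
      "(x \<oplus>\<^bsub>T\<^esub> y) \<odot>\<^sub>r\<^bsub>T\<^esub> a = x \<odot>\<^sub>r\<^bsub>T\<^esub> a \<oplus>\<^bsub>T\<^esub> y \<odot>\<^sub>r\<^bsub>T\<^esub> a"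
      by (auto simp: ad)
  next
    fix a b x assume ab: "a \<in> carrier R" "b \<in> carrier R" and x: "x \<in> carrier T"
    show "(a \<oplus>\<^bsub>R\<^esub> b) \<odot>\<^bsub>T\<^esub> x = a \<odot>\<^bsub>T\<^esub> x \<oplus>\<^bsub>T\<^esub> b \<odot>\<^bsub>T\<^esub> x"
      using x by (induction rule: tensor_induct)
        (use ab in \<open>auto simp: sm P.smult_l_distr ten_add_l ad cl ac\<close>)
    show "x \<odot>\<^sub>r\<^bsub>T\<^esub> (a \<oplus>\<^bsub>R\<^esub> b) = x \<odot>\<^sub>r\<^bsub>T\<^esub> a \<oplus>\<^bsub>T\<^esub> x \<odot>\<^sub>r\<^bsub>T\<^esub> b"
      using x by (induction rule: tensor_induct)
        (use ab in \<open>auto simp: sm Q.rsmult_r_distr ten_add_r ad cl ac\<close>)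
    show "(a \<otimes>\<^bsub>R\<^esub> b) \<odot>\<^bsub>T\<^esub> x = a \<odot>\<^bsub>T\<^esub> (b \<odot>\<^bsub>T\<^esub> x)"
      using x by (induction rule: tensor_induct) (use ab in \<open>auto simp: sm P.smult_assoc ad cl\<close>)
    show "x \<odot>\<^sub>r\<^bsub>T\<^esub> (a \<otimes>\<^bsub>R\<^esub> b) = (x \<odot>\<^sub>r\<^bsub>T\<^esub> a) \<odot>\<^sub>r\<^bsub>T\<^esub> b"
      using x by (induction rule: tensor_induct) (use ab in \<open>auto simp: sm Q.rsmult_assoc ad cl\<close>)
  next
    fix x assume x: "x \<in> carrier T"
    show "\<one>\<^bsub>R\<^esub> \<odot>\<^bsub>T\<^esub> x = x"
      using x by (induction rule: tensor_induct) (auto simp: sm P.smult_one ad)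
    show "x \<odot>\<^sub>r\<^bsub>T\<^esub> \<one>\<^bsub>R\<^esub> = x"
      using x by (induction rule: tensor_induct) (auto simp: sm Q.rsmult_one ad)
  next
    fix a x b assume ab: "a \<in> carrier R" "b \<in> carrier R" and x: "x \<in> carrier T"
    show "(a \<odot>\<^bsub>T\<^esub> x) \<odot>\<^sub>r\<^bsub>T\<^esub> b = a \<odot>\<^bsub>T\<^esub> (x \<odot>\<^sub>r\<^bsub>T\<^esub> b)"
      using x by (induction rule: tensor_induct) (use ab in \<open>auto simp: sm ad cl\<close>)
  qed unfold_locales
qed

lemma left_hom_tensorI:
  assumes N: "left_module R N" and f: "f \<in> add_hom T N"
    and "\<And>a p q. \<lbrakk>a \<in> carrier R; p \<in> carrier P; q \<in> carrier Q\<rbrakk>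
      \<Longrightarrow> f ((a \<odot>\<^bsub>P\<^esub> p) \<otimes>\<^sub>t q) = a \<odot>\<^bsub>N\<^esub> f (p \<otimes>\<^sub>t q)"
  shows "f \<in> left_hom R T N"
proof -
  interpret T: bimodule R T by (rule bimodule_tensor)
  interpret N: left_module R N by fact
  have "f (a \<odot>\<^bsub>T\<^esub> x) = a \<odot>\<^bsub>N\<^esub> f x" if "x \<in> carrier T" "a \<in> carrier R" for a x
    using that
    by (induction rule: tensor_induct)
      (simp_all add: smult_ten assms(3) T.smult_r_distr T.smult_closed add_hom_add[OF f] add_hom_closed[OF f]
        N.smult_r_distr)
  then show ?thesis using f by (simp add: left_hom_iff)
qed

lemma right_hom_tensorI:
  assumes N: "left_module (op_ring R) (right_module N)" and f: "f \<in> add_hom T N"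
    and "\<And>a p q. \<lbrakk>a \<in> carrier R; p \<in> carrier P; q \<in> carrier Q\<rbrakk>
      \<Longrightarrow> f (p \<otimes>\<^sub>t (q \<odot>\<^sub>r\<^bsub>Q\<^esub> a)) = f (p \<otimes>\<^sub>t q) \<odot>\<^sub>r\<^bsub>N\<^esub> a"
  shows "f \<in> right_hom R T N"
proof -
  interpret T: bimodule R T by (rule bimodule_tensor)
  interpret N: left_module "op_ring R" "right_module N" by fact
  have "f (x \<odot>\<^sub>r\<^bsub>T\<^esub> a) = f x \<odot>\<^sub>r\<^bsub>N\<^esub> a" if "x \<in> carrier T" "a \<in> carrier R" for a x
    using that N.smult_r_distr[of a]
    by (induction rule: tensor_induct)
      (simp_all add: rsmult_ten assms(3) T.rsmult_l_distr T.rsmult_closed add_hom_add[OF f] add_hom_closed[OF f])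
  then show ?thesis using f by (simp add: right_hom_iff)
qed

lemma bimod_hom_tensorI:
  assumes N: "bimodule R N" and f: "f \<in> add_hom T N"
    and "\<And>a p q. \<lbrakk>a \<in> carrier R; p \<in> carrier P; q \<in> carrier Q\<rbrakk>
      \<Longrightarrow> f ((a \<odot>\<^bsub>P\<^esub> p) \<otimes>\<^sub>t q) = a \<odot>\<^bsub>N\<^esub> f (p \<otimes>\<^sub>t q)"
    and "\<And>a p q. \<lbrakk>a \<in> carrier R; p \<in> carrier P; q \<in> carrier Q\<rbrakk>
      \<Longrightarrow> f (p \<otimes>\<^sub>t (q \<odot>\<^sub>r\<^bsub>Q\<^esub> a)) = f (p \<otimes>\<^sub>t q) \<odot>\<^sub>r\<^bsub>N\<^esub> a"
  shows "f \<in> bimod_hom R T N"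
  using left_hom_tensorI[OF bimodule.left_module[OF N] f] right_hom_tensorI[OF bimodule.left_module_right_module[OF N] f] assms(3,4)
  by (simp add: bimod_hom_def)

end

section \<open>Isomorphisms, associativity and units\<close>

lemma bimod_hom_iff:
  "f \<in> bimod_hom R M N \<longleftrightarrow> f \<in> add_hom M N \<and>
    (\<forall>a\<in>carrier R. \<forall>x\<in>carrier M. f (a \<odot>\<^bsub>M\<^esub> x) = a \<odot>\<^bsub>N\<^esub> f x) \<and>
    (\<forall>a\<in>carrier R. \<forall>x\<in>carrier M. f (x \<odot>\<^sub>r\<^bsub>M\<^esub> a) = f x \<odot>\<^sub>r\<^bsub>N\<^esub> a)"
  by (auto simp: bimod_hom_def left_hom_iff right_hom_iff)

lemma bimod_isomorphicI:
  assumes "f \<in> bimod_hom R M N" "\<And>y. y \<in> carrier N \<Longrightarrow> g y \<in> carrier M"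
    and "\<And>x. x \<in> carrier M \<Longrightarrow> g (f x) = x" "\<And>y. y \<in> carrier N \<Longrightarrow> f (g y) = y"
  shows "bimod_isomorphic R M N"
proof -
  have "bij_betw f (carrier M) (carrier N)"
    using assms by (intro bij_betw_byWitness[of _ g]) (auto simp: bimod_hom_iff add_hom_def)
  then show ?thesis using assms(1) by (auto simp: bimod_isomorphic_def)
qed

lemma bimod_isomorphicE:
  assumes "bimod_isomorphic R M N" "bimodule R M"
  obtains f g where "f \<in> bimod_hom R M N" "g \<in> bimod_hom R N M"
    "\<And>x. x \<in> carrier M \<Longrightarrow> g (f x) = x" "\<And>y. y \<in> carrier N \<Longrightarrow> f (g y) = y"
proof -
  interpret M: bimodule R M by fact
  obtain f where f: "f \<in> bimod_hom R M N" and bij: "bij_betw f (carrier M) (carrier N)"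
    using assms(1) by (auto simp: bimod_isomorphic_def)
  define g where "g = inv_into (carrier M) f"
  have gc: "g y \<in> carrier M" and fg: "f (g y) = y" if "y \<in> carrier N" for y
    using that bij bij_betw_inv_into_right[OF bij] bij_betwE[OF bij_betw_inv_into[OF bij]]
    by (auto simp: g_def)
  have gf: "g (f x) = x" if "x \<in> carrier M" for x
    using that bij_betw_inv_into_left[OF bij] by (simp add: g_def)
  have f': "f \<in> add_hom M N" "\<And>a x. \<lbrakk>a \<in> carrier R; x \<in> carrier M\<rbrakk> \<Longrightarrow> f (a \<odot>\<^bsub>M\<^esub> x) = a \<odot>\<^bsub>N\<^esub> f x"
    "\<And>a x. \<lbrakk>a \<in> carrier R; x \<in> carrier M\<rbrakk> \<Longrightarrow> f (x \<odot>\<^sub>r\<^bsub>M\<^esub> a) = f x \<odot>\<^sub>r\<^bsub>N\<^esub> a"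
    using f by (auto simp: bimod_hom_iff)
  have "g (x \<oplus>\<^bsub>N\<^esub> y) = g x \<oplus>\<^bsub>M\<^esub> g y" if "x \<in> carrier N" "y \<in> carrier N" for x y
    using gf[of "g x \<oplus>\<^bsub>M\<^esub> g y"] add_hom_add[OF f'(1), of "g x" "g y"] that by (simp add: gc fg)
  moreover have "g (a \<odot>\<^bsub>N\<^esub> y) = a \<odot>\<^bsub>M\<^esub> g y" if "a \<in> carrier R" "y \<in> carrier N" for a y
    using gf[of "a \<odot>\<^bsub>M\<^esub> g y"] f'(2)[of a "g y"] that by (simp add: gc fg M.smult_closed)
  moreover have "g (y \<odot>\<^sub>r\<^bsub>N\<^esub> a) = g y \<odot>\<^sub>r\<^bsub>M\<^esub> a" if "a \<in> carrier R" "y \<in> carrier N" for a y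
    using gf[of "g y \<odot>\<^sub>r\<^bsub>M\<^esub> a"] f'(3)[of a "g y"] that by (simp add: gc fg M.rsmult_closed)
  ultimately have "g \<in> bimod_hom R N M"
    by (auto simp: bimod_hom_iff gc intro!: add_homI)
  then show thesis using that f gf fg by blast
qed

lemma bimod_isomorphic_refl: "bimod_isomorphic R M M"
  by (rule bimod_isomorphicI[of "\<lambda>x. x" _ _ _ "\<lambda>x. x"]) (auto simp: bimod_hom_iff add_hom_def)

lemma bimod_isomorphic_sym: "\<lbrakk>bimod_isomorphic R M N; bimodule R M\<rbrakk> \<Longrightarrow> bimod_isomorphic R N M"
  by (erule (1) bimod_isomorphicE, rule bimod_isomorphicI) (auto simp: bimod_hom_iff add_hom_def)

lemma bimod_hom_compose: "\<lbrakk>f \<in> bimod_hom R L M; g \<in> bimod_hom R M N\<rbrakk> \<Longrightarrow> (\<lambda>x. g (f x)) \<in> bimod_hom R L N"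
  using add_hom_compose[of f L M g N] by (auto simp: bimod_hom_iff add_hom_closed)

lemma bimod_isomorphic_trans:
  assumes "bimod_isomorphic R L M" "bimod_isomorphic R M N"
  shows "bimod_isomorphic R L N"
proof -
  obtain f g where f: "f \<in> bimod_hom R L M" "bij_betw f (carrier L) (carrier M)"
    and g: "g \<in> bimod_hom R M N" "bij_betw g (carrier M) (carrier N)"
    using assms by (auto simp: bimod_isomorphic_def)
  then have "bij_betw (\<lambda>x. g (f x)) (carrier L) (carrier N)"
    using bij_betw_trans[OF f(2) g(2)] by (simp add: o_def)
  then show ?thesis using bimod_hom_compose[OF f(1) g(1)] by (auto simp: bimod_isomorphic_def)
qed

section \<open>Isomorphisms of tensor products\<close>

lemma (in bimodule_pair) tensor_lift_ex:
  assumes "abelian_group N" "balanced R P Q N \<beta>"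
  shows "\<exists>\<phi>. \<phi> \<in> add_hom T N \<and> (\<forall>p\<in>carrier P. \<forall>q\<in>carrier Q. \<phi> (p \<otimes>\<^sub>t q) = \<beta> p q)"
  by (rule tensor_lift[OF assms]) blast

text \<open>The lift \<open>\<phi>\<close> of \<open>\<beta>\<close> exists only inside the proof,
  so the last hypothesis speaks of every additive map with the values \<open>\<beta>\<close> on pure
  tensors. For the inverse \<open>g\<close> additivity is enough: \<open>\<phi>\<close> respects
  both actions, and a bijective bimodule map is an isomorphism.\<close>

lemma (in bimodule_pair) tensor_isomorphicI:
  assumes N: "bimodule R N" and \<beta>: "balanced R P Q N \<beta>"
    and "\<And>a p q. \<lbrakk>a \<in> carrier R; p \<in> carrier P; q \<in> carrier Q\<rbrakk> \<Longrightarrow> \<beta> (a \<odot>\<^bsub>P\<^esub> p) q = a \<odot>\<^bsub>N\<^esub> \<beta> p q"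
    and "\<And>a p q. \<lbrakk>a \<in> carrier R; p \<in> carrier P; q \<in> carrier Q\<rbrakk> \<Longrightarrow> \<beta> p (q \<odot>\<^sub>r\<^bsub>Q\<^esub> a) = \<beta> p q \<odot>\<^sub>r\<^bsub>N\<^esub> a"
    and g: "g \<in> add_hom N T"
    and g\<beta>: "\<And>p q. \<lbrakk>p \<in> carrier P; q \<in> carrier Q\<rbrakk> \<Longrightarrow> g (\<beta> p q) = p \<otimes>\<^sub>t q"
    and right_inverse: "\<And>\<phi> y. \<lbrakk>\<phi> \<in> add_hom T N; \<And>p q. \<lbrakk>p \<in> carrier P; q \<in> carrier Q\<rbrakk> \<Longrightarrow> \<phi> (p \<otimes>\<^sub>t q) = \<beta> p q;
      y \<in> carrier N\<rbrakk> \<Longrightarrow> \<phi> (g y) = y"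
  shows "bimod_isomorphic R T N"
proof -
  interpret N: bimodule R N by fact
  obtain \<phi> where \<phi>: "\<phi> \<in> add_hom T N"
    and \<phi>t: "\<And>p q. \<lbrakk>p \<in> carrier P; q \<in> carrier Q\<rbrakk> \<Longrightarrow> \<phi> (p \<otimes>\<^sub>t q) = \<beta> p q"
    using tensor_lift[OF N.M.abelian_group_axioms \<beta>] by blast
  show ?thesis
  proof (rule bimod_isomorphicI[of \<phi> _ _ _ g])
    show "\<phi> \<in> bimod_hom R T N"
      by (rule bimod_hom_tensorI[OF N \<phi>]) (simp_all add: \<phi>t P.smult_closed Q.rsmult_closed assms(3,4))
    show "g (\<phi> x) = x" if "x \<in> carrier T" for x
      using tensor_hom_eqI[OF add_hom_compose[OF \<phi> g], of "\<lambda>x. x"] that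
      by (auto simp: \<phi>t g\<beta> intro!: add_homI)
  qed (auto simp: add_hom_closed[OF g] intro: right_inverse[OF \<phi> \<phi>t])
qed

lemma tensor_map:
  assumes "bimodule R P" "bimodule R Q" "bimodule R P'" "bimodule R Q'"
    and f: "f \<in> bimod_hom R P P'" and g: "g \<in> bimod_hom R Q Q'"
  obtains \<phi> where "\<phi> \<in> bimod_hom R (tensor R P Q) (tensor R P' Q')"
    "\<And>p q. \<lbrakk>p \<in> carrier P; q \<in> carrier Q\<rbrakk> \<Longrightarrow> \<phi> (ten R P Q p q) = ten R P' Q' (f p) (g q)"
proof -
  interpret A: bimodule_pair R P Q by (intro bimodule_pair.intro assms)
  interpret B: bimodule_pair R P' Q' by (intro bimodule_pair.intro assms)
  note f' = f[unfolded bimod_hom_iff] and g' = g[unfolded bimod_hom_iff]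
  note cl [simp] = add_hom_closed[OF conjunct1[OF f']] add_hom_closed[OF conjunct1[OF g']]
  note ad [simp] = add_hom_add[OF conjunct1[OF f']] add_hom_add[OF conjunct1[OF g']]
  have "balanced R P Q (tensor R P' Q') (\<lambda>p q. ten R P' Q' (f p) (g q))"
    using f' g' by (auto simp: balanced_def B.ten_closed B.ten_add_l B.ten_add_r B.ten_balanced intro!: add_homI)
  then obtain \<phi> where \<phi>: "\<phi> \<in> add_hom (tensor R P Q) (tensor R P' Q')"
    "\<And>p q. \<lbrakk>p \<in> carrier P; q \<in> carrier Q\<rbrakk> \<Longrightarrow> \<phi> (ten R P Q p q) = ten R P' Q' (f p) (g q)"
    using A.tensor_lift[OF B.abelian_group_tensor] by blast
  have "\<phi> \<in> bimod_hom R (tensor R P Q) (tensor R P' Q')"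
    using f' g'
    by (intro A.bimod_hom_tensorI[OF B.bimodule_tensor \<phi>(1)])
      (simp_all add: \<phi>(2) B.smult_ten B.rsmult_ten A.P.smult_closed A.Q.rsmult_closed)
  then show thesis using \<phi>(2) that by blast
qed

lemma tensor_cong:
  assumes "bimodule R P" "bimodule R Q" "bimodule R P'" "bimodule R Q'"
    and "bimod_isomorphic R P P'" "bimod_isomorphic R Q Q'"
  shows "bimod_isomorphic R (tensor R P Q) (tensor R P' Q')"
proof -
  interpret A: bimodule_pair R P Q by (intro bimodule_pair.intro assms)
  interpret B: bimodule_pair R P' Q' by (intro bimodule_pair.intro assms)
  obtain f f' where f: "f \<in> bimod_hom R P P'" "f' \<in> bimod_hom R P' P"
    and ff: "\<And>x. x \<in> carrier P \<Longrightarrow> f' (f x) = x" "\<And>x. x \<in> carrier P' \<Longrightarrow> f (f' x) = x"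
    using bimod_isomorphicE[OF assms(5,1)] by blast
  obtain g g' where g: "g \<in> bimod_hom R Q Q'" "g' \<in> bimod_hom R Q' Q"
    and gg: "\<And>x. x \<in> carrier Q \<Longrightarrow> g' (g x) = x" "\<And>x. x \<in> carrier Q' \<Longrightarrow> g (g' x) = x"
    using bimod_isomorphicE[OF assms(6,2)] by blast
  have cl: "\<And>x. x \<in> carrier P \<Longrightarrow> f x \<in> carrier P'" "\<And>x. x \<in> carrier P' \<Longrightarrow> f' x \<in> carrier P"
    "\<And>x. x \<in> carrier Q \<Longrightarrow> g x \<in> carrier Q'" "\<And>x. x \<in> carrier Q' \<Longrightarrow> g' x \<in> carrier Q"
    using f g by (auto simp: bimod_hom_iff add_hom_def)
  obtain \<phi> where \<phi>: "\<phi> \<in> bimod_hom R (tensor R P Q) (tensor R P' Q')"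
    "\<And>p q. \<lbrakk>p \<in> carrier P; q \<in> carrier Q\<rbrakk> \<Longrightarrow> \<phi> (ten R P Q p q) = ten R P' Q' (f p) (g q)"
    using tensor_map[OF assms(1-4) f(1) g(1)] by blast
  obtain \<psi> where \<psi>: "\<psi> \<in> bimod_hom R (tensor R P' Q') (tensor R P Q)"
    "\<And>p q. \<lbrakk>p \<in> carrier P'; q \<in> carrier Q'\<rbrakk> \<Longrightarrow> \<psi> (ten R P' Q' p q) = ten R P Q (f' p) (g' q)"
    using tensor_map[OF assms(3,4,1,2) f(2) g(2)] by blast
  have ah: "\<phi> \<in> add_hom (tensor R P Q) (tensor R P' Q')" "\<psi> \<in> add_hom (tensor R P' Q') (tensor R P Q)"
    using \<phi> \<psi> by (auto simp: bimod_hom_iff)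
  show ?thesis
  proof (rule bimod_isomorphicI[OF \<phi>(1), of \<psi>])
    show "\<psi> (\<phi> x) = x" if "x \<in> carrier (tensor R P Q)" for x
      using A.tensor_hom_eqI[OF add_hom_compose[OF ah], of "\<lambda>x. x"] that
      by (auto simp: \<phi> \<psi> ff gg cl intro!: add_homI)
    show "\<phi> (\<psi> x) = x" if "x \<in> carrier (tensor R P' Q')" for x
      using B.tensor_hom_eqI[OF add_hom_compose[OF ah(2,1)], of "\<lambda>x. x"] that
      by (auto simp: \<phi> \<psi> ff gg cl intro!: add_homI)
  qed (rule add_hom_closed[OF ah(2)])
qed

text \<open>A map out of a threefold product is lifted twice. With \<open>s\<close> held fixed, the
  pairing of \<open>p\<close> and \<open>q\<close> lifts to \<open>\<Phi> s\<close>; then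
  \<open>\<Phi>\<close> is checked to be balanced in the tensor and \<open>s\<close>, and is lifted
  again. The inverse arises in the same way with \<open>p\<close> held fixed.\<close>

lemma tensor_assoc:
  assumes "bimodule R P" "bimodule R Q" "bimodule R S"
  shows "bimod_isomorphic R (tensor R (tensor R P Q) S) (tensor R P (tensor R Q S))"
proof -
  interpret PQ: bimodule_pair R P Q by (intro bimodule_pair.intro assms)
  interpret QS: bimodule_pair R Q S by (intro bimodule_pair.intro assms)
  interpret L: bimodule_pair R "tensor R P Q" S by (intro bimodule_pair.intro PQ.bimodule_tensor assms)
  interpret M: bimodule_pair R P "tensor R Q S" by (intro bimodule_pair.intro QS.bimodule_tensor assms)
  interpret L: bimodule R L.T by (rule L.bimodule_tensor)
  interpret M: bimodule R M.T by (rule M.bimodule_tensor)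
  \<comment> \<open>The lifts for the single elements \<open>s\<close> are merged into one function
    by choice, which is what the existential form of the lifting lemma is for.\<close>
  have "\<exists>\<Phi>. \<forall>s\<in>carrier S. \<Phi> s \<in> add_hom PQ.T M.T \<and>
      (\<forall>p\<in>carrier P. \<forall>q\<in>carrier Q. \<Phi> s (ten R P Q p q) = ten R P QS.T p (ten R Q S q s))"
  proof (intro bchoice ballI)
    fix s assume s: "s \<in> carrier S"
    then have "balanced R P Q M.T (\<lambda>p q. ten R P QS.T p (ten R Q S q s))"
      unfolding balanced_def
      by (intro conjI ballI add_homI)
        (simp_all add: QS.ten_closed M.ten_closed QS.ten_add_l M.ten_add_l M.ten_add_r M.ten_balanced QS.smult_ten)
    then show "\<exists>\<phi>. \<phi> \<in> add_hom PQ.T M.T \<and>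
        (\<forall>p\<in>carrier P. \<forall>q\<in>carrier Q. \<phi> (ten R P Q p q) = ten R P QS.T p (ten R Q S q s))"
      by (rule PQ.tensor_lift_ex[OF M.abelian_group_tensor])
  qed
  then obtain \<Phi> where \<Phi>: "\<And>s. s \<in> carrier S \<Longrightarrow> \<Phi> s \<in> add_hom PQ.T M.T"
    and \<Phi>t: "\<And>p q s. \<lbrakk>p \<in> carrier P; q \<in> carrier Q; s \<in> carrier S\<rbrakk>
      \<Longrightarrow> \<Phi> s (ten R P Q p q) = ten R P QS.T p (ten R Q S q s)"
    by blast
  have "\<exists>\<Psi>. \<forall>p\<in>carrier P. \<Psi> p \<in> add_hom QS.T L.T \<and>
      (\<forall>q\<in>carrier Q. \<forall>s\<in>carrier S. \<Psi> p (ten R Q S q s) = ten R PQ.T S (ten R P Q p q) s)"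
  proof (intro bchoice ballI)
    fix p assume p: "p \<in> carrier P"
    then have "balanced R Q S L.T (\<lambda>q s. ten R PQ.T S (ten R P Q p q) s)"
      unfolding balanced_def
      by (intro conjI ballI add_homI)
        (simp_all add: PQ.ten_closed L.ten_closed PQ.ten_add_r L.ten_add_l L.ten_add_r
          flip: L.ten_balanced PQ.rsmult_ten)
    then show "\<exists>\<psi>. \<psi> \<in> add_hom QS.T L.T \<and>
        (\<forall>q\<in>carrier Q. \<forall>s\<in>carrier S. \<psi> (ten R Q S q s) = ten R PQ.T S (ten R P Q p q) s)"
      by (rule QS.tensor_lift_ex[OF L.abelian_group_tensor])
  qed
  then obtain \<Psi> where \<Psi>: "\<And>p. p \<in> carrier P \<Longrightarrow> \<Psi> p \<in> add_hom QS.T L.T"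
    and \<Psi>t: "\<And>p q s. \<lbrakk>p \<in> carrier P; q \<in> carrier Q; s \<in> carrier S\<rbrakk>
      \<Longrightarrow> \<Psi> p (ten R Q S q s) = ten R PQ.T S (ten R P Q p q) s"
    by blast
  note simps = \<Phi>t \<Psi>t add_hom_closed[OF \<Phi>] add_hom_add[OF \<Phi>] add_hom_closed[OF \<Psi>] add_hom_add[OF \<Psi>]
    PQ.ten_closed QS.ten_closed L.ten_closed M.ten_closed

  \<comment> \<open>Each law for the dependence on the element held fixed is checked on pure tensors
    and extends to all tensors by additivity of the lifts.\<close>
  have \<Phi>_add: "\<Phi> (s \<oplus>\<^bsub>S\<^esub> s') x = \<Phi> s x \<oplus>\<^bsub>M.T\<^esub> \<Phi> s' x"
    if "s \<in> carrier S" "s' \<in> carrier S" "x \<in> carrier PQ.T" for s s' x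
    using that(3) by (induction rule: PQ.tensor_induct)
      (use that(1,2) in \<open>auto simp: simps QS.ten_add_r M.ten_add_r M.M.a_ac\<close>)
  have \<Phi>_bal: "\<Phi> s (x \<odot>\<^sub>r\<^bsub>PQ.T\<^esub> a) = \<Phi> (a \<odot>\<^bsub>S\<^esub> s) x"
    if "s \<in> carrier S" "a \<in> carrier R" "x \<in> carrier PQ.T" for s a x
    using that(3) by (induction rule: PQ.tensor_induct)
      (use that(1,2) in \<open>auto simp: simps PQ.rsmult_ten PQ.Q.rsmult_closed QS.Q.smult_closed QS.ten_balanced
        L.P.rsmult_l_distr L.P.rsmult_closed\<close>)
  have \<Phi>_smult: "\<Phi> s (a \<odot>\<^bsub>PQ.T\<^esub> x) = a \<odot>\<^bsub>M.T\<^esub> \<Phi> s x"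
    if "s \<in> carrier S" "a \<in> carrier R" "x \<in> carrier PQ.T" for s a x
    using that(3) by (induction rule: PQ.tensor_induct)
      (use that(1,2) in \<open>auto simp: simps PQ.smult_ten M.smult_ten PQ.P.smult_closed
        L.P.smult_r_distr L.P.smult_closed M.smult_r_distr\<close>)
  have \<Phi>_rsmult: "\<Phi> (s \<odot>\<^sub>r\<^bsub>S\<^esub> a) x = \<Phi> s x \<odot>\<^sub>r\<^bsub>M.T\<^esub> a"
    if "s \<in> carrier S" "a \<in> carrier R" "x \<in> carrier PQ.T" for s a x
    using that(3) by (induction rule: PQ.tensor_induct)
      (use that(1,2) in \<open>auto simp: simps M.rsmult_ten QS.rsmult_ten QS.Q.rsmult_closed M.rsmult_l_distr\<close>)
  have \<Psi>_add: "\<Psi> (p \<oplus>\<^bsub>P\<^esub> p') y = \<Psi> p y \<oplus>\<^bsub>L.T\<^esub> \<Psi> p' y"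
    if "p \<in> carrier P" "p' \<in> carrier P" "y \<in> carrier QS.T" for p p' y
    using that(3) by (induction rule: QS.tensor_induct)
      (use that(1,2) in \<open>auto simp: simps PQ.ten_add_l L.ten_add_l L.M.a_ac\<close>)
  have \<Psi>_bal: "\<Psi> (p \<odot>\<^sub>r\<^bsub>P\<^esub> a) y = \<Psi> p (a \<odot>\<^bsub>QS.T\<^esub> y)"
    if "p \<in> carrier P" "a \<in> carrier R" "y \<in> carrier QS.T" for p a y
    using that(3) by (induction rule: QS.tensor_induct)
      (use that(1,2) in \<open>auto simp: simps QS.smult_ten PQ.P.rsmult_closed PQ.Q.smult_closed PQ.ten_balanced
        M.Q.smult_r_distr M.Q.smult_closed\<close>)

  have "balanced R P QS.T L.T \<Psi>"
    by (auto simp: balanced_def \<Psi>_add \<Psi>_bal \<Psi> simps intro!: add_homI)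
  then obtain \<psi> where \<psi>: "\<psi> \<in> add_hom M.T L.T"
    and \<psi>t: "\<And>p y. \<lbrakk>p \<in> carrier P; y \<in> carrier QS.T\<rbrakk> \<Longrightarrow> \<psi> (ten R P QS.T p y) = \<Psi> p y"
    using M.tensor_lift[OF L.abelian_group_tensor] by blast
  show ?thesis
  proof (rule L.tensor_isomorphicI[OF M.bimodule_tensor, of "\<lambda>x s. \<Phi> s x" \<psi>])
    show "balanced R PQ.T S M.T (\<lambda>x s. \<Phi> s x)"
      by (auto simp: balanced_def \<Phi>_add \<Phi>_bal \<Phi> simps intro!: add_homI)
    show "\<psi> (\<Phi> s x) = ten R PQ.T S x s" if "x \<in> carrier PQ.T" "s \<in> carrier S" for x s
      using that(1) by (induction rule: PQ.tensor_induct)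
        (use that(2) in \<open>auto simp: simps \<psi>t add_hom_add[OF \<psi>] L.ten_add_l\<close>)
    fix \<phi> y assume \<phi>: "\<phi> \<in> add_hom L.T M.T"
      and \<phi>t: "\<And>x s. \<lbrakk>x \<in> carrier PQ.T; s \<in> carrier S\<rbrakk> \<Longrightarrow> \<phi> (ten R PQ.T S x s) = \<Phi> s x"
      and y: "y \<in> carrier M.T"
    have \<phi>\<Psi>: "\<phi> (\<Psi> p y) = ten R P QS.T p y" if "p \<in> carrier P" "y \<in> carrier QS.T" for p y
      using that(2) by (induction rule: QS.tensor_induct)
        (use that(1) in \<open>auto simp: simps \<phi>t add_hom_add[OF \<phi>] M.ten_add_r\<close>)
    show "\<phi> (\<psi> y) = y"
      using y by (induction rule: M.tensor_induct)
        (auto simp: \<psi>t \<phi>\<Psi> add_hom_add[OF \<psi>] add_hom_add[OF \<phi>] add_hom_closed[OF \<psi>])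
  qed (auto simp: \<psi> \<Phi>_smult \<Phi>_rsmult)
qed

lemma bimodule_regular: "ring R \<Longrightarrow> bimodule R (regular_bimod R)"
proof -
  assume "ring R"
  then interpret ring R .
  show ?thesis
    by (intro bimodule.intro bimodule_axioms.intro abelian_groupI)
      (auto simp: ring_axioms a_ac m_assoc l_distr r_distr intro: add.l_inv_ex)
qed

lemma tensor_unit_left:
  assumes "bimodule R P"
  shows "bimod_isomorphic R (tensor R (regular_bimod R) P) P"
proof -
  interpret P: bimodule R P by fact
  interpret T: bimodule_pair R "regular_bimod R" P
    by (intro bimodule_pair.intro bimodule_regular assms P.R.ring_axioms)
  show ?thesis
  proof (rule T.tensor_isomorphicI[OF assms, of "\<lambda>a p. a \<odot>\<^bsub>P\<^esub> p" "\<lambda>p. ten R (regular_bimod R) P \<one>\<^bsub>R\<^esub> p"])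
    show "(\<lambda>p. ten R (regular_bimod R) P \<one>\<^bsub>R\<^esub> p) \<in> add_hom P T.T"
      by (rule T.ten_add_hom_r) simp
    show "ten R (regular_bimod R) P \<one>\<^bsub>R\<^esub> (a \<odot>\<^bsub>P\<^esub> p) = ten R (regular_bimod R) P a p"
      if "a \<in> carrier (regular_bimod R)" "p \<in> carrier P" for a p
      using T.ten_balanced[of "\<one>\<^bsub>R\<^esub>" a p] that by simp
  qed (auto simp: balanced_def add_hom_def P.smult_closed P.smult_l_distr P.smult_r_distr P.smult_assoc
      P.smult_one P.smult_rsmult)
qed

lemma tensor_unit_right:
  assumes "bimodule R P"
  shows "bimod_isomorphic R (tensor R P (regular_bimod R)) P"
proof -
  interpret P: bimodule R P by fact
  interpret T: bimodule_pair R P "regular_bimod R"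
    by (intro bimodule_pair.intro bimodule_regular assms P.R.ring_axioms)
  show ?thesis
  proof (rule T.tensor_isomorphicI[OF assms, of "\<lambda>p a. p \<odot>\<^sub>r\<^bsub>P\<^esub> a" "\<lambda>p. ten R P (regular_bimod R) p \<one>\<^bsub>R\<^esub>"])
    show "(\<lambda>p. ten R P (regular_bimod R) p \<one>\<^bsub>R\<^esub>) \<in> add_hom P T.T"
      by (rule T.ten_add_hom_l) simp
    show "ten R P (regular_bimod R) (p \<odot>\<^sub>r\<^bsub>P\<^esub> a) \<one>\<^bsub>R\<^esub> = ten R P (regular_bimod R) p a"
      if "a \<in> carrier (regular_bimod R)" "p \<in> carrier P" for a p
      using T.ten_balanced[of p a "\<one>\<^bsub>R\<^esub>"] that by simp
  qed (auto simp: balanced_def add_hom_def P.rsmult_closed P.rsmult_l_distr P.rsmult_r_distr P.rsmult_assoc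
      P.rsmult_one P.smult_rsmult)
qed

section \<open>Opposite bimodules and partial invertibility\<close>

text \<open>In contrast to \<open>right_module\<close>, both actions are kept and exchanged, so the
  result is again a bimodule, over the opposite ring. Statements on the left structure follow by
  applying the right versions to it.\<close>

definition op_bimod :: "('a, 'm, 'e) bimod_scheme \<Rightarrow> ('a, 'm, 'e) bimod_scheme"
  where "op_bimod M = M\<lparr>smult := (\<lambda>a x. x \<odot>\<^sub>r\<^bsub>M\<^esub> a), rsmult := (\<lambda>x a. a \<odot>\<^bsub>M\<^esub> x)\<rparr>"

lemma carrier_op_bimod [simp]: "carrier (op_bimod M) = carrier M"
  and add_op_bimod [simp]: "x \<oplus>\<^bsub>op_bimod M\<^esub> y = x \<oplus>\<^bsub>M\<^esub> y"
  and zero_op_bimod [simp]: "\<zero>\<^bsub>op_bimod M\<^esub> = \<zero>\<^bsub>M\<^esub>"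
  and smult_op_bimod [simp]: "a \<odot>\<^bsub>op_bimod M\<^esub> x = x \<odot>\<^sub>r\<^bsub>M\<^esub> a"
  and rsmult_op_bimod [simp]: "x \<odot>\<^sub>r\<^bsub>op_bimod M\<^esub> a = a \<odot>\<^bsub>M\<^esub> x"
  and finsum_op_bimod [simp]: "finsum (op_bimod M) = finsum M"
  by (simp_all add: op_bimod_def finsum_def)

lemma op_ring_op_ring [simp]: "op_ring (op_ring R) = R"
  by (simp add: op_ring_def)

lemma add_hom_from_op_bimod [simp]: "add_hom (op_bimod M) N = add_hom M N"
  by (simp add: add_hom_def)

lemma add_hom_to_op_bimod [simp]: "add_hom M (op_bimod N) = add_hom M N"
  by (simp add: add_hom_def)

lemma bimod_hom_op: "bimod_hom (op_ring R) (op_bimod M) (op_bimod N) = bimod_hom R M N"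
  by (auto simp: bimod_hom_iff)

lemma bimod_isomorphic_op:
  "bimod_isomorphic (op_ring R) (op_bimod M) (op_bimod N) \<longleftrightarrow> bimod_isomorphic R M N"
  by (simp add: bimod_isomorphic_def bimod_hom_op)

lemma finitely_generated_op_bimod [simp]:
  "finitely_generated R (right_module (op_bimod M)) \<longleftrightarrow> finitely_generated R M"
  by (simp add: finitely_generated_def)

lemma projective_op_bimod [simp]:
  "projective R (right_module (op_bimod M)) \<longleftrightarrow> projective R M"
  by (simp add: projective_def left_hom_def)

lemma (in bimodule) bimodule_op: "bimodule (op_ring R) (op_bimod M)"
  by (intro bimodule.intro bimodule_axioms.intro ring_op_ring R.ring_axioms abelian_groupI)
    (auto simp: smult_closed smult_l_distr smult_r_distr smult_assoc smult_one smult_rsmult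
      rsmult_closed rsmult_l_distr rsmult_r_distr rsmult_assoc rsmult_one M.a_ac intro: M.add.l_inv_ex)

context bimodule_pair
begin

text \<open>Swapping the entries of a pair turns the balancing relation over \<open>R\<close> into
  the one over the opposite ring. The left half of the invertibility of a tensor product is reduced
  to the right half in this way.\<close>

lemma tensor_op:
  "bimod_isomorphic (op_ring R) (tensor (op_ring R) (op_bimod Q) (op_bimod P)) (op_bimod T)"
proof -
  interpret T: bimodule R T by (rule bimodule_tensor)
  interpret O: bimodule_pair "op_ring R" "op_bimod Q" "op_bimod P"
    by (intro bimodule_pair.intro P.bimodule_op Q.bimodule_op)
  have "balanced R P Q O.T (\<lambda>p q. ten (op_ring R) (op_bimod Q) (op_bimod P) q p)"
    unfolding balanced_def
    using O.ten_add_hom_l O.ten_add_hom_r O.ten_balanced by simp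
  then obtain \<psi> where \<psi>: "\<psi> \<in> add_hom T O.T"
    and \<psi>t: "\<And>p q. \<lbrakk>p \<in> carrier P; q \<in> carrier Q\<rbrakk> \<Longrightarrow> \<psi> (p \<otimes>\<^sub>t q) = ten (op_ring R) (op_bimod Q) (op_bimod P) q p"
    using tensor_lift[OF O.abelian_group_tensor] by blast
  show ?thesis
  proof (rule O.tensor_isomorphicI[OF T.bimodule_op, of "\<lambda>q p. p \<otimes>\<^sub>t q" \<psi>])
    show "balanced (op_ring R) (op_bimod Q) (op_bimod P) (op_bimod T) (\<lambda>q p. p \<otimes>\<^sub>t q)"
      unfolding balanced_def
      using ten_add_hom_l ten_add_hom_r ten_balanced by simp
    fix \<phi> y assume \<phi>: "\<phi> \<in> add_hom O.T (op_bimod T)"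
      and \<phi>t: "\<And>q p. \<lbrakk>q \<in> carrier (op_bimod Q); p \<in> carrier (op_bimod P)\<rbrakk>
        \<Longrightarrow> \<phi> (ten (op_ring R) (op_bimod Q) (op_bimod P) q p) = p \<otimes>\<^sub>t q"
      and "y \<in> carrier (op_bimod T)"
    then have "y \<in> carrier T" by simp
    then show "\<phi> (\<psi> y) = y"
      by (induction rule: tensor_induct)
        (use \<phi>t in \<open>simp_all add: \<psi>t add_hom_add[OF \<psi>] add_hom_add[OF \<phi>] add_hom_closed[OF \<psi>]\<close>)
  qed (use \<psi> in \<open>simp_all add: \<psi>t smult_ten rsmult_ten\<close>)
qed

end

text \<open>The conditions of \<^const>\<open>partially_invertible\<close> on the right module structure; the remaining ones are
  the same conditions on the opposite bimodule.\<close>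

definition right_invertible :: "('a, 'r) ring_scheme \<Rightarrow> ('a, 'm, 'e) bimod_scheme \<Rightarrow> bool"
  where "right_invertible R P \<longleftrightarrow> bimodule R P \<and>
    finitely_generated (op_ring R) (right_module P) \<and> projective (op_ring R) (right_module P) \<and>
    (\<forall>\<phi>\<in>right_hom R P P. \<exists>a\<in>carrier R. \<forall>x\<in>carrier P. \<phi> x = a \<odot>\<^bsub>P\<^esub> x)"

lemma restrict_add_hom: "restrict f (carrier M) \<in> add_hom M M \<longleftrightarrow> f \<in> add_hom M M" if "abelian_group M"
proof -
  interpret abelian_group M by fact
  show ?thesis by (auto simp: add_hom_def Pi_def)
qed

context bimodule
begin

text \<open>Left multiplication is always a bimodule map into the right endomorphisms, so only
  surjectivity is at stake. Members of \<open>End_right\<close> are extensional while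
  \<open>\<phi>\<close> in the second condition may take any values off the carrier; hence the
  passage through \<open>restrict\<close>.\<close>

lemma left_multiplication_epi_iff:
  "(\<lambda>a. \<lambda>x\<in>carrier M. a \<odot>\<^bsub>M\<^esub> x) \<in> bimod_epi R (regular_bimod R) (End_right R M) \<longleftrightarrow>
    (\<forall>\<phi>\<in>right_hom R M M. \<exists>a\<in>carrier R. \<forall>x\<in>carrier M. \<phi> x = a \<odot>\<^bsub>M\<^esub> x)"
proof -
  let ?l = "\<lambda>a. \<lambda>x\<in>carrier M. a \<odot>\<^bsub>M\<^esub> x"
  have restrict: "restrict \<phi> (carrier M) \<in> carrier (End_right R M)" if "\<phi> \<in> right_hom R M M" for \<phi>
    using that by (auto simp: End_right_def right_hom_iff rsmult_closed restrict_add_hom M.abelian_group_axioms)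
  have closed: "?l a \<in> carrier (End_right R M)" if "a \<in> carrier R" for a
    using that
    by (intro restrict) (simp add: right_hom_iff smult_closed smult_r_distr smult_rsmult add_homI)
  have hom: "?l \<in> bimod_hom R (regular_bimod R) (End_right R M)"
    unfolding bimod_hom_iff
    by (intro conjI ballI add_homI, simp add: closed)
      (auto simp: End_right_def smult_closed smult_l_distr smult_assoc intro!: ext)
  show ?thesis
  proof
    assume "?l \<in> bimod_epi R (regular_bimod R) (End_right R M)"
    then have img: "?l ` carrier R = carrier (End_right R M)"
      by (simp add: bimod_epi_def)
    show "\<forall>\<phi>\<in>right_hom R M M. \<exists>a\<in>carrier R. \<forall>x\<in>carrier M. \<phi> x = a \<odot>\<^bsub>M\<^esub> x"
    proof
      fix \<phi> assume "\<phi> \<in> right_hom R M M"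
      then obtain a where "a \<in> carrier R" "restrict \<phi> (carrier M) = ?l a"
        using restrict img by blast
      then show "\<exists>a\<in>carrier R. \<forall>x\<in>carrier M. \<phi> x = a \<odot>\<^bsub>M\<^esub> x"
        by (metis restrict_apply')
    qed
  next
    assume *: "\<forall>\<phi>\<in>right_hom R M M. \<exists>a\<in>carrier R. \<forall>x\<in>carrier M. \<phi> x = a \<odot>\<^bsub>M\<^esub> x"
    have "\<phi> \<in> ?l ` carrier R" if "\<phi> \<in> carrier (End_right R M)" for \<phi>
    proof -
      have \<phi>: "\<phi> \<in> right_hom R M M" "\<phi> \<in> extensional (carrier M)"
        using that by (auto simp: End_right_def)
      then obtain a where "a \<in> carrier R" "\<forall>x\<in>carrier M. \<phi> x = a \<odot>\<^bsub>M\<^esub> x"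
        using * by blast
      then show ?thesis
        using \<phi>(2) by (intro image_eqI[of _ _ a]) (auto intro: extensionalityI[of _ "carrier M"])
    qed
    then show "?l \<in> bimod_epi R (regular_bimod R) (End_right R M)"
      using hom closed by (auto simp: bimod_epi_def)
  qed
qed

end

text \<open>The left endomorphisms of \<open>M\<close>, with their two actions exchanged, are the
  right endomorphisms of the opposite bimodule, so the previous equivalence applies to that
  one.\<close>

lemma (in bimodule) right_multiplication_epi_iff:
  "(\<lambda>a. \<lambda>x\<in>carrier M. x \<odot>\<^sub>r\<^bsub>M\<^esub> a) \<in> bimod_epi R (regular_bimod R) (End_left R M) \<longleftrightarrow>
    (\<forall>\<phi>\<in>left_hom R M M. \<exists>a\<in>carrier R. \<forall>x\<in>carrier M. \<phi> x = x \<odot>\<^sub>r\<^bsub>M\<^esub> a)"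
proof -
  interpret Op: bimodule "op_ring R" "op_bimod M" by (rule bimodule_op)
  have hom: "right_hom (op_ring R) (op_bimod M) (op_bimod M) = left_hom R M M"
    by (auto simp: right_hom_iff left_hom_iff)
  have "bimod_epi (op_ring R) (regular_bimod (op_ring R)) (End_right (op_ring R) (op_bimod M))
      = bimod_epi R (regular_bimod R) (End_left R M)"
    by (auto simp: bimod_epi_def bimod_hom_iff End_right_def End_left_def hom add_hom_def)
  then show ?thesis
    using Op.left_multiplication_epi_iff by (simp add: hom)
qed

lemma partially_invertible_iff:
  "partially_invertible R P \<longleftrightarrow> right_invertible R P \<and> right_invertible (op_ring R) (op_bimod P)"
proof -
  have hom: "right_hom (op_ring R) (op_bimod P) (op_bimod P) = left_hom R P P"
    by (auto simp: right_hom_iff left_hom_iff)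
  show ?thesis
  proof (cases "bimodule R P")
    case True
    then interpret bimodule R P .
    have op: "right_invertible (op_ring R) (op_bimod P) \<longleftrightarrow> bimodule (op_ring R) (op_bimod P) \<and>
      finitely_generated R P \<and> projective R P \<and>
      (\<forall>\<phi>\<in>left_hom R P P. \<exists>a\<in>carrier R. \<forall>x\<in>carrier P. \<phi> x = x \<odot>\<^sub>r\<^bsub>P\<^esub> a)"
      by (simp only: right_invertible_def hom op_ring_op_ring finitely_generated_op_bimod projective_op_bimod
          carrier_op_ring carrier_op_bimod smult_op_bimod)
    show ?thesis
      unfolding op
      unfolding partially_invertible_def right_invertible_def left_multiplication_epi_iff
        right_multiplication_epi_iff
      using True bimodule_op by - (rule iffI; elim conjE; intro conjI; assumption)
  qed (simp add: partially_invertible_def right_invertible_def)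
qed

lemma partially_invertible_imp_bimodule: "partially_invertible R P \<Longrightarrow> bimodule R P"
  by (simp add: partially_invertible_def)

lemma add_hom_regular_op [simp]: "add_hom M (sub_bimod (op_ring R) (carrier R)) = add_hom M R"
  by (simp add: add_hom_def)

lemma right_dual_basis_iff:
  "left_dual_basis (op_ring R) (right_module M) I p f \<longleftrightarrow> finite I \<and> (\<forall>i\<in>I. p i \<in> carrier M) \<and>
    (\<forall>i\<in>I. f i \<in> add_hom M R \<and> (\<forall>a\<in>carrier R. \<forall>x\<in>carrier M. f i (x \<odot>\<^sub>r\<^bsub>M\<^esub> a) = f i x \<otimes>\<^bsub>R\<^esub> a)) \<and>
    (\<forall>x\<in>carrier M. (\<Oplus>\<^bsub>M\<^esub>i\<in>I. p i \<odot>\<^sub>r\<^bsub>M\<^esub> f i x) = x)"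
  by (auto simp: left_dual_basis_def left_hom_iff Pi_def)

lemma right_invertibleI:
  assumes "bimodule R P" "left_dual_basis (op_ring R) (right_module P) I p f"
    and "\<And>\<phi>. \<phi> \<in> right_hom R P P \<Longrightarrow> \<exists>a\<in>carrier R. \<forall>x\<in>carrier P. \<phi> x = a \<odot>\<^bsub>P\<^esub> x"
  shows "right_invertible R P"
  using assms left_module.left_dual_basis_imp_fgp[OF bimodule.left_module_right_module[OF assms(1)] assms(2)]
  by (auto simp: right_invertible_def)

lemma right_invertibleD:
  "\<lbrakk>right_invertible R P; \<phi> \<in> right_hom R P P\<rbrakk> \<Longrightarrow> \<exists>a\<in>carrier R. \<forall>x\<in>carrier P. \<phi> x = a \<odot>\<^bsub>P\<^esub> x"
  by (simp add: right_invertible_def)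

lemma right_invertibleE:
  fixes P :: "('a, 'm, 'e) bimod_scheme"
  assumes "right_invertible R P"
  obtains I :: "'m set" and p f where "left_dual_basis (op_ring R) (right_module P) I p f"
  using left_module.fgp_imp_left_dual_basis[OF bimodule.left_module_right_module, of R P] assms
  by (auto simp: right_invertible_def)

text \<open>Generation and projectivity follow from the transported dual basis. An endomorphism
  \<open>\<phi>\<close> of \<open>Q\<close> is conjugated to
  \<open>g \<circ> \<phi> \<circ> f\<close> on \<open>P\<close>, and the scalar found there also
  works on \<open>Q\<close>.\<close>

lemma right_invertible_isomorphic:
  fixes P :: "('a, 'm, 'e) bimod_scheme"
  assumes "bimod_isomorphic R P Q" "right_invertible R P" "bimodule R Q"
  shows "right_invertible R Q"
proof -
  have P: "bimodule R P" using assms(2) by (simp add: right_invertible_def)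
  obtain f g where f: "f \<in> bimod_hom R P Q" and g: "g \<in> bimod_hom R Q P"
    and gf: "\<And>x. x \<in> carrier P \<Longrightarrow> g (f x) = x" and fg: "\<And>y. y \<in> carrier Q \<Longrightarrow> f (g y) = y"
    using bimod_isomorphicE[OF assms(1) P] by blast
  obtain I :: "'m set" and p h where db: "left_dual_basis (op_ring R) (right_module P) I p h"
    by (rule right_invertibleE[OF assms(2)])
  show ?thesis
  proof (rule right_invertibleI[OF assms(3)])
    show "left_dual_basis (op_ring R) (right_module Q) I (\<lambda>i. f (p i)) (\<lambda>i y. h i (g y))"
      using f g fg
      by (intro left_module.left_dual_basis_retract[OF bimodule.left_module_right_module[OF P]
            bimodule.left_module_right_module[OF assms(3)] _ _ _ db])
        (auto simp: bimod_hom_def right_hom_def)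
    fix \<phi> assume \<phi>: "\<phi> \<in> right_hom R Q Q"
    note hom = f[unfolded bimod_hom_iff] g[unfolded bimod_hom_iff] \<phi>[unfolded right_hom_iff]
    note [simp] = hom[THEN conjunct1, THEN add_hom_closed]
    have "(\<lambda>x. g (\<phi> (f x))) \<in> right_hom R P P"
      unfolding right_hom_iff
      using hom by (auto intro!: add_homI simp: hom[THEN conjunct1, THEN add_hom_add])
    then obtain a where a: "a \<in> carrier R" "\<And>x. x \<in> carrier P \<Longrightarrow> g (\<phi> (f x)) = a \<odot>\<^bsub>P\<^esub> x"
      using assms(2) by (auto simp: right_invertible_def)
    have "\<phi> y = a \<odot>\<^bsub>Q\<^esub> y" if "y \<in> carrier Q" for y
      using arg_cong[OF a(2)[of "g y"], of f] a(1) that hom by (simp add: fg)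
    then show "\<exists>a\<in>carrier R. \<forall>y\<in>carrier Q. \<phi> y = a \<odot>\<^bsub>Q\<^esub> y" using a(1) by blast
  qed
qed

lemma partially_invertible_isomorphic:
  assumes "bimod_isomorphic R P Q" "partially_invertible R P" "bimodule R Q"
  shows "partially_invertible R Q"
  using assms right_invertible_isomorphic[of R P Q]
    right_invertible_isomorphic[of "op_ring R" "op_bimod P" "op_bimod Q"] bimodule.bimodule_op[OF assms(3)]
  by (simp add: partially_invertible_iff bimod_isomorphic_op)

section \<open>Tensor products of invertible bimodules\<close>

context bimodule_pair
begin

text \<open>Expanding \<open>f i x y\<close> in \<open>Q\<close>, moving \<open>f i x\<close> across
  the tensor sign and then expanding \<open>x\<close> in \<open>P\<close> shows that the coordinate
  at \<open>(i, j)\<close> is \<open>x \<otimes> y \<mapsto> g j (f i x y)\<close>. The coordinates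
  \<open>h\<close> are lifts of these balanced maps, hence the existential statement.\<close>

lemma right_dual_basis_tensor:
  assumes P: "left_dual_basis (op_ring R) (right_module P) I p f"
    and Q: "left_dual_basis (op_ring R) (right_module Q) J q g"
  shows "\<exists>h. left_dual_basis (op_ring R) (right_module T) (I \<times> J) (\<lambda>(i, j). p i \<otimes>\<^sub>t q j) h"
proof -
  interpret T: bimodule R T by (rule bimodule_tensor)
  have fin: "finite I" "finite J"
    and p: "\<And>i. i \<in> I \<Longrightarrow> p i \<in> carrier P" and q: "\<And>j. j \<in> J \<Longrightarrow> q j \<in> carrier Q"
    and f: "\<And>i. i \<in> I \<Longrightarrow> f i \<in> add_hom P R" and g: "\<And>j. j \<in> J \<Longrightarrow> g j \<in> add_hom Q R"
    and fr: "\<And>i a x. \<lbrakk>i \<in> I; a \<in> carrier R; x \<in> carrier P\<rbrakk> \<Longrightarrow> f i (x \<odot>\<^sub>r\<^bsub>P\<^esub> a) = f i x \<otimes>\<^bsub>R\<^esub> a"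
    and gr: "\<And>j a x. \<lbrakk>j \<in> J; a \<in> carrier R; x \<in> carrier Q\<rbrakk> \<Longrightarrow> g j (x \<odot>\<^sub>r\<^bsub>Q\<^esub> a) = g j x \<otimes>\<^bsub>R\<^esub> a"
    and fs: "\<And>x. x \<in> carrier P \<Longrightarrow> (\<Oplus>\<^bsub>P\<^esub>i\<in>I. p i \<odot>\<^sub>r\<^bsub>P\<^esub> f i x) = x"
    and gs: "\<And>x. x \<in> carrier Q \<Longrightarrow> (\<Oplus>\<^bsub>Q\<^esub>j\<in>J. q j \<odot>\<^sub>r\<^bsub>Q\<^esub> g j x) = x"
    using P Q by (simp_all add: right_dual_basis_iff)
  note [simp] = add_hom_closed[OF f] add_hom_closed[OF g] p q P.smult_closed Q.smult_closed
    P.rsmult_closed Q.rsmult_closed ten_closed T.rsmult_closed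
  have "\<exists>h. \<forall>k\<in>I \<times> J. h k \<in> add_hom T R \<and>
      (\<forall>x\<in>carrier P. \<forall>y\<in>carrier Q. h k (x \<otimes>\<^sub>t y) = (case k of (i, j) \<Rightarrow> g j (f i x \<odot>\<^bsub>Q\<^esub> y)))"
  proof (intro bchoice ballI)
    fix k assume "k \<in> I \<times> J"
    then obtain i j where k: "k = (i, j)" "i \<in> I" "j \<in> J" by blast
    have "balanced R P Q R (\<lambda>x y. g j (f i x \<odot>\<^bsub>Q\<^esub> y))"
      unfolding balanced_def
      using k(2,3)
      by (intro conjI ballI add_homI)
        (simp_all add: add_hom_add[OF f] add_hom_add[OF g] fr Q.smult_l_distr Q.smult_r_distr Q.smult_assoc)
    then show "\<exists>h. h \<in> add_hom T R \<and>
        (\<forall>x\<in>carrier P. \<forall>y\<in>carrier Q. h (x \<otimes>\<^sub>t y) = (case k of (i, j) \<Rightarrow> g j (f i x \<odot>\<^bsub>Q\<^esub> y)))"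
      unfolding k(1) prod.case by (rule tensor_lift_ex[OF P.R.abelian_group_axioms])
  qed
  then obtain h where h: "\<And>k. k \<in> I \<times> J \<Longrightarrow> h k \<in> add_hom T R"
    and ht: "\<And>i j x y. \<lbrakk>i \<in> I; j \<in> J; x \<in> carrier P; y \<in> carrier Q\<rbrakk>
      \<Longrightarrow> h (i, j) (x \<otimes>\<^sub>t y) = g j (f i x \<odot>\<^bsub>Q\<^esub> y)"
    by force
  note [simp] = add_hom_closed[OF h]
  have hr: "h (i, j) (t \<odot>\<^sub>r\<^bsub>T\<^esub> a) = h (i, j) t \<otimes>\<^bsub>R\<^esub> a"
    if "i \<in> I" "j \<in> J" "a \<in> carrier R" "t \<in> carrier T" for i j a t
    using that(4)
    by (induction rule: tensor_induct)
      (use that(1-3) in \<open>simp_all add: rsmult_ten ht gr T.rsmult_l_distr add_hom_add[OF h] P.R.l_distr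
        flip: Q.smult_rsmult\<close>)
  have sum: "(\<Oplus>\<^bsub>T\<^esub>k\<in>I \<times> J. (case k of (i, j) \<Rightarrow> p i \<otimes>\<^sub>t q j) \<odot>\<^sub>r\<^bsub>T\<^esub> h k t) = t" if "t \<in> carrier T" for t
  proof (rule tensor_hom_eqI[OF add_hom_sum[OF abelian_group_tensor] _ _ that, of _ _ "\<lambda>t. t"])
    show "(\<lambda>t. (case k of (i, j) \<Rightarrow> p i \<otimes>\<^sub>t q j) \<odot>\<^sub>r\<^bsub>T\<^esub> h k t) \<in> add_hom T T" if "k \<in> I \<times> J" for k
      using that by (auto intro!: add_homI simp: add_hom_add[OF h] T.rsmult_r_distr)
    show "(\<lambda>t. t) \<in> add_hom T T" by (simp add: add_homI)
    fix x y assume xy [simp]: "x \<in> carrier P" "y \<in> carrier Q"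
    have "(\<Oplus>\<^bsub>T\<^esub>k\<in>I \<times> J. (case k of (i, j) \<Rightarrow> p i \<otimes>\<^sub>t q j) \<odot>\<^sub>r\<^bsub>T\<^esub> h k (x \<otimes>\<^sub>t y))
        = finsum T (\<lambda>(i, j). p i \<otimes>\<^sub>t (q j \<odot>\<^sub>r\<^bsub>Q\<^esub> g j (f i x \<odot>\<^bsub>Q\<^esub> y))) (I \<times> J)"
      by (intro T.M.finsum_cong') (auto simp: ht rsmult_ten)
    also have "\<dots> = (\<Oplus>\<^bsub>T\<^esub>i\<in>I. \<Oplus>\<^bsub>T\<^esub>j\<in>J. p i \<otimes>\<^sub>t (q j \<odot>\<^sub>r\<^bsub>Q\<^esub> g j (f i x \<odot>\<^bsub>Q\<^esub> y)))"
      by (rule T.M.finsum_cartesian[symmetric]) (simp_all add: fin)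
    also have "\<dots> = (\<Oplus>\<^bsub>T\<^esub>i\<in>I. (p i \<odot>\<^sub>r\<^bsub>P\<^esub> f i x) \<otimes>\<^sub>t y)"
    proof (rule T.M.finsum_cong')
      fix i assume i: "i \<in> I"
      have "(\<Oplus>\<^bsub>T\<^esub>j\<in>J. p i \<otimes>\<^sub>t (q j \<odot>\<^sub>r\<^bsub>Q\<^esub> g j (f i x \<odot>\<^bsub>Q\<^esub> y)))
          = p i \<otimes>\<^sub>t (\<Oplus>\<^bsub>Q\<^esub>j\<in>J. q j \<odot>\<^sub>r\<^bsub>Q\<^esub> g j (f i x \<odot>\<^bsub>Q\<^esub> y))"
        using i fin
        by (intro add_hom_finsum[OF ten_add_hom_r Q.M.abelian_group_axioms abelian_group_tensor, symmetric])
          simp_all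
      then show "(\<Oplus>\<^bsub>T\<^esub>j\<in>J. p i \<otimes>\<^sub>t (q j \<odot>\<^sub>r\<^bsub>Q\<^esub> g j (f i x \<odot>\<^bsub>Q\<^esub> y))) = (p i \<odot>\<^sub>r\<^bsub>P\<^esub> f i x) \<otimes>\<^sub>t y"
        using i by (simp add: gs ten_balanced)
    qed auto
    also have "\<dots> = (\<Oplus>\<^bsub>P\<^esub>i\<in>I. p i \<odot>\<^sub>r\<^bsub>P\<^esub> f i x) \<otimes>\<^sub>t y"
      using fin
      by (intro add_hom_finsum[OF ten_add_hom_l P.M.abelian_group_axioms abelian_group_tensor, symmetric])
        simp_all
    finally show "(\<Oplus>\<^bsub>T\<^esub>k\<in>I \<times> J. (case k of (i, j) \<Rightarrow> p i \<otimes>\<^sub>t q j) \<odot>\<^sub>r\<^bsub>T\<^esub> h k (x \<otimes>\<^sub>t y)) = x \<otimes>\<^sub>t y"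
      by (simp add: fs)
  qed
  have "left_dual_basis (op_ring R) (right_module T) (I \<times> J) (\<lambda>(i, j). p i \<otimes>\<^sub>t q j) h"
    unfolding right_dual_basis_iff using fin h by (auto simp: hr sum)
  then show ?thesis by blast
qed

text \<open>The matrix entries assemble into elements \<open>w j\<close> of \<open>P\<close> with
  \<open>\<phi> (p j \<otimes> y) = w j \<otimes> y\<close>. Thus \<open>\<phi>\<close> comes from
  the right endomorphism \<open>x \<mapsto> \<Sum>\<^sub>j w j f j x\<close> of \<open>P\<close>,
  and the hypothesis on \<open>P\<close> turns this one into a scalar.\<close>

lemma right_endomorphism_tensor:
  assumes P: "right_invertible R P" and Q: "right_invertible R Q" and \<phi>: "\<phi> \<in> right_hom R T T"
  shows "\<exists>a\<in>carrier R. \<forall>t\<in>carrier T. \<phi> t = a \<odot>\<^bsub>T\<^esub> t"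
proof -
  interpret T: bimodule R T by (rule bimodule_tensor)
  obtain I :: "'p set" and p f where "left_dual_basis (op_ring R) (right_module P) I p f"
    by (rule right_invertibleE[OF P])
  then have fin: "finite I"
    and p: "\<And>i. i \<in> I \<Longrightarrow> p i \<in> carrier P" and f: "\<And>i. i \<in> I \<Longrightarrow> f i \<in> add_hom P R"
    and fr: "\<And>i a x. \<lbrakk>i \<in> I; a \<in> carrier R; x \<in> carrier P\<rbrakk> \<Longrightarrow> f i (x \<odot>\<^sub>r\<^bsub>P\<^esub> a) = f i x \<otimes>\<^bsub>R\<^esub> a"
    and fs: "\<And>x. x \<in> carrier P \<Longrightarrow> (\<Oplus>\<^bsub>P\<^esub>i\<in>I. p i \<odot>\<^sub>r\<^bsub>P\<^esub> f i x) = x"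
    by (simp_all add: right_dual_basis_iff)
  have \<phi>h: "\<phi> \<in> add_hom T T" and \<phi>r: "\<And>a t. \<lbrakk>a \<in> carrier R; t \<in> carrier T\<rbrakk> \<Longrightarrow> \<phi> (t \<odot>\<^sub>r\<^bsub>T\<^esub> a) = \<phi> t \<odot>\<^sub>r\<^bsub>T\<^esub> a"
    using \<phi> by (auto simp: right_hom_iff)
  note [simp] = add_hom_closed[OF f] add_hom_closed[OF \<phi>h] p P.smult_closed Q.smult_closed
    P.rsmult_closed Q.rsmult_closed ten_closed T.rsmult_closed T.smult_closed
  \<comment> \<open>\<open>c i\<close> is the coordinate of a tensor at \<open>p i\<close>, with
    values in \<open>Q\<close>.\<close>
  have "\<exists>c. \<forall>i\<in>I. c i \<in> add_hom T Q \<and> (\<forall>x\<in>carrier P. \<forall>y\<in>carrier Q. c i (x \<otimes>\<^sub>t y) = f i x \<odot>\<^bsub>Q\<^esub> y)"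
  proof (intro bchoice ballI)
    fix i assume i: "i \<in> I"
    have "balanced R P Q Q (\<lambda>x y. f i x \<odot>\<^bsub>Q\<^esub> y)"
      unfolding balanced_def using i
      by (intro conjI ballI add_homI)
        (simp_all add: add_hom_add[OF f] fr Q.smult_l_distr Q.smult_r_distr Q.smult_assoc)
    then show "\<exists>c. c \<in> add_hom T Q \<and> (\<forall>x\<in>carrier P. \<forall>y\<in>carrier Q. c (x \<otimes>\<^sub>t y) = f i x \<odot>\<^bsub>Q\<^esub> y)"
      by (rule tensor_lift_ex[OF Q.M.abelian_group_axioms])
  qed
  then obtain c where c: "\<And>i. i \<in> I \<Longrightarrow> c i \<in> add_hom T Q"
    and ct: "\<And>i x y. \<lbrakk>i \<in> I; x \<in> carrier P; y \<in> carrier Q\<rbrakk> \<Longrightarrow> c i (x \<otimes>\<^sub>t y) = f i x \<odot>\<^bsub>Q\<^esub> y"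
    by blast
  note [simp] = add_hom_closed[OF c]
  have cr: "c i (t \<odot>\<^sub>r\<^bsub>T\<^esub> a) = c i t \<odot>\<^sub>r\<^bsub>Q\<^esub> a" if "i \<in> I" "a \<in> carrier R" "t \<in> carrier T" for i a t
    using that(3)
    by (induction rule: tensor_induct)
      (use that(1,2) in \<open>simp_all add: rsmult_ten ct T.rsmult_l_distr add_hom_add[OF c] Q.rsmult_l_distr
        Q.smult_rsmult\<close>)
  have decomp: "(\<Oplus>\<^bsub>T\<^esub>i\<in>I. p i \<otimes>\<^sub>t c i t) = t" if "t \<in> carrier T" for t
  proof (rule tensor_hom_eqI[OF add_hom_sum[OF abelian_group_tensor] _ _ that, of _ _ "\<lambda>t. t"])
    show "(\<lambda>t. p i \<otimes>\<^sub>t c i t) \<in> add_hom T T" if "i \<in> I" for i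
      using that by (intro add_hom_compose[OF c ten_add_hom_r]) simp_all
    show "(\<lambda>t. t) \<in> add_hom T T" by (simp add: add_homI)
    fix x y assume xy [simp]: "x \<in> carrier P" "y \<in> carrier Q"
    have "(\<Oplus>\<^bsub>T\<^esub>i\<in>I. p i \<otimes>\<^sub>t c i (x \<otimes>\<^sub>t y)) = (\<Oplus>\<^bsub>T\<^esub>i\<in>I. (p i \<odot>\<^sub>r\<^bsub>P\<^esub> f i x) \<otimes>\<^sub>t y)"
      by (intro T.M.finsum_cong') (simp_all add: ct ten_balanced)
    also have "\<dots> = (\<Oplus>\<^bsub>P\<^esub>i\<in>I. p i \<odot>\<^sub>r\<^bsub>P\<^esub> f i x) \<otimes>\<^sub>t y"
      using fin
      by (intro add_hom_finsum[OF ten_add_hom_l P.M.abelian_group_axioms abelian_group_tensor, symmetric])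
        simp_all
    finally show "(\<Oplus>\<^bsub>T\<^esub>i\<in>I. p i \<otimes>\<^sub>t c i (x \<otimes>\<^sub>t y)) = x \<otimes>\<^sub>t y" by (simp add: fs)
  qed
  have "\<exists>w. \<forall>j\<in>I. w j \<in> carrier P \<and> (\<forall>y\<in>carrier Q. \<phi> (p j \<otimes>\<^sub>t y) = w j \<otimes>\<^sub>t y)"
  proof (intro bchoice ballI)
    fix j assume j [simp]: "j \<in> I"
    \<comment> \<open>The matrix entry at \<open>i\<close> and \<open>j\<close> is a right
      endomorphism of \<open>Q\<close>, hence left multiplication by a scalar
      \<open>r i\<close>.\<close>
    have "\<exists>r. \<forall>i\<in>I. r i \<in> carrier R \<and> (\<forall>y\<in>carrier Q. c i (\<phi> (p j \<otimes>\<^sub>t y)) = r i \<odot>\<^bsub>Q\<^esub> y)"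
    proof (intro bchoice ballI)
      fix i assume i [simp]: "i \<in> I"
      have "(\<lambda>y. c i (\<phi> (p j \<otimes>\<^sub>t y))) \<in> right_hom R Q Q"
        unfolding right_hom_iff
        by (auto intro!: add_homI simp: ten_add_r add_hom_add[OF \<phi>h] add_hom_add[OF c] cr \<phi>r simp flip: rsmult_ten)
      then have "\<exists>r\<in>carrier R. \<forall>y\<in>carrier Q. c i (\<phi> (p j \<otimes>\<^sub>t y)) = r \<odot>\<^bsub>Q\<^esub> y"
        by (rule right_invertibleD[OF Q])
      then show "\<exists>r. r \<in> carrier R \<and> (\<forall>y\<in>carrier Q. c i (\<phi> (p j \<otimes>\<^sub>t y)) = r \<odot>\<^bsub>Q\<^esub> y)"
        by (simp only: Bex_def)
    qed
    then obtain r where r: "\<And>i. i \<in> I \<Longrightarrow> r i \<in> carrier R"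
      and rc: "\<And>i y. \<lbrakk>i \<in> I; y \<in> carrier Q\<rbrakk> \<Longrightarrow> c i (\<phi> (p j \<otimes>\<^sub>t y)) = r i \<odot>\<^bsub>Q\<^esub> y"
      by blast
    have "\<phi> (p j \<otimes>\<^sub>t y) = (\<Oplus>\<^bsub>P\<^esub>i\<in>I. p i \<odot>\<^sub>r\<^bsub>P\<^esub> r i) \<otimes>\<^sub>t y" if y [simp]: "y \<in> carrier Q" for y
    proof -
      have "\<phi> (p j \<otimes>\<^sub>t y) = (\<Oplus>\<^bsub>T\<^esub>i\<in>I. p i \<otimes>\<^sub>t c i (\<phi> (p j \<otimes>\<^sub>t y)))"
        by (rule decomp[symmetric]) simp
      also have "\<dots> = (\<Oplus>\<^bsub>T\<^esub>i\<in>I. (p i \<odot>\<^sub>r\<^bsub>P\<^esub> r i) \<otimes>\<^sub>t y)"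
        by (intro T.M.finsum_cong') (simp_all add: rc r ten_balanced)
      also have "\<dots> = (\<Oplus>\<^bsub>P\<^esub>i\<in>I. p i \<odot>\<^sub>r\<^bsub>P\<^esub> r i) \<otimes>\<^sub>t y"
        using fin r
        by (intro add_hom_finsum[OF ten_add_hom_l P.M.abelian_group_axioms abelian_group_tensor, symmetric])
          simp_all
      finally show ?thesis .
    qed
    then show "\<exists>w. w \<in> carrier P \<and> (\<forall>y\<in>carrier Q. \<phi> (p j \<otimes>\<^sub>t y) = w \<otimes>\<^sub>t y)"
      using r by (intro exI[of _ "\<Oplus>\<^bsub>P\<^esub>i\<in>I. p i \<odot>\<^sub>r\<^bsub>P\<^esub> r i"]) (auto intro!: P.M.finsum_closed)
  qed
  then obtain w where w [simp]: "\<And>j. j \<in> I \<Longrightarrow> w j \<in> carrier P"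
    and \<phi>w: "\<And>j y. \<lbrakk>j \<in> I; y \<in> carrier Q\<rbrakk> \<Longrightarrow> \<phi> (p j \<otimes>\<^sub>t y) = w j \<otimes>\<^sub>t y"
    by blast
  have sum_w: "(\<lambda>x. \<Oplus>\<^bsub>P\<^esub>j\<in>I. w j \<odot>\<^sub>r\<^bsub>P\<^esub> f j x) \<in> add_hom P P"
    by (intro add_hom_sum P.M.abelian_group_axioms add_homI) (simp_all add: add_hom_add[OF f] P.rsmult_r_distr)
  have "(\<lambda>x. \<Oplus>\<^bsub>P\<^esub>j\<in>I. w j \<odot>\<^sub>r\<^bsub>P\<^esub> f j x) \<in> right_hom R P P"
    unfolding right_hom_iff
  proof (intro conjI ballI sum_w)
    fix a x assume [simp]: "a \<in> carrier R" "x \<in> carrier P"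
    have "(\<Oplus>\<^bsub>P\<^esub>j\<in>I. w j \<odot>\<^sub>r\<^bsub>P\<^esub> f j (x \<odot>\<^sub>r\<^bsub>P\<^esub> a)) = (\<Oplus>\<^bsub>P\<^esub>j\<in>I. (w j \<odot>\<^sub>r\<^bsub>P\<^esub> f j x) \<odot>\<^sub>r\<^bsub>P\<^esub> a)"
      by (intro P.M.finsum_cong') (simp_all add: fr P.rsmult_assoc)
    also have "\<dots> = (\<Oplus>\<^bsub>P\<^esub>j\<in>I. w j \<odot>\<^sub>r\<^bsub>P\<^esub> f j x) \<odot>\<^sub>r\<^bsub>P\<^esub> a"
      using fin
      by (intro add_hom_finsum[OF _ P.M.abelian_group_axioms P.M.abelian_group_axioms, symmetric] add_homI)
        (simp_all add: P.rsmult_l_distr)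
    finally show "(\<Oplus>\<^bsub>P\<^esub>j\<in>I. w j \<odot>\<^sub>r\<^bsub>P\<^esub> f j (x \<odot>\<^sub>r\<^bsub>P\<^esub> a)) = (\<Oplus>\<^bsub>P\<^esub>j\<in>I. w j \<odot>\<^sub>r\<^bsub>P\<^esub> f j x) \<odot>\<^sub>r\<^bsub>P\<^esub> a" .
  qed
  then obtain s where s: "s \<in> carrier R"
    and sw: "\<forall>x\<in>carrier P. (\<Oplus>\<^bsub>P\<^esub>j\<in>I. w j \<odot>\<^sub>r\<^bsub>P\<^esub> f j x) = s \<odot>\<^bsub>P\<^esub> x"
    by (rule bexE[OF right_invertibleD[OF P]])
  have "\<phi> t = s \<odot>\<^bsub>T\<^esub> t" if "t \<in> carrier T" for t
  proof (rule tensor_hom_eqI[OF \<phi>h smult_add_hom_tensor[OF s] _ that])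
    fix x y assume xy [simp]: "x \<in> carrier P" "y \<in> carrier Q"
    have "\<phi> (x \<otimes>\<^sub>t y) = \<phi> ((\<Oplus>\<^bsub>P\<^esub>j\<in>I. p j \<odot>\<^sub>r\<^bsub>P\<^esub> f j x) \<otimes>\<^sub>t y)"
      by (simp add: fs)
    also have "\<dots> = (\<Oplus>\<^bsub>T\<^esub>j\<in>I. \<phi> ((p j \<odot>\<^sub>r\<^bsub>P\<^esub> f j x) \<otimes>\<^sub>t y))"
      using fin
      by (intro add_hom_finsum[OF add_hom_compose[OF ten_add_hom_l \<phi>h] P.M.abelian_group_axioms
            abelian_group_tensor]) simp_all
    also have "\<dots> = (\<Oplus>\<^bsub>T\<^esub>j\<in>I. (w j \<odot>\<^sub>r\<^bsub>P\<^esub> f j x) \<otimes>\<^sub>t y)"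
      by (intro T.M.finsum_cong') (simp_all add: ten_balanced \<phi>w)
    also have "\<dots> = (\<Oplus>\<^bsub>P\<^esub>j\<in>I. w j \<odot>\<^sub>r\<^bsub>P\<^esub> f j x) \<otimes>\<^sub>t y"
      using fin
      by (intro add_hom_finsum[OF ten_add_hom_l P.M.abelian_group_axioms abelian_group_tensor, symmetric])
        simp_all
    also have "\<dots> = s \<odot>\<^bsub>T\<^esub> (x \<otimes>\<^sub>t y)"
      using s by (simp add: sw smult_ten)
    finally show "\<phi> (x \<otimes>\<^sub>t y) = s \<odot>\<^bsub>T\<^esub> (x \<otimes>\<^sub>t y)" .
  qed
  then show ?thesis using s by blast
qed

lemma right_invertible_tensor:
  assumes "right_invertible R P" "right_invertible R Q"
  shows "right_invertible R T"
proof -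
  obtain I :: "'p set" and p f where "left_dual_basis (op_ring R) (right_module P) I p f"
    by (rule right_invertibleE[OF assms(1)])
  moreover obtain J :: "'q set" and q g where "left_dual_basis (op_ring R) (right_module Q) J q g"
    by (rule right_invertibleE[OF assms(2)])
  ultimately obtain h where "left_dual_basis (op_ring R) (right_module T) (I \<times> J) (\<lambda>(i, j). p i \<otimes>\<^sub>t q j) h"
    using right_dual_basis_tensor by blast
  then show ?thesis
    using right_endomorphism_tensor[OF assms] by (intro right_invertibleI[OF bimodule_tensor])
qed

end

text \<open>Up to isomorphism, the opposite of a tensor product is a tensor product of right
  invertible bimodules over the opposite ring, so the right-sided result is used once for each
  half.\<close>

lemma partially_invertible_tensor:
  assumes "partially_invertible R P" "partially_invertible R Q"
  shows "partially_invertible R (tensor R P Q)"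
proof -
  interpret bimodule_pair R P Q
    using assms by (intro bimodule_pair.intro partially_invertible_imp_bimodule)
  interpret O: bimodule_pair "op_ring R" "op_bimod Q" "op_bimod P"
    by (intro bimodule_pair.intro P.bimodule_op Q.bimodule_op)
  have "right_invertible (op_ring R) (op_bimod T)"
    using right_invertible_isomorphic[OF tensor_op O.right_invertible_tensor] assms
      bimodule.bimodule_op[OF bimodule_tensor]
    by (simp add: partially_invertible_iff)
  then show ?thesis
    using right_invertible_tensor assms by (simp add: partially_invertible_iff)
qed

section \<open>The monoid of isomorphism classes\<close>

text \<open>Transport of structure, used to move a bimodule into the type of the
  representatives.\<close>

lemma bimodule_transport:
  fixes \<kappa> :: "'m \<Rightarrow> 'n"
  assumes "bimodule R M" and inj: "inj_on \<kappa> (carrier M)"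
  obtains N :: "('a, 'n) bimod" where "bimodule R N" "bimod_isomorphic R N M"
proof -
  interpret M: bimodule R M by fact
  define d where "d = inv_into (carrier M) \<kappa>"
  define N :: "('a, 'n) bimod" where "N = \<lparr>carrier = \<kappa> ` carrier M, monoid.mult = undefined, one = undefined,
    ring.zero = \<kappa> \<zero>\<^bsub>M\<^esub>, add = (\<lambda>u v. \<kappa> (d u \<oplus>\<^bsub>M\<^esub> d v)),
    smult = (\<lambda>a u. \<kappa> (a \<odot>\<^bsub>M\<^esub> d u)), rsmult = (\<lambda>u a. \<kappa> (d u \<odot>\<^sub>r\<^bsub>M\<^esub> a))\<rparr>"
  have d [simp]: "d (\<kappa> x) = x" if "x \<in> carrier M" for x
    using that inj by (simp add: d_def)
  have [simp]: "carrier N = \<kappa> ` carrier M" "\<zero>\<^bsub>N\<^esub> = \<kappa> \<zero>\<^bsub>M\<^esub>" "u \<oplus>\<^bsub>N\<^esub> v = \<kappa> (d u \<oplus>\<^bsub>M\<^esub> d v)"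
    "a \<odot>\<^bsub>N\<^esub> u = \<kappa> (a \<odot>\<^bsub>M\<^esub> d u)" "u \<odot>\<^sub>r\<^bsub>N\<^esub> a = \<kappa> (d u \<odot>\<^sub>r\<^bsub>M\<^esub> a)" for u v a
    by (simp_all add: N_def)
  note [simp] = M.smult_closed M.rsmult_closed
  have "abelian_group N"
  proof (rule abelian_groupI, goal_cases)
    case (6 u)
    then obtain x where x: "x \<in> carrier M" "u = \<kappa> x" by auto
    then show ?case
      by (intro bexI[of _ "\<kappa> (\<ominus>\<^bsub>M\<^esub> x)"]) (auto simp: M.M.l_neg)
  qed (auto simp: M.M.a_ac)
  then have "bimodule R N"
    by (intro bimodule.intro bimodule_axioms.intro M.R.ring_axioms)
      (auto simp: M.smult_l_distr M.smult_r_distr M.smult_assoc M.smult_one M.smult_rsmult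
        M.rsmult_l_distr M.rsmult_r_distr M.rsmult_assoc M.rsmult_one)
  moreover have "bimod_isomorphic R N M"
    by (rule bimod_isomorphicI[of d _ _ _ \<kappa>]) (auto simp: bimod_hom_iff intro!: add_homI)
  ultimately show thesis by (rule that)
qed

lemma iso_class_cong:
  assumes "bimod_isomorphic R M N" "bimodule R M"
  shows "iso_class R M = iso_class R N"
  using bimod_isomorphic_trans[OF _ assms(1)] bimod_isomorphic_trans[OF _ bimod_isomorphic_sym[OF assms]]
  by (auto simp: iso_class_def)

text \<open>By the expansion in a left dual basis, an element is determined by its finitely many
  coordinates, and numbering the basis makes them a function on \<open>nat\<close>. Without a
  representative of this type \<open>iso_class R P\<close> would be empty.\<close>

lemma partially_invertible_representative:
  fixes P :: "('a, 'm, 'e) bimod_scheme"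
  assumes "partially_invertible R P"
  obtains N :: "('a, nat \<Rightarrow> 'a) bimod" where "bimodule R N" "bimod_isomorphic R N P"
proof -
  interpret bimodule R P using assms by (rule partially_invertible_imp_bimodule)
  obtain I :: "'m set" and p f where "left_dual_basis R P I p f"
    using left_module.fgp_imp_left_dual_basis[OF left_module] assms by (auto simp: partially_invertible_def)
  then have fin: "finite I" and sum: "\<And>x. x \<in> carrier P \<Longrightarrow> (\<Oplus>\<^bsub>P\<^esub>i\<in>I. f i x \<odot>\<^bsub>P\<^esub> p i) = x"
    and p: "\<And>i. i \<in> I \<Longrightarrow> p i \<in> carrier P" and f: "\<And>i. i \<in> I \<Longrightarrow> f i \<in> add_hom P R"
    by (auto simp: left_dual_basis_def left_hom_iff)
  obtain e n where e: "I = e ` {i :: nat. i < n}"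
    using finite_imp_nat_seg_image_inj_on[OF fin] by blast
  \<comment> \<open>From \<open>n\<close> on the value is the same for all \<open>x\<close>, so
    elements are distinguished by their coordinates alone.\<close>
  define \<kappa> where "\<kappa> x = (\<lambda>k. if k < n then f (e k) x else undefined)" for x
  have "inj_on \<kappa> (carrier P)"
  proof (rule inj_onI)
    fix x y assume xy: "x \<in> carrier P" "y \<in> carrier P" and eq: "\<kappa> x = \<kappa> y"
    have "f i x = f i y" if "i \<in> I" for i
    proof -
      obtain k where "i = e k" "k < n" using \<open>i \<in> I\<close> e by blast
      then show ?thesis using fun_cong[OF eq, of k] by (simp add: \<kappa>_def)
    qed
    then have "(\<Oplus>\<^bsub>P\<^esub>i\<in>I. f i x \<odot>\<^bsub>P\<^esub> p i) = (\<Oplus>\<^bsub>P\<^esub>i\<in>I. f i y \<odot>\<^bsub>P\<^esub> p i)"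
      using xy by (intro M.finsum_cong') (auto simp: smult_closed p add_hom_closed[OF f])
    then show "x = y" using xy by (simp add: sum)
  qed
  then show thesis using bimodule_transport[OF bimodule_axioms] that by blast
qed

text \<open>Tensor products respect isomorphism, so all pairs of representatives contribute the same
  class; the union equals that class because both index sets are nonempty.\<close>

lemma iso_class_mult:
  assumes "partially_invertible R P" "partially_invertible R Q"
  shows "iso_class R P \<otimes>\<^bsub>PicS R\<^esub> iso_class R Q = iso_class R (tensor R P Q)"
proof -
  note bim = assms[THEN partially_invertible_imp_bimodule]
  have "iso_class R (tensor R P' Q') = iso_class R (tensor R P Q)"
    if "P' \<in> iso_class R P" "Q' \<in> iso_class R Q" for P' Q'
  proof -
    have *: "bimodule R P'" "bimod_isomorphic R P' P" "bimodule R Q'" "bimod_isomorphic R Q' Q"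
      using that by (auto simp: iso_class_def)
    then show ?thesis
      by (intro iso_class_cong tensor_cong bim bimodule_pair.bimodule_tensor bimodule_pair.intro)
  qed
  moreover obtain P' where "P' \<in> iso_class R P"
    by (rule partially_invertible_representative[OF assms(1)]) (auto simp: iso_class_def)
  moreover obtain Q' where "Q' \<in> iso_class R Q"
    by (rule partially_invertible_representative[OF assms(2)]) (auto simp: iso_class_def)
  ultimately show ?thesis
    unfolding PicS_def by auto
qed

text \<open>Membership in the carrier asks for an invertible bimodule of the fixed type, so the
  representative must inherit invertibility from \<open>P\<close>.\<close>

lemma iso_class_in_PicS:
  assumes "partially_invertible R P"
  shows "iso_class R P \<in> carrier (PicS R)"
proof -
  obtain N :: "('a, nat \<Rightarrow> 'a) bimod" where N: "bimodule R N" "bimod_isomorphic R N P"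
    by (rule partially_invertible_representative[OF assms])
  then have "partially_invertible R N"
    using partially_invertible_isomorphic[OF bimod_isomorphic_sym[OF N(2,1)] assms N(1)] by simp
  then show ?thesis
    using iso_class_cong[OF N(2,1)] by (auto simp: PicS_def)
qed

lemma PicS_carrierE:
  assumes "C \<in> carrier (PicS R)"
  obtains P :: "('a, nat \<Rightarrow> 'a) bimod" where "C = iso_class R P" "partially_invertible R P"
  using assms by (auto simp: PicS_def)

text \<open>The unit alone is a dual basis, and a right endomorphism is left multiplication by its
  value at the unit.\<close>

lemma right_invertible_regular:
  assumes "ring R"
  shows "right_invertible R (regular_bimod R)"
proof -
  interpret bimodule R "regular_bimod R" by (rule bimodule_regular[OF assms])
  show ?thesis
  proof (rule right_invertibleI[OF bimodule_axioms])
    show "left_dual_basis (op_ring R) (right_module (regular_bimod R)) {()} (\<lambda>_. \<one>\<^bsub>R\<^esub>) (\<lambda>_ x. x)"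
      using M.finsum_insert[of "{}" "()"] by (auto simp: right_dual_basis_iff intro: add_homI)
    fix \<phi> assume \<phi>: "\<phi> \<in> right_hom R (regular_bimod R) (regular_bimod R)"
    have eq: "\<phi> x = \<phi> \<one>\<^bsub>R\<^esub> \<otimes>\<^bsub>R\<^esub> x" if "x \<in> carrier R" for x
      using \<phi>[unfolded right_hom_iff, THEN conjunct2, rule_format, of x "\<one>\<^bsub>R\<^esub>"] that by simp
    have "\<phi> \<one>\<^bsub>R\<^esub> \<in> carrier R"
      using \<phi> by (auto simp: right_hom_iff add_hom_def)
    then show "\<exists>a\<in>carrier R. \<forall>x\<in>carrier (regular_bimod R). \<phi> x = a \<odot>\<^bsub>regular_bimod R\<^esub> x"
      unfolding carrier_sub_bimod smult_sub_bimod by (rule bexI[rotated]) (intro ballI eq)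
  qed
qed

lemma partially_invertible_regular:
  assumes "ring R"
  shows "partially_invertible R (regular_bimod R)"
proof -
  \<comment> \<open>Carrier, addition and actions agree, but the two records may differ in the field
    \<open>mult\<close>, which carries no meaning here. So the identity is used as an isomorphism in
    place of an equality.\<close>
  have "bimod_isomorphic (op_ring R) (regular_bimod (op_ring R)) (op_bimod (regular_bimod R))"
    by (rule bimod_isomorphicI[of "\<lambda>x. x" _ _ _ "\<lambda>x. x"]) (auto simp: bimod_hom_iff add_hom_def)
  then have "right_invertible (op_ring R) (op_bimod (regular_bimod R))"
    by (rule right_invertible_isomorphic[OF _ right_invertible_regular[OF ring_op_ring[OF assms]]
          bimodule.bimodule_op[OF bimodule_regular[OF assms]]])
  then show ?thesis
    using right_invertible_regular[OF assms] by (simp add: partially_invertible_iff)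
qed

lemma monoid_PicS:
  assumes "ring R"
  shows "monoid (PicS R)"
proof (rule monoidI)
  note bim = partially_invertible_imp_bimodule
  have one: "\<one>\<^bsub>PicS R\<^esub> = iso_class R (regular_bimod R)"
    by (simp add: PicS_def)
  show "\<one>\<^bsub>PicS R\<^esub> \<in> carrier (PicS R)"
    unfolding one by (rule iso_class_in_PicS[OF partially_invertible_regular[OF assms]])
  fix C D E assume C: "C \<in> carrier (PicS R)"
  obtain P :: "('a, nat \<Rightarrow> 'a) bimod" where P: "C = iso_class R P" "partially_invertible R P"
    by (rule PicS_carrierE[OF C])
  show "\<one>\<^bsub>PicS R\<^esub> \<otimes>\<^bsub>PicS R\<^esub> C = C"
    unfolding one P(1) iso_class_mult[OF partially_invertible_regular[OF assms] P(2)]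
    by (intro iso_class_cong tensor_unit_left bimodule_pair.bimodule_tensor bimodule_pair.intro
        bimodule_regular assms bim P)
  show "C \<otimes>\<^bsub>PicS R\<^esub> \<one>\<^bsub>PicS R\<^esub> = C"
    unfolding one P(1) iso_class_mult[OF P(2) partially_invertible_regular[OF assms]]
    by (intro iso_class_cong tensor_unit_right bimodule_pair.bimodule_tensor bimodule_pair.intro
        bimodule_regular assms bim P)
  assume D: "D \<in> carrier (PicS R)"
  obtain Q :: "('a, nat \<Rightarrow> 'a) bimod" where Q: "D = iso_class R Q" "partially_invertible R Q"
    by (rule PicS_carrierE[OF D])
  show "C \<otimes>\<^bsub>PicS R\<^esub> D \<in> carrier (PicS R)"
    using P Q by (simp add: iso_class_mult iso_class_in_PicS partially_invertible_tensor)
  assume E: "E \<in> carrier (PicS R)"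
  obtain S :: "('a, nat \<Rightarrow> 'a) bimod" where S: "E = iso_class R S" "partially_invertible R S"
    by (rule PicS_carrierE[OF E])
  have "bimod_isomorphic R (tensor R (tensor R P Q) S) (tensor R P (tensor R Q S))"
    by (intro tensor_assoc bim P Q S)
  then show "C \<otimes>\<^bsub>PicS R\<^esub> D \<otimes>\<^bsub>PicS R\<^esub> E = C \<otimes>\<^bsub>PicS R\<^esub> (D \<otimes>\<^bsub>PicS R\<^esub> E)"
    using P Q S
    by (simp add: iso_class_mult partially_invertible_tensor iso_class_cong bim)
qed

section \<open>Epsilon-strongly graded rings\<close>

lemma principal_component_simps [simp]:
  "carrier (principal_component G A \<A>) = \<A> \<one>\<^bsub>G\<^esub>"
  "x \<oplus>\<^bsub>principal_component G A \<A>\<^esub> y = x \<oplus>\<^bsub>A\<^esub> y"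
  "x \<otimes>\<^bsub>principal_component G A \<A>\<^esub> y = x \<otimes>\<^bsub>A\<^esub> y"
  "\<zero>\<^bsub>principal_component G A \<A>\<^esub> = \<zero>\<^bsub>A\<^esub>"
  "\<one>\<^bsub>principal_component G A \<A>\<^esub> = \<one>\<^bsub>A\<^esub>"
  by (simp_all add: principal_component_def)

lemma (in ring) finsum_additive_subgroup:
  assumes X: "additive_subgroup X R" and "\<And>i. i \<in> I \<Longrightarrow> x i \<in> X"
  shows "(\<Oplus>i\<in>I. x i) \<in> X"
proof -
  interpret additive_subgroup X R by (rule X)
  show ?thesis
    using assms(2)
  proof (induction I rule: infinite_finite_induct)
    case (insert i I)
    then have "x \<in> insert i I \<rightarrow> carrier R" using a_subset by blast
    with insert show ?case by (subst finsum_insert) auto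
  qed auto
qed

locale epsilon_graded = graded_ring G A \<A>
  for G :: "('g, 'h) monoid_scheme" and A :: "('a, 'r) ring_scheme" and \<A> :: "'g \<Rightarrow> 'a set" +
  fixes \<epsilon> :: "'g \<Rightarrow> 'a"
  assumes epsilon: "epsilon_family G A \<A> \<epsilon>"
begin

abbreviation R :: "('a, 'r) ring_scheme"
  where "R \<equiv> principal_component G A \<A>"

lemma component_closed: "\<lbrakk>g \<in> carrier G; x \<in> \<A> g\<rbrakk> \<Longrightarrow> x \<in> carrier A"
  using additive_subgroup.a_Hcarr[OF component] .

lemma component_one_closed: "x \<in> \<A> \<one>\<^bsub>G\<^esub> \<Longrightarrow> x \<in> carrier A"
  and component_inv_closed: "\<lbrakk>g \<in> carrier G; x \<in> \<A> (inv\<^bsub>G\<^esub> g)\<rbrakk> \<Longrightarrow> x \<in> carrier A"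
  by (auto intro: component_closed[of "\<one>\<^bsub>G\<^esub>"] component_closed[of "inv\<^bsub>G\<^esub> g"])

lemma component_mult_eq:
  "\<lbrakk>x \<in> \<A> g; y \<in> \<A> h; g \<in> carrier G; h \<in> carrier G; g \<otimes>\<^bsub>G\<^esub> h = k\<rbrakk> \<Longrightarrow> x \<otimes>\<^bsub>A\<^esub> y \<in> \<A> k"
  using component_mult by blast

lemma epsilon_sum:
  assumes "g \<in> carrier G"
  obtains n :: nat and a b where "\<And>i. i < n \<Longrightarrow> a i \<in> \<A> g" "\<And>i. i < n \<Longrightarrow> b i \<in> \<A> (inv\<^bsub>G\<^esub> g)"
    "\<epsilon> g = (\<Oplus>\<^bsub>A\<^esub>i\<in>{..<n}. a i \<otimes>\<^bsub>A\<^esub> b i)"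
proof -
  have "\<epsilon> g \<in> sums_of_products A (\<A> g) (\<A> (inv\<^bsub>G\<^esub> g))"
    using assms epsilon by (simp add: epsilon_family_def)
  then obtain n :: nat and a b where "\<epsilon> g = (\<Oplus>\<^bsub>A\<^esub>i\<in>{..<n}. a i \<otimes>\<^bsub>A\<^esub> b i)"
    "a \<in> {..<n} \<rightarrow> \<A> g" "b \<in> {..<n} \<rightarrow> \<A> (inv\<^bsub>G\<^esub> g)"
    unfolding sums_of_products_def by blast
  then show thesis by (intro that[of n a b]) auto
qed

lemma epsilon_left: "\<lbrakk>g \<in> carrier G; x \<in> \<A> g\<rbrakk> \<Longrightarrow> \<epsilon> g \<otimes>\<^bsub>A\<^esub> x = x"
  and epsilon_right': "\<lbrakk>g \<in> carrier G; x \<in> \<A> g\<rbrakk> \<Longrightarrow> x \<otimes>\<^bsub>A\<^esub> \<epsilon> (inv\<^bsub>G\<^esub> g) = x"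
  using epsilon by (simp_all add: epsilon_family_def)

lemma epsilon_right: "\<lbrakk>g \<in> carrier G; x \<in> \<A> (inv\<^bsub>G\<^esub> g)\<rbrakk> \<Longrightarrow> x \<otimes>\<^bsub>A\<^esub> \<epsilon> g = x"
  using epsilon_right'[of "inv\<^bsub>G\<^esub> g" x] by simp

lemma epsilon_in_one: "g \<in> carrier G \<Longrightarrow> \<epsilon> g \<in> \<A> \<one>\<^bsub>G\<^esub>"
proof -
  assume g: "g \<in> carrier G"
  obtain n :: nat and a b where "\<And>i. i < n \<Longrightarrow> a i \<in> \<A> g" "\<And>i. i < n \<Longrightarrow> b i \<in> \<A> (inv\<^bsub>G\<^esub> g)"
    "\<epsilon> g = (\<Oplus>\<^bsub>A\<^esub>i\<in>{..<n}. a i \<otimes>\<^bsub>A\<^esub> b i)"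
    by (rule epsilon_sum[OF g], rule that)
  then show ?thesis
    using g by (auto intro!: A.finsum_additive_subgroup component component_mult_eq[of _ g _ "inv\<^bsub>G\<^esub> g"])
qed

lemma epsilon_closed: "g \<in> carrier G \<Longrightarrow> \<epsilon> g \<in> carrier A"
  using epsilon_in_one component_closed by blast

text \<open>On \<open>\<A> g\<close> the idempotent \<open>\<epsilon> (inv g)\<close> acts as a right identity, and \<open>\<epsilon> \<one>\<close> is the identity of \<open>\<A> \<one>\<close>, so
  \<open>\<epsilon> \<one>\<close> is a right identity on every component.\<close>

lemma one_in_component: "\<one>\<^bsub>A\<^esub> \<in> \<A> \<one>\<^bsub>G\<^esub>"
proof -
  let ?e = "\<epsilon> \<one>\<^bsub>G\<^esub>"
  have e: "?e \<in> \<A> \<one>\<^bsub>G\<^esub>" "?e \<in> carrier A"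
    by (simp_all add: epsilon_in_one epsilon_closed)
  have hom: "x \<otimes>\<^bsub>A\<^esub> ?e = x" if "g \<in> carrier G" "x \<in> \<A> g" for g x
  proof -
    have "x \<otimes>\<^bsub>A\<^esub> ?e = (x \<otimes>\<^bsub>A\<^esub> \<epsilon> (inv\<^bsub>G\<^esub> g)) \<otimes>\<^bsub>A\<^esub> ?e"
      using that by (simp add: epsilon_right')
    also have "\<dots> = x \<otimes>\<^bsub>A\<^esub> (\<epsilon> (inv\<^bsub>G\<^esub> g) \<otimes>\<^bsub>A\<^esub> ?e)"
      using that e by (simp add: A.m_assoc component_closed[of g] epsilon_closed)
    also have "\<epsilon> (inv\<^bsub>G\<^esub> g) \<otimes>\<^bsub>A\<^esub> ?e = \<epsilon> (inv\<^bsub>G\<^esub> g)"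
      using that epsilon_right'[of "\<one>\<^bsub>G\<^esub>" "\<epsilon> (inv\<^bsub>G\<^esub> g)"] by (simp add: epsilon_in_one)
    finally show ?thesis using that by (simp add: epsilon_right')
  qed
  \<comment> \<open>Multiplication by \<open>?e\<close> on the right fixes every homogeneous part of
    the unit of \<open>A\<close>, hence the unit itself, and so \<open>?e\<close> is the
    unit.\<close>
  obtain f where f: "f \<in> (\<Pi>\<^sub>E g\<in>carrier G. \<A> g)" "finite {g \<in> carrier G. f g \<noteq> \<zero>\<^bsub>A\<^esub>}"
    "\<one>\<^bsub>A\<^esub> = (\<Oplus>\<^bsub>A\<^esub>g\<in>{g \<in> carrier G. f g \<noteq> \<zero>\<^bsub>A\<^esub>}. f g)"
    using direct_sum[OF A.one_closed] by blast
  have fc: "f g \<in> \<A> g" "f g \<in> carrier A" if "g \<in> carrier G" for g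
    using f(1) that component_closed by auto
  have "?e = \<one>\<^bsub>A\<^esub> \<otimes>\<^bsub>A\<^esub> ?e" using e by simp
  also have "\<dots> = (\<Oplus>\<^bsub>A\<^esub>g\<in>{g \<in> carrier G. f g \<noteq> \<zero>\<^bsub>A\<^esub>}. f g \<otimes>\<^bsub>A\<^esub> ?e)"
    unfolding f(3) using f(2) fc e by (intro A.finsum_ldistr) auto
  also have "\<dots> = (\<Oplus>\<^bsub>A\<^esub>g\<in>{g \<in> carrier G. f g \<noteq> \<zero>\<^bsub>A\<^esub>}. f g)"
    using fc hom by (intro A.finsum_cong') auto
  also have "\<dots> = \<one>\<^bsub>A\<^esub>" using f(3) by simp
  finally show ?thesis using e by simp
qed

lemma ring_R: "ring R"
proof -
  interpret one: additive_subgroup "\<A> \<one>\<^bsub>G\<^esub>" A by (simp add: component)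
  note cl = component_closed[OF G.one_closed]
  have "\<exists>y\<in>\<A> \<one>\<^bsub>G\<^esub>. x \<oplus>\<^bsub>A\<^esub> y = \<zero>\<^bsub>A\<^esub>" if "x \<in> \<A> \<one>\<^bsub>G\<^esub>" for x
    using that cl by (intro bexI[of _ "\<ominus>\<^bsub>A\<^esub> x"]) (auto simp: A.r_neg)
  then show ?thesis
    by (intro ringI abelian_groupI monoidI)
      (auto simp: cl A.a_ac A.m_assoc A.l_distr A.r_distr one_in_component intro: component_mult_eq)
qed

section \<open>Sub-bimodules of the graded ring and centrality of the idempotents\<close>

definition sub_bimodule :: "'a set \<Rightarrow> bool"
  where "sub_bimodule X \<longleftrightarrow> additive_subgroup X A \<and>
    (\<forall>r\<in>\<A> \<one>\<^bsub>G\<^esub>. \<forall>x\<in>X. r \<otimes>\<^bsub>A\<^esub> x \<in> X \<and> x \<otimes>\<^bsub>A\<^esub> r \<in> X)"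

lemma sub_bimoduleD:
  assumes "sub_bimodule X" "x \<in> X"
  shows "x \<in> carrier A" "r \<in> \<A> \<one>\<^bsub>G\<^esub> \<Longrightarrow> r \<otimes>\<^bsub>A\<^esub> x \<in> X" "r \<in> \<A> \<one>\<^bsub>G\<^esub> \<Longrightarrow> x \<otimes>\<^bsub>A\<^esub> r \<in> X"
  using assms by (auto simp: sub_bimodule_def dest: additive_subgroup.a_Hcarr)

lemma bimodule_sub:
  assumes "sub_bimodule X"
  shows "bimodule R (sub_bimod A X)"
proof -
  interpret X: additive_subgroup X A using assms by (simp add: sub_bimodule_def)
  note cl = component_closed[OF G.one_closed] sub_bimoduleD[OF assms]
  have "\<exists>y\<in>X. y \<oplus>\<^bsub>A\<^esub> x = \<zero>\<^bsub>A\<^esub>" if "x \<in> X" for x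
    using that cl(2) by (intro bexI[of _ "\<ominus>\<^bsub>A\<^esub> x"]) (auto simp: A.l_neg)
  then show ?thesis
    by (intro bimodule.intro bimodule_axioms.intro ring_R abelian_groupI)
      (auto simp: cl A.a_ac A.m_assoc A.l_distr A.r_distr)
qed

text \<open>\<open>finsum\<close> depends on the record, but the inclusion into \<open>A\<close> is
  additive and so takes sums to sums.\<close>

lemma finsum_sub_bimod:
  assumes "sub_bimodule X" "finite I" "\<And>i. i \<in> I \<Longrightarrow> x i \<in> X"
  shows "(\<Oplus>\<^bsub>sub_bimod A X\<^esub>i\<in>I. x i) = (\<Oplus>\<^bsub>A\<^esub>i\<in>I. x i)"
proof -
  interpret X: bimodule R "sub_bimod A X" by (rule bimodule_sub[OF assms(1)])
  have "(\<lambda>x. x) \<in> add_hom (sub_bimod A X) A"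
    using sub_bimoduleD[OF assms(1)] by (auto intro: add_homI)
  from add_hom_finsum[OF this X.M.abelian_group_axioms A.abelian_group_axioms assms(2), of x]
  show ?thesis using assms(3) by simp
qed

lemma sub_bimodule_component: "g \<in> carrier G \<Longrightarrow> sub_bimodule (\<A> g)"
  by (auto simp: sub_bimodule_def component intro: component_mult_eq)

text \<open>Both products equal \<open>\<epsilon> g r \<epsilon> g\<close>. In
  \<open>\<epsilon> g r\<close> the factors \<open>b i r\<close> stay in the component of
  \<open>inv g\<close>, where \<open>\<epsilon> g\<close> is a right identity; in
  \<open>r \<epsilon> g\<close> the factors \<open>r a i\<close> stay in the component of
  \<open>g\<close>, where it is a left identity.\<close>

lemma epsilon_central:
  assumes g: "g \<in> carrier G" and r: "r \<in> \<A> \<one>\<^bsub>G\<^esub>"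
  shows "\<epsilon> g \<otimes>\<^bsub>A\<^esub> r = r \<otimes>\<^bsub>A\<^esub> \<epsilon> g"
proof -
  obtain n :: nat and a b where ab: "\<And>i. i < n \<Longrightarrow> a i \<in> \<A> g" "\<And>i. i < n \<Longrightarrow> b i \<in> \<A> (inv\<^bsub>G\<^esub> g)"
    and sum: "\<epsilon> g = (\<Oplus>\<^bsub>A\<^esub>i\<in>{..<n}. a i \<otimes>\<^bsub>A\<^esub> b i)"
    by (rule epsilon_sum[OF g], rule that)
  have cl [simp]: "r \<in> carrier A" "\<epsilon> g \<in> carrier A" "\<And>i. i < n \<Longrightarrow> a i \<in> carrier A" "\<And>i. i < n \<Longrightarrow> b i \<in> carrier A"
    using r g ab by (auto intro: component_closed[OF g] component_inv_closed[OF g] component_one_closed epsilon_closed)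
  have br: "b i \<otimes>\<^bsub>A\<^esub> r \<in> \<A> (inv\<^bsub>G\<^esub> g)" and ra: "r \<otimes>\<^bsub>A\<^esub> a i \<in> \<A> g" if "i < n" for i
    using component_mult_eq[OF ab(2)[OF that] r] component_mult_eq[OF r ab(1)[OF that]] g by simp_all
  have "\<epsilon> g \<otimes>\<^bsub>A\<^esub> r = (\<Oplus>\<^bsub>A\<^esub>i\<in>{..<n}. a i \<otimes>\<^bsub>A\<^esub> (b i \<otimes>\<^bsub>A\<^esub> r))"
    unfolding sum by (subst A.finsum_ldistr) (auto simp: A.m_assoc intro!: A.finsum_cong')
  also have "\<dots> = (\<Oplus>\<^bsub>A\<^esub>i\<in>{..<n}. a i \<otimes>\<^bsub>A\<^esub> (b i \<otimes>\<^bsub>A\<^esub> r) \<otimes>\<^bsub>A\<^esub> \<epsilon> g)"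
    using epsilon_right[OF g br] by (intro A.finsum_cong') (auto simp: A.m_assoc)
  also have "\<dots> = \<epsilon> g \<otimes>\<^bsub>A\<^esub> r \<otimes>\<^bsub>A\<^esub> \<epsilon> g"
    by (subst (2) sum) (auto simp: A.finsum_ldistr A.m_assoc simp del: A.finsum_closed intro!: A.finsum_cong')
  finally have 1: "\<epsilon> g \<otimes>\<^bsub>A\<^esub> r = \<epsilon> g \<otimes>\<^bsub>A\<^esub> r \<otimes>\<^bsub>A\<^esub> \<epsilon> g" .
  have "r \<otimes>\<^bsub>A\<^esub> \<epsilon> g = (\<Oplus>\<^bsub>A\<^esub>i\<in>{..<n}. r \<otimes>\<^bsub>A\<^esub> a i \<otimes>\<^bsub>A\<^esub> b i)"
    unfolding sum by (subst A.finsum_rdistr) (auto simp: A.m_assoc intro!: A.finsum_cong')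
  also have "\<dots> = (\<Oplus>\<^bsub>A\<^esub>i\<in>{..<n}. \<epsilon> g \<otimes>\<^bsub>A\<^esub> (r \<otimes>\<^bsub>A\<^esub> a i \<otimes>\<^bsub>A\<^esub> b i))"
    using epsilon_left[OF g ra] by (intro A.finsum_cong') (auto simp flip: A.m_assoc)
  also have "\<dots> = \<epsilon> g \<otimes>\<^bsub>A\<^esub> (\<Oplus>\<^bsub>A\<^esub>i\<in>{..<n}. r \<otimes>\<^bsub>A\<^esub> a i \<otimes>\<^bsub>A\<^esub> b i)"
    by (rule A.finsum_rdistr[symmetric]) auto
  also have "(\<Oplus>\<^bsub>A\<^esub>i\<in>{..<n}. r \<otimes>\<^bsub>A\<^esub> a i \<otimes>\<^bsub>A\<^esub> b i) = r \<otimes>\<^bsub>A\<^esub> \<epsilon> g"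
    unfolding sum by (subst A.finsum_rdistr) (auto simp: A.m_assoc intro!: A.finsum_cong')
  finally show ?thesis using 1 by (simp add: A.m_assoc)
qed

lemma epsilon_idem: "g \<in> carrier G \<Longrightarrow> \<epsilon> g \<otimes>\<^bsub>A\<^esub> \<epsilon> g = \<epsilon> g"
proof -
  assume g: "g \<in> carrier G"
  obtain n :: nat and a b where ab: "\<And>i. i < n \<Longrightarrow> a i \<in> \<A> g" "\<And>i. i < n \<Longrightarrow> b i \<in> \<A> (inv\<^bsub>G\<^esub> g)"
    and sum: "\<epsilon> g = (\<Oplus>\<^bsub>A\<^esub>i\<in>{..<n}. a i \<otimes>\<^bsub>A\<^esub> b i)"
    by (rule epsilon_sum[OF g], rule that)
  have cl [simp]: "\<epsilon> g \<in> carrier A" "\<And>i. i < n \<Longrightarrow> a i \<in> carrier A" "\<And>i. i < n \<Longrightarrow> b i \<in> carrier A"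
    using g ab by (auto intro: component_closed[OF g] component_inv_closed[OF g] epsilon_closed)
  have "\<epsilon> g \<otimes>\<^bsub>A\<^esub> \<epsilon> g = (\<Oplus>\<^bsub>A\<^esub>i\<in>{..<n}. \<epsilon> g \<otimes>\<^bsub>A\<^esub> (a i \<otimes>\<^bsub>A\<^esub> b i))"
    by (subst (2) sum, rule A.finsum_rdistr) auto
  also have "\<dots> = (\<Oplus>\<^bsub>A\<^esub>i\<in>{..<n}. a i \<otimes>\<^bsub>A\<^esub> b i)"
    using epsilon_left[OF g ab(1)] by (intro A.finsum_cong') (auto simp flip: A.m_assoc)
  finally show ?thesis using sum by simp
qed

text \<open>This is \<open>\<epsilon> g \<A> h\<close>: because \<open>\<epsilon> g\<close> is an
  idempotent of the unit component, that set consists of the fixed points of multiplication by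
  \<open>\<epsilon> g\<close>, and membership becomes an equation.\<close>

definition left_cut :: "'g \<Rightarrow> 'g \<Rightarrow> 'a set"
  where "left_cut g h = {z \<in> \<A> h. \<epsilon> g \<otimes>\<^bsub>A\<^esub> z = z}"

text \<open>This is \<open>\<A> h \<epsilon> g\<close>, with the arguments in the order of the
  product.\<close>

definition right_cut :: "'g \<Rightarrow> 'g \<Rightarrow> 'a set"
  where "right_cut h g = {z \<in> \<A> h. z \<otimes>\<^bsub>A\<^esub> \<epsilon> g = z}"

text \<open>Stability under left multiplication by \<open>\<A> \<one>\<close> is where centrality of
  \<open>\<epsilon> g\<close> enters; on the right, associativity suffices.\<close>

lemma sub_bimodule_left_cut:
  assumes "g \<in> carrier G" "h \<in> carrier G"
  shows "sub_bimodule (left_cut g h)"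
proof -
  interpret additive_subgroup "\<A> h" A using assms component by blast
  note cl [simp] = component_closed[OF assms(2)] component_closed[OF G.one_closed] epsilon_closed[OF assms(1)]
  have "additive_subgroup (left_cut g h) A"
  proof (intro additive_subgroup.intro A.add.subgroupI)
    have "\<zero>\<^bsub>A\<^esub> \<in> left_cut g h" by (simp add: left_cut_def)
    then show "left_cut g h \<noteq> {}" by (rule ex_in_conv[THEN iffD1, OF exI])
  qed (auto simp: left_cut_def A.r_distr A.r_minus a_inv_def[symmetric])
  moreover have "\<epsilon> g \<otimes>\<^bsub>A\<^esub> (r \<otimes>\<^bsub>A\<^esub> x) = r \<otimes>\<^bsub>A\<^esub> x" if "r \<in> \<A> \<one>\<^bsub>G\<^esub>" "x \<in> \<A> h" "\<epsilon> g \<otimes>\<^bsub>A\<^esub> x = x" for r x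
  proof -
    have "\<epsilon> g \<otimes>\<^bsub>A\<^esub> (r \<otimes>\<^bsub>A\<^esub> x) = (\<epsilon> g \<otimes>\<^bsub>A\<^esub> r) \<otimes>\<^bsub>A\<^esub> x"
      using that by (simp add: A.m_assoc)
    also have "\<dots> = r \<otimes>\<^bsub>A\<^esub> (\<epsilon> g \<otimes>\<^bsub>A\<^esub> x)"
      unfolding epsilon_central[OF assms(1) that(1)] using that by (simp add: A.m_assoc)
    finally show ?thesis using that(3) by simp
  qed
  moreover have "\<epsilon> g \<otimes>\<^bsub>A\<^esub> (x \<otimes>\<^bsub>A\<^esub> r) = x \<otimes>\<^bsub>A\<^esub> r" if "r \<in> \<A> \<one>\<^bsub>G\<^esub>" "x \<in> \<A> h" "\<epsilon> g \<otimes>\<^bsub>A\<^esub> x = x" for r x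
    using that assms by (simp add: A.m_assoc[symmetric])
  ultimately show ?thesis
    using assms by (auto simp: sub_bimodule_def left_cut_def intro: component_mult_eq)
qed

lemma sub_bimodule_right_cut:
  assumes "g \<in> carrier G" "h \<in> carrier G"
  shows "sub_bimodule (right_cut h g)"
proof -
  interpret additive_subgroup "\<A> h" A using assms component by blast
  note cl [simp] = component_closed[OF assms(2)] component_closed[OF G.one_closed] epsilon_closed[OF assms(1)]
  have "additive_subgroup (right_cut h g) A"
  proof (intro additive_subgroup.intro A.add.subgroupI)
    have "\<zero>\<^bsub>A\<^esub> \<in> right_cut h g" by (simp add: right_cut_def)
    then show "right_cut h g \<noteq> {}" by (rule ex_in_conv[THEN iffD1, OF exI])
  qed (auto simp: right_cut_def A.l_distr A.l_minus a_inv_def[symmetric])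
  moreover have "x \<otimes>\<^bsub>A\<^esub> r \<otimes>\<^bsub>A\<^esub> \<epsilon> g = x \<otimes>\<^bsub>A\<^esub> r" if "r \<in> \<A> \<one>\<^bsub>G\<^esub>" "x \<in> \<A> h" "x \<otimes>\<^bsub>A\<^esub> \<epsilon> g = x" for r x
  proof -
    have "x \<otimes>\<^bsub>A\<^esub> r \<otimes>\<^bsub>A\<^esub> \<epsilon> g = x \<otimes>\<^bsub>A\<^esub> (\<epsilon> g \<otimes>\<^bsub>A\<^esub> r)"
      unfolding epsilon_central[OF assms(1) that(1)] using that by (simp add: A.m_assoc)
    also have "\<dots> = (x \<otimes>\<^bsub>A\<^esub> \<epsilon> g) \<otimes>\<^bsub>A\<^esub> r"
      by (rule A.m_assoc[symmetric]) (use that(1,2) in simp_all)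
    finally show ?thesis using that(3) by simp
  qed
  moreover have "r \<otimes>\<^bsub>A\<^esub> x \<otimes>\<^bsub>A\<^esub> \<epsilon> g = r \<otimes>\<^bsub>A\<^esub> x" if "r \<in> \<A> \<one>\<^bsub>G\<^esub>" "x \<in> \<A> h" "x \<otimes>\<^bsub>A\<^esub> \<epsilon> g = x" for r x
    using that assms by (simp add: A.m_assoc)
  ultimately show ?thesis
    using assms by (auto simp: sub_bimodule_def right_cut_def intro: component_mult_eq)
qed

text \<open>The inverse of multiplication is \<open>z \<mapsto> \<Sum>\<^sub>i a\<^sub>i \<otimes> b\<^sub>i z\<close>.\<close>

lemma tensor_mult_left:
  fixes n :: nat
  assumes X: "sub_bimodule X" and Y: "sub_bimodule Y" and Z: "sub_bimodule Z"
    and XY: "\<And>x y. \<lbrakk>x \<in> X; y \<in> Y\<rbrakk> \<Longrightarrow> x \<otimes>\<^bsub>A\<^esub> y \<in> Z"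
    and a: "\<And>i. i < n \<Longrightarrow> a i \<in> X" and b: "\<And>i. i < n \<Longrightarrow> b i \<in> carrier A"
    and e: "e = (\<Oplus>\<^bsub>A\<^esub>i\<in>{..<n}. a i \<otimes>\<^bsub>A\<^esub> b i)"
    and eX: "\<And>x. x \<in> X \<Longrightarrow> e \<otimes>\<^bsub>A\<^esub> x = x" and eZ: "\<And>z. z \<in> Z \<Longrightarrow> e \<otimes>\<^bsub>A\<^esub> z = z"
    and bX: "\<And>i x. \<lbrakk>i < n; x \<in> X\<rbrakk> \<Longrightarrow> b i \<otimes>\<^bsub>A\<^esub> x \<in> \<A> \<one>\<^bsub>G\<^esub>"
    and bZ: "\<And>i z. \<lbrakk>i < n; z \<in> Z\<rbrakk> \<Longrightarrow> b i \<otimes>\<^bsub>A\<^esub> z \<in> Y"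
  shows "bimod_isomorphic R (tensor R (sub_bimod A X) (sub_bimod A Y)) (sub_bimod A Z)"
proof -
  let ?X = "sub_bimod A X" and ?Y = "sub_bimod A Y" and ?Z = "sub_bimod A Z"
  interpret T: bimodule_pair R ?X ?Y
    by (intro bimodule_pair.intro bimodule_sub X Y)
  interpret Z: bimodule R ?Z by (rule bimodule_sub[OF Z])
  interpret TT: abelian_group T.T by (rule T.abelian_group_tensor)
  note [simp] = sub_bimoduleD(1)[OF X] sub_bimoduleD(1)[OF Y] sub_bimoduleD(1)[OF Z] a b XY
    component_closed[OF G.one_closed]
  have aX: "(\<Oplus>\<^bsub>A\<^esub>i\<in>{..<n}. a i \<otimes>\<^bsub>A\<^esub> (b i \<otimes>\<^bsub>A\<^esub> x)) = e \<otimes>\<^bsub>A\<^esub> x" if "x \<in> carrier A" for x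
    unfolding e using that by (subst A.finsum_ldistr) (auto simp: A.m_assoc intro!: A.finsum_cong')
  show ?thesis
  proof (rule T.tensor_isomorphicI[OF Z.bimodule_axioms, of "\<lambda>x y. x \<otimes>\<^bsub>A\<^esub> y"
        "\<lambda>z. \<Oplus>\<^bsub>T.T\<^esub>i\<in>{..<n}. ten R ?X ?Y (a i) (b i \<otimes>\<^bsub>A\<^esub> z)"])
    show "balanced R ?X ?Y ?Z (\<lambda>x y. x \<otimes>\<^bsub>A\<^esub> y)"
      unfolding balanced_def
      by (intro conjI ballI add_homI) (simp_all add: A.l_distr A.r_distr A.m_assoc)
    show "(\<lambda>z. \<Oplus>\<^bsub>T.T\<^esub>i\<in>{..<n}. ten R ?X ?Y (a i) (b i \<otimes>\<^bsub>A\<^esub> z)) \<in> add_hom ?Z T.T"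
    proof (rule add_hom_sum[OF T.abelian_group_tensor])
      fix i assume i: "i \<in> {..<n}"
      then have "(\<lambda>z. b i \<otimes>\<^bsub>A\<^esub> z) \<in> add_hom ?Z ?Y"
        by (intro add_homI) (simp_all add: bZ A.r_distr)
      then show "(\<lambda>z. ten R ?X ?Y (a i) (b i \<otimes>\<^bsub>A\<^esub> z)) \<in> add_hom ?Z T.T"
        by (rule add_hom_compose[OF _ T.ten_add_hom_r]) (use i in simp)
    qed
  next
    fix x y assume "x \<in> carrier ?X" "y \<in> carrier ?Y"
    then have x: "x \<in> X" and y: "y \<in> Y" by simp_all
    \<comment> \<open>The element \<open>b i x\<close> lies in \<open>\<A> \<one>\<close> and is
      therefore a scalar that can be moved across the tensor sign; afterwards the right factor is
      \<open>y\<close> for every \<open>i\<close>.\<close>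
    have "(\<Oplus>\<^bsub>T.T\<^esub>i\<in>{..<n}. ten R ?X ?Y (a i) (b i \<otimes>\<^bsub>A\<^esub> (x \<otimes>\<^bsub>A\<^esub> y)))
        = (\<Oplus>\<^bsub>T.T\<^esub>i\<in>{..<n}. ten R ?X ?Y (a i \<otimes>\<^bsub>A\<^esub> (b i \<otimes>\<^bsub>A\<^esub> x)) y)"
      using x y T.ten_balanced[of "a _" "b _ \<otimes>\<^bsub>A\<^esub> x" y]
      by (intro TT.finsum_cong')
        (auto simp: A.m_assoc bX sub_bimoduleD[OF X] sub_bimoduleD[OF Y] intro!: T.ten_closed)
    also have "\<dots> = ten R ?X ?Y (\<Oplus>\<^bsub>?X\<^esub>i\<in>{..<n}. a i \<otimes>\<^bsub>A\<^esub> (b i \<otimes>\<^bsub>A\<^esub> x)) y"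
      using x y
      by (intro add_hom_finsum[OF T.ten_add_hom_l T.P.M.abelian_group_axioms T.abelian_group_tensor, symmetric])
        (simp_all add: bX sub_bimoduleD[OF X])
    also have "(\<Oplus>\<^bsub>?X\<^esub>i\<in>{..<n}. a i \<otimes>\<^bsub>A\<^esub> (b i \<otimes>\<^bsub>A\<^esub> x)) = x"
      using x by (subst finsum_sub_bimod[OF X]) (simp_all add: bX sub_bimoduleD[OF X] aX eX)
    finally show "(\<Oplus>\<^bsub>T.T\<^esub>i\<in>{..<n}. ten R ?X ?Y (a i) (b i \<otimes>\<^bsub>A\<^esub> (x \<otimes>\<^bsub>A\<^esub> y))) = ten R ?X ?Y x y" .
  next
    fix \<phi> z assume \<phi>: "\<phi> \<in> add_hom T.T ?Z"
      and \<phi>t: "\<And>x y. \<lbrakk>x \<in> carrier ?X; y \<in> carrier ?Y\<rbrakk> \<Longrightarrow> \<phi> (ten R ?X ?Y x y) = x \<otimes>\<^bsub>A\<^esub> y"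
      and "z \<in> carrier ?Z"
    then have z: "z \<in> Z" by simp
    have "\<phi> (\<Oplus>\<^bsub>T.T\<^esub>i\<in>{..<n}. ten R ?X ?Y (a i) (b i \<otimes>\<^bsub>A\<^esub> z))
        = (\<Oplus>\<^bsub>?Z\<^esub>i\<in>{..<n}. \<phi> (ten R ?X ?Y (a i) (b i \<otimes>\<^bsub>A\<^esub> z)))"
      using z
      by (intro add_hom_finsum[OF \<phi> T.abelian_group_tensor Z.M.abelian_group_axioms])
        (simp_all add: bZ T.ten_closed)
    also have "\<dots> = (\<Oplus>\<^bsub>?Z\<^esub>i\<in>{..<n}. a i \<otimes>\<^bsub>A\<^esub> (b i \<otimes>\<^bsub>A\<^esub> z))"
      using z by (intro Z.M.finsum_cong') (auto simp: bZ \<phi>t)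
    also have "\<dots> = z"
      using z by (subst finsum_sub_bimod[OF Z]) (simp_all add: bZ aX eZ)
    finally show "\<phi> (\<Oplus>\<^bsub>T.T\<^esub>i\<in>{..<n}. ten R ?X ?Y (a i) (b i \<otimes>\<^bsub>A\<^esub> z)) = z" .
  qed (simp_all add: A.m_assoc)
qed

text \<open>The mirror image, with inverse
  \<open>z \<mapsto> \<Sum>\<^sub>i z a i \<otimes> b i\<close>. Now the \<open>b i\<close> lie in
  the second factor and \<open>y a i\<close> is the scalar moved across.\<close>

lemma tensor_mult_right:
  fixes n :: nat
  assumes X: "sub_bimodule X" and Y: "sub_bimodule Y" and Z: "sub_bimodule Z"
    and XY: "\<And>x y. \<lbrakk>x \<in> X; y \<in> Y\<rbrakk> \<Longrightarrow> x \<otimes>\<^bsub>A\<^esub> y \<in> Z"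
    and a: "\<And>i. i < n \<Longrightarrow> a i \<in> carrier A" and b: "\<And>i. i < n \<Longrightarrow> b i \<in> Y"
    and e: "e = (\<Oplus>\<^bsub>A\<^esub>i\<in>{..<n}. a i \<otimes>\<^bsub>A\<^esub> b i)"
    and eY: "\<And>y. y \<in> Y \<Longrightarrow> y \<otimes>\<^bsub>A\<^esub> e = y" and eZ: "\<And>z. z \<in> Z \<Longrightarrow> z \<otimes>\<^bsub>A\<^esub> e = z"
    and aY: "\<And>i y. \<lbrakk>i < n; y \<in> Y\<rbrakk> \<Longrightarrow> y \<otimes>\<^bsub>A\<^esub> a i \<in> \<A> \<one>\<^bsub>G\<^esub>"
    and aZ: "\<And>i z. \<lbrakk>i < n; z \<in> Z\<rbrakk> \<Longrightarrow> z \<otimes>\<^bsub>A\<^esub> a i \<in> X"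
  shows "bimod_isomorphic R (tensor R (sub_bimod A X) (sub_bimod A Y)) (sub_bimod A Z)"
proof -
  let ?X = "sub_bimod A X" and ?Y = "sub_bimod A Y" and ?Z = "sub_bimod A Z"
  interpret T: bimodule_pair R ?X ?Y
    by (intro bimodule_pair.intro bimodule_sub X Y)
  interpret Z: bimodule R ?Z by (rule bimodule_sub[OF Z])
  interpret TT: abelian_group T.T by (rule T.abelian_group_tensor)
  note [simp] = sub_bimoduleD(1)[OF X] sub_bimoduleD(1)[OF Y] sub_bimoduleD(1)[OF Z] a b XY
    component_closed[OF G.one_closed]
  have bY: "(\<Oplus>\<^bsub>A\<^esub>i\<in>{..<n}. x \<otimes>\<^bsub>A\<^esub> a i \<otimes>\<^bsub>A\<^esub> b i) = x \<otimes>\<^bsub>A\<^esub> e" if "x \<in> carrier A" for x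
    unfolding e using that by (subst A.finsum_rdistr) (auto simp: A.m_assoc intro!: A.finsum_cong')
  show ?thesis
  proof (rule T.tensor_isomorphicI[OF Z.bimodule_axioms, of "\<lambda>x y. x \<otimes>\<^bsub>A\<^esub> y"
        "\<lambda>z. \<Oplus>\<^bsub>T.T\<^esub>i\<in>{..<n}. ten R ?X ?Y (z \<otimes>\<^bsub>A\<^esub> a i) (b i)"])
    show "balanced R ?X ?Y ?Z (\<lambda>x y. x \<otimes>\<^bsub>A\<^esub> y)"
      unfolding balanced_def
      by (intro conjI ballI add_homI) (simp_all add: A.l_distr A.r_distr A.m_assoc)
    show "(\<lambda>z. \<Oplus>\<^bsub>T.T\<^esub>i\<in>{..<n}. ten R ?X ?Y (z \<otimes>\<^bsub>A\<^esub> a i) (b i)) \<in> add_hom ?Z T.T"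
    proof (rule add_hom_sum[OF T.abelian_group_tensor])
      fix i assume i: "i \<in> {..<n}"
      then have "(\<lambda>z. z \<otimes>\<^bsub>A\<^esub> a i) \<in> add_hom ?Z ?X"
        by (intro add_homI) (simp_all add: aZ A.l_distr)
      then show "(\<lambda>z. ten R ?X ?Y (z \<otimes>\<^bsub>A\<^esub> a i) (b i)) \<in> add_hom ?Z T.T"
        by (rule add_hom_compose[OF _ T.ten_add_hom_l]) (use i in simp)
    qed
  next
    fix x y assume "x \<in> carrier ?X" "y \<in> carrier ?Y"
    then have x: "x \<in> X" and y: "y \<in> Y" by simp_all
    have yab: "y \<otimes>\<^bsub>A\<^esub> (a i \<otimes>\<^bsub>A\<^esub> b i) \<in> Y" if "i < n" for i
      using sub_bimoduleD(2)[OF Y b[OF that] aY[OF that y]] that y by (simp add: A.m_assoc)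
    have "(\<Oplus>\<^bsub>T.T\<^esub>i\<in>{..<n}. ten R ?X ?Y (x \<otimes>\<^bsub>A\<^esub> y \<otimes>\<^bsub>A\<^esub> a i) (b i))
        = (\<Oplus>\<^bsub>T.T\<^esub>i\<in>{..<n}. ten R ?X ?Y x (y \<otimes>\<^bsub>A\<^esub> a i \<otimes>\<^bsub>A\<^esub> b i))"
      using x y T.ten_balanced[of x "y \<otimes>\<^bsub>A\<^esub> a _" "b _"]
      by (intro TT.finsum_cong')
        (auto simp: A.m_assoc aY yab sub_bimoduleD[OF X] sub_bimoduleD[OF Y] intro!: T.ten_closed)
    also have "\<dots> = ten R ?X ?Y x (\<Oplus>\<^bsub>?Y\<^esub>i\<in>{..<n}. y \<otimes>\<^bsub>A\<^esub> a i \<otimes>\<^bsub>A\<^esub> b i)"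
      using x y
      by (intro add_hom_finsum[OF T.ten_add_hom_r T.Q.M.abelian_group_axioms T.abelian_group_tensor, symmetric])
        (simp_all add: aY sub_bimoduleD[OF Y])
    also have "(\<Oplus>\<^bsub>?Y\<^esub>i\<in>{..<n}. y \<otimes>\<^bsub>A\<^esub> a i \<otimes>\<^bsub>A\<^esub> b i) = y"
      using y by (subst finsum_sub_bimod[OF Y]) (simp_all add: aY sub_bimoduleD[OF Y] bY eY)
    finally show "(\<Oplus>\<^bsub>T.T\<^esub>i\<in>{..<n}. ten R ?X ?Y (x \<otimes>\<^bsub>A\<^esub> y \<otimes>\<^bsub>A\<^esub> a i) (b i)) = ten R ?X ?Y x y" .
  next
    fix \<phi> z assume \<phi>: "\<phi> \<in> add_hom T.T ?Z"
      and \<phi>t: "\<And>x y. \<lbrakk>x \<in> carrier ?X; y \<in> carrier ?Y\<rbrakk> \<Longrightarrow> \<phi> (ten R ?X ?Y x y) = x \<otimes>\<^bsub>A\<^esub> y"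
      and "z \<in> carrier ?Z"
    then have z: "z \<in> Z" by simp
    have "\<phi> (\<Oplus>\<^bsub>T.T\<^esub>i\<in>{..<n}. ten R ?X ?Y (z \<otimes>\<^bsub>A\<^esub> a i) (b i))
        = (\<Oplus>\<^bsub>?Z\<^esub>i\<in>{..<n}. \<phi> (ten R ?X ?Y (z \<otimes>\<^bsub>A\<^esub> a i) (b i)))"
      using z
      by (intro add_hom_finsum[OF \<phi> T.abelian_group_tensor Z.M.abelian_group_axioms])
        (simp_all add: aZ T.ten_closed)
    also have "\<dots> = (\<Oplus>\<^bsub>?Z\<^esub>i\<in>{..<n}. z \<otimes>\<^bsub>A\<^esub> a i \<otimes>\<^bsub>A\<^esub> b i)"
      using z by (intro Z.M.finsum_cong') (auto simp: aZ \<phi>t)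
    also have "\<dots> = z"
      using z by (subst finsum_sub_bimod[OF Z]) (simp_all add: aZ bY eZ)
    finally show "\<phi> (\<Oplus>\<^bsub>T.T\<^esub>i\<in>{..<n}. ten R ?X ?Y (z \<otimes>\<^bsub>A\<^esub> a i) (b i)) = z" .
  qed (simp_all add: A.m_assoc)
qed

section \<open>Products of components and of their cuts\<close>

lemma inv_mult_cancel: "\<lbrakk>g \<in> carrier G; h \<in> carrier G\<rbrakk> \<Longrightarrow> inv\<^bsub>G\<^esub> g \<otimes>\<^bsub>G\<^esub> (g \<otimes>\<^bsub>G\<^esub> h) = h"
  and mult_inv_cancel: "\<lbrakk>g \<in> carrier G; h \<in> carrier G\<rbrakk> \<Longrightarrow> g \<otimes>\<^bsub>G\<^esub> h \<otimes>\<^bsub>G\<^esub> inv\<^bsub>G\<^esub> h = g"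
  by (simp_all add: G.m_assoc[symmetric]) (simp add: G.m_assoc)

text \<open>The \<open>b i\<close> have degree \<open>inv g\<close>: they carry degree
  \<open>g\<close> to the unit degree and degree \<open>g h\<close> back to degree \<open>h\<close>,
  as the multiplication lemma asks. Products land in the cut because \<open>\<epsilon> g\<close>
  fixes the first factor.\<close>

lemma tensor_components_left:
  assumes g: "g \<in> carrier G" and h: "h \<in> carrier G"
  shows "bimod_isomorphic R (tensor R (sub_bimod A (\<A> g)) (sub_bimod A (\<A> h)))
    (sub_bimod A (left_cut g (g \<otimes>\<^bsub>G\<^esub> h)))"
proof -
  obtain n :: nat and a b where a: "\<And>i. i < n \<Longrightarrow> a i \<in> \<A> g" and b: "\<And>i. i < n \<Longrightarrow> b i \<in> \<A> (inv\<^bsub>G\<^esub> g)"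
    and sum: "\<epsilon> g = (\<Oplus>\<^bsub>A\<^esub>i\<in>{..<n}. a i \<otimes>\<^bsub>A\<^esub> b i)"
    by (rule epsilon_sum[OF g], rule that)
  show ?thesis
  proof (rule tensor_mult_left[OF _ _ _ _ a _ sum])
    show "b i \<in> carrier A" if "i < n" for i
      using component_closed[OF _ b[OF that]] g by simp
    show "x \<otimes>\<^bsub>A\<^esub> y \<in> left_cut g (g \<otimes>\<^bsub>G\<^esub> h)" if "x \<in> \<A> g" "y \<in> \<A> h" for x y
      using that g h component_closed[of g x] component_closed[of h y]
      by (auto simp: left_cut_def component_mult epsilon_left epsilon_closed simp flip: A.m_assoc)
    show "b i \<otimes>\<^bsub>A\<^esub> x \<in> \<A> \<one>\<^bsub>G\<^esub>" if "i < n" "x \<in> \<A> g" for i x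
      using b[OF that(1)] that(2) by (rule component_mult_eq) (simp_all add: g)
    show "b i \<otimes>\<^bsub>A\<^esub> z \<in> \<A> h" if "i < n" "z \<in> left_cut g (g \<otimes>\<^bsub>G\<^esub> h)" for i z
      using b[OF that(1)] that(2) g h
      by (intro component_mult_eq[of _ "inv\<^bsub>G\<^esub> g" _ "g \<otimes>\<^bsub>G\<^esub> h"]) (simp_all add: left_cut_def inv_mult_cancel)
  qed (use g h in \<open>simp_all add: sub_bimodule_component sub_bimodule_left_cut[unfolded left_cut_def] epsilon_left left_cut_def\<close>)
qed

text \<open>Writing the degree of the second factor as \<open>inv h\<close> lets the decomposition
  of \<open>\<epsilon> h\<close> be used as it stands: its \<open>b i\<close> have that degree, and
  \<open>\<epsilon> h\<close> is a right identity there.\<close>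

lemma tensor_components_right:
  assumes g: "g \<in> carrier G" and h: "h \<in> carrier G"
  shows "bimod_isomorphic R (tensor R (sub_bimod A (\<A> g)) (sub_bimod A (\<A> (inv\<^bsub>G\<^esub> h))))
    (sub_bimod A (right_cut (g \<otimes>\<^bsub>G\<^esub> inv\<^bsub>G\<^esub> h) h))"
proof -
  obtain n :: nat and a b where a: "\<And>i. i < n \<Longrightarrow> a i \<in> \<A> h" and b: "\<And>i. i < n \<Longrightarrow> b i \<in> \<A> (inv\<^bsub>G\<^esub> h)"
    and sum: "\<epsilon> h = (\<Oplus>\<^bsub>A\<^esub>i\<in>{..<n}. a i \<otimes>\<^bsub>A\<^esub> b i)"
    by (rule epsilon_sum[OF h], rule that)
  show ?thesis
  proof (rule tensor_mult_right[OF _ _ _ _ _ b sum])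
    show "a i \<in> carrier A" if "i < n" for i
      using component_closed[OF h a[OF that]] .
    show "x \<otimes>\<^bsub>A\<^esub> y \<in> right_cut (g \<otimes>\<^bsub>G\<^esub> inv\<^bsub>G\<^esub> h) h" if "x \<in> \<A> g" "y \<in> \<A> (inv\<^bsub>G\<^esub> h)" for x y
      using that g h component_closed[of g x] component_closed[of "inv\<^bsub>G\<^esub> h" y]
      by (auto simp: right_cut_def component_mult epsilon_right epsilon_closed A.m_assoc)
    show "y \<otimes>\<^bsub>A\<^esub> a i \<in> \<A> \<one>\<^bsub>G\<^esub>" if "i < n" "y \<in> \<A> (inv\<^bsub>G\<^esub> h)" for i y
      using that(2) a[OF that(1)] by (rule component_mult_eq) (simp_all add: h)
    show "z \<otimes>\<^bsub>A\<^esub> a i \<in> \<A> g" if "i < n" "z \<in> right_cut (g \<otimes>\<^bsub>G\<^esub> inv\<^bsub>G\<^esub> h) h" for i z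
      using a[OF that(1)] that(2) g h
      by (intro component_mult_eq[of _ "g \<otimes>\<^bsub>G\<^esub> inv\<^bsub>G\<^esub> h" _ h]) (simp_all add: right_cut_def G.m_assoc)
  qed (use g h in \<open>simp_all add: sub_bimodule_component sub_bimodule_right_cut[unfolded right_cut_def] epsilon_right right_cut_def\<close>)
qed

text \<open>The equation \<open>\<epsilon> g = \<epsilon> g \<epsilon> g\<close> is a decomposition
  of length one inside the cut of the unit component, so the same multiplication lemma applies with
  this cut as first factor.\<close>

lemma tensor_cut_left:
  assumes g: "g \<in> carrier G" and h: "h \<in> carrier G"
  shows "bimod_isomorphic R (tensor R (sub_bimod A (left_cut g \<one>\<^bsub>G\<^esub>)) (sub_bimod A (\<A> h)))
    (sub_bimod A (left_cut g h))"
proof (rule tensor_mult_left[of _ _ _ "1" "\<lambda>_. \<epsilon> g" "\<lambda>_. \<epsilon> g" "\<epsilon> g"])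
  have "{..<1::nat} = {0}" by auto
  then show "\<epsilon> g = (\<Oplus>\<^bsub>A\<^esub>i\<in>{..<1::nat}. \<epsilon> g \<otimes>\<^bsub>A\<^esub> \<epsilon> g)"
    using g by (simp add: epsilon_idem epsilon_closed)
  show "x \<otimes>\<^bsub>A\<^esub> y \<in> left_cut g h" if "x \<in> left_cut g \<one>\<^bsub>G\<^esub>" "y \<in> \<A> h" for x y
    using that g h component_closed[of "\<one>\<^bsub>G\<^esub>" x] component_closed[of h y]
    by (auto simp: left_cut_def epsilon_closed intro: component_mult_eq simp flip: A.m_assoc)
qed (use g h in \<open>auto simp: sub_bimodule_component sub_bimodule_left_cut[unfolded left_cut_def] left_cut_def epsilon_in_one epsilon_idem
    epsilon_closed\<close>)

lemma tensor_cut_right: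
  assumes g: "g \<in> carrier G" and h: "h \<in> carrier G"
  shows "bimod_isomorphic R (tensor R (sub_bimod A (\<A> g)) (sub_bimod A (right_cut \<one>\<^bsub>G\<^esub> h)))
    (sub_bimod A (right_cut g h))"
proof (rule tensor_mult_right[of _ _ _ "1" "\<lambda>_. \<epsilon> h" "\<lambda>_. \<epsilon> h" "\<epsilon> h"])
  have "{..<1::nat} = {0}" by auto
  then show "\<epsilon> h = (\<Oplus>\<^bsub>A\<^esub>i\<in>{..<1::nat}. \<epsilon> h \<otimes>\<^bsub>A\<^esub> \<epsilon> h)"
    using h by (simp add: epsilon_idem epsilon_closed)
  show "x \<otimes>\<^bsub>A\<^esub> y \<in> right_cut g h" if "x \<in> \<A> g" "y \<in> right_cut \<one>\<^bsub>G\<^esub> h" for x y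
    using that g h component_closed[of "\<one>\<^bsub>G\<^esub>" y] component_closed[of g x]
    by (auto simp: right_cut_def epsilon_closed A.m_assoc intro: component_mult_eq)
qed (use g h in \<open>auto simp: sub_bimodule_component sub_bimodule_right_cut[unfolded right_cut_def] right_cut_def epsilon_in_one epsilon_idem
    epsilon_closed\<close>)

section \<open>Partial invertibility of the components\<close>

lemma right_invertible_component:
  assumes g: "g \<in> carrier G"
  shows "right_invertible R (sub_bimod A (\<A> g))"
proof -
  let ?M = "sub_bimod A (\<A> g)"
  have sb: "sub_bimodule (\<A> g)" by (rule sub_bimodule_component[OF g])
  interpret bimodule R ?M by (rule bimodule_sub[OF sb])
  obtain n :: nat and a b where a: "\<And>i. i < n \<Longrightarrow> a i \<in> \<A> g" and b: "\<And>i. i < n \<Longrightarrow> b i \<in> \<A> (inv\<^bsub>G\<^esub> g)"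
    and sum: "\<epsilon> g = (\<Oplus>\<^bsub>A\<^esub>i\<in>{..<n}. a i \<otimes>\<^bsub>A\<^esub> b i)"
    by (rule epsilon_sum[OF g], rule that)
  have cl [simp]: "\<And>i. i < n \<Longrightarrow> a i \<in> carrier A" "\<And>i. i < n \<Longrightarrow> b i \<in> carrier A" "\<And>x. x \<in> \<A> g \<Longrightarrow> x \<in> carrier A"
    "\<And>x. x \<in> \<A> \<one>\<^bsub>G\<^esub> \<Longrightarrow> x \<in> carrier A"
    using a b by (auto intro: component_closed[OF g] component_inv_closed[OF g] component_one_closed)
  have b1: "b i \<otimes>\<^bsub>A\<^esub> x \<in> \<A> \<one>\<^bsub>G\<^esub>" if "i < n" "x \<in> \<A> g" for i x
    using b[OF that(1)] that(2) by (rule component_mult_eq) (simp_all add: g)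
  have b2: "x \<otimes>\<^bsub>A\<^esub> b i \<in> \<A> \<one>\<^bsub>G\<^esub>" if "i < n" "x \<in> \<A> g" for i x
    using that(2) b[OF that(1)] by (rule component_mult_eq) (simp_all add: g)
  have ab: "a i \<otimes>\<^bsub>A\<^esub> (b i \<otimes>\<^bsub>A\<^esub> x) \<in> \<A> g" if "i < n" "x \<in> \<A> g" for i x
    using sub_bimoduleD(3)[OF sb a[OF that(1)] b1[OF that]] .
  have exp: "(\<Oplus>\<^bsub>?M\<^esub>i\<in>{..<n}. a i \<otimes>\<^bsub>A\<^esub> (b i \<otimes>\<^bsub>A\<^esub> x)) = x" if x: "x \<in> \<A> g" for x
  proof -
    have "(\<Oplus>\<^bsub>?M\<^esub>i\<in>{..<n}. a i \<otimes>\<^bsub>A\<^esub> (b i \<otimes>\<^bsub>A\<^esub> x)) = (\<Oplus>\<^bsub>A\<^esub>i\<in>{..<n}. a i \<otimes>\<^bsub>A\<^esub> b i \<otimes>\<^bsub>A\<^esub> x)"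
      using x ab by (subst finsum_sub_bimod[OF sb]) (auto simp: A.m_assoc intro!: A.finsum_cong')
    also have "\<dots> = \<epsilon> g \<otimes>\<^bsub>A\<^esub> x"
      unfolding sum using x by (intro A.finsum_ldistr[symmetric]) auto
    finally show ?thesis using epsilon_left[OF g x] by simp
  qed
  show ?thesis
  proof (rule right_invertibleI[OF bimodule_axioms])
    show "left_dual_basis (op_ring R) (right_module ?M) {..<n} a (\<lambda>i x. b i \<otimes>\<^bsub>A\<^esub> x)"
      by (auto simp: right_dual_basis_iff a b1 exp A.r_distr A.m_assoc intro!: add_homI)
    fix \<phi> assume "\<phi> \<in> right_hom R ?M ?M"
    then have \<phi>: "\<phi> \<in> add_hom ?M ?M"
      and \<phi>r: "\<And>r x. \<lbrakk>r \<in> \<A> \<one>\<^bsub>G\<^esub>; x \<in> \<A> g\<rbrakk> \<Longrightarrow> \<phi> (x \<otimes>\<^bsub>A\<^esub> r) = \<phi> x \<otimes>\<^bsub>A\<^esub> r"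
      by (auto simp: right_hom_iff)
    have \<phi>c [simp]: "\<phi> x \<in> \<A> g" "\<phi> x \<in> carrier A" if "x \<in> \<A> g" for x
      using add_hom_closed[OF \<phi>] that by auto
    \<comment> \<open>Applying \<open>\<phi>\<close> to the expansion of \<open>x\<close> and
      pulling out the scalars \<open>b i x\<close> exhibits left multiplication by
      \<open>\<Sum>\<^sub>i \<phi> (a i) b i\<close>, which has unit degree.\<close>
    have eq: "\<phi> x = (\<Oplus>\<^bsub>A\<^esub>i\<in>{..<n}. \<phi> (a i) \<otimes>\<^bsub>A\<^esub> b i) \<otimes>\<^bsub>A\<^esub> x" if x: "x \<in> \<A> g" for x
    proof -
      have "\<phi> x = \<phi> (\<Oplus>\<^bsub>?M\<^esub>i\<in>{..<n}. a i \<otimes>\<^bsub>A\<^esub> (b i \<otimes>\<^bsub>A\<^esub> x))"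
        by (simp add: exp x)
      also have "\<dots> = (\<Oplus>\<^bsub>?M\<^esub>i\<in>{..<n}. \<phi> (a i \<otimes>\<^bsub>A\<^esub> (b i \<otimes>\<^bsub>A\<^esub> x)))"
        using x ab by (intro add_hom_finsum[OF \<phi> M.abelian_group_axioms M.abelian_group_axioms]) auto
      also have "\<dots> = (\<Oplus>\<^bsub>A\<^esub>i\<in>{..<n}. \<phi> (a i \<otimes>\<^bsub>A\<^esub> (b i \<otimes>\<^bsub>A\<^esub> x)))"
        using x ab by (intro finsum_sub_bimod[OF sb]) auto
      also have "\<dots> = (\<Oplus>\<^bsub>A\<^esub>i\<in>{..<n}. \<phi> (a i) \<otimes>\<^bsub>A\<^esub> b i \<otimes>\<^bsub>A\<^esub> x)"
        using x a b1 by (intro A.finsum_cong') (auto simp: \<phi>r A.m_assoc)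
      also have "\<dots> = (\<Oplus>\<^bsub>A\<^esub>i\<in>{..<n}. \<phi> (a i) \<otimes>\<^bsub>A\<^esub> b i) \<otimes>\<^bsub>A\<^esub> x"
        using x a by (intro A.finsum_ldistr[symmetric]) auto
      finally show ?thesis .
    qed
    have "(\<Oplus>\<^bsub>A\<^esub>i\<in>{..<n}. \<phi> (a i) \<otimes>\<^bsub>A\<^esub> b i) \<in> \<A> \<one>\<^bsub>G\<^esub>"
      using a b2 by (intro A.finsum_additive_subgroup component) auto
    then show "\<exists>r\<in>carrier R. \<forall>x\<in>carrier ?M. \<phi> x = r \<odot>\<^bsub>?M\<^esub> x"
      unfolding carrier_sub_bimod smult_sub_bimod principal_component_simps by (rule bexI[rotated]) (intro ballI eq)
  qed
qed

lemma right_invertible_op_component: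
  assumes g: "g \<in> carrier G"
  shows "right_invertible (op_ring R) (op_bimod (sub_bimod A (\<A> g)))"
proof -
  let ?M = "sub_bimod A (\<A> g)" and ?g' = "inv\<^bsub>G\<^esub> g"
  have sb: "sub_bimodule (\<A> g)" by (rule sub_bimodule_component[OF g])
  interpret bimodule R ?M by (rule bimodule_sub[OF sb])
  have g': "?g' \<in> carrier G" using g by simp
  \<comment> \<open>For the left structure \<open>\<epsilon> (inv g)\<close> is decomposed, since it
    is the right identity of \<open>\<A> g\<close>. The names are exchanged so that
    \<open>a i\<close> has degree \<open>g\<close> again.\<close>
  obtain n :: nat and b a where b: "\<And>i. i < n \<Longrightarrow> b i \<in> \<A> ?g'" and a': "\<And>i. i < n \<Longrightarrow> a i \<in> \<A> (inv\<^bsub>G\<^esub> ?g')"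
    and sum: "\<epsilon> ?g' = (\<Oplus>\<^bsub>A\<^esub>i\<in>{..<n}. b i \<otimes>\<^bsub>A\<^esub> a i)"
    by (rule epsilon_sum[OF g'], rule that)
  have a: "\<And>i. i < n \<Longrightarrow> a i \<in> \<A> g" using a' g by simp
  have cl [simp]: "\<And>i. i < n \<Longrightarrow> a i \<in> carrier A" "\<And>i. i < n \<Longrightarrow> b i \<in> carrier A" "\<And>x. x \<in> \<A> g \<Longrightarrow> x \<in> carrier A"
    "\<And>x. x \<in> \<A> \<one>\<^bsub>G\<^esub> \<Longrightarrow> x \<in> carrier A"
    using a b by (auto intro: component_closed[OF g] component_inv_closed[OF g] component_one_closed)
  have b1: "b i \<otimes>\<^bsub>A\<^esub> x \<in> \<A> \<one>\<^bsub>G\<^esub>" if "i < n" "x \<in> \<A> g" for i x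
    using b[OF that(1)] that(2) by (rule component_mult_eq) (simp_all add: g)
  have b2: "x \<otimes>\<^bsub>A\<^esub> b i \<in> \<A> \<one>\<^bsub>G\<^esub>" if "i < n" "x \<in> \<A> g" for i x
    using that(2) b[OF that(1)] by (rule component_mult_eq) (simp_all add: g)
  have ba: "x \<otimes>\<^bsub>A\<^esub> b i \<otimes>\<^bsub>A\<^esub> a i \<in> \<A> g" if "i < n" "x \<in> \<A> g" for i x
    using sub_bimoduleD(2)[OF sb a[OF that(1)] b2[OF that]] .
  have exp: "(\<Oplus>\<^bsub>?M\<^esub>i\<in>{..<n}. x \<otimes>\<^bsub>A\<^esub> b i \<otimes>\<^bsub>A\<^esub> a i) = x" if x: "x \<in> \<A> g" for x
  proof -
    have "(\<Oplus>\<^bsub>?M\<^esub>i\<in>{..<n}. x \<otimes>\<^bsub>A\<^esub> b i \<otimes>\<^bsub>A\<^esub> a i) = (\<Oplus>\<^bsub>A\<^esub>i\<in>{..<n}. x \<otimes>\<^bsub>A\<^esub> (b i \<otimes>\<^bsub>A\<^esub> a i))"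
      using x ba by (subst finsum_sub_bimod[OF sb]) (auto simp: A.m_assoc intro!: A.finsum_cong')
    also have "\<dots> = x \<otimes>\<^bsub>A\<^esub> \<epsilon> ?g'"
      unfolding sum using x by (intro A.finsum_rdistr[symmetric]) auto
    finally show ?thesis using epsilon_right'[OF g x] by simp
  qed
  show ?thesis
  proof (rule right_invertibleI[OF bimodule_op])
    show "left_dual_basis (op_ring (op_ring R)) (right_module (op_bimod ?M)) {..<n} a (\<lambda>i x. x \<otimes>\<^bsub>A\<^esub> b i)"
      by (auto simp: right_dual_basis_iff a b2 exp A.l_distr A.m_assoc simp del: op_ring_op_ring intro!: add_homI)
    fix \<phi> assume "\<phi> \<in> right_hom (op_ring R) (op_bimod ?M) (op_bimod ?M)"
    then have \<phi>: "\<phi> \<in> add_hom ?M ?M"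
      and \<phi>r: "\<And>r x. \<lbrakk>r \<in> \<A> \<one>\<^bsub>G\<^esub>; x \<in> \<A> g\<rbrakk> \<Longrightarrow> \<phi> (r \<otimes>\<^bsub>A\<^esub> x) = r \<otimes>\<^bsub>A\<^esub> \<phi> x"
      by (auto simp: right_hom_iff)
    have \<phi>c [simp]: "\<phi> x \<in> \<A> g" "\<phi> x \<in> carrier A" if "x \<in> \<A> g" for x
      using add_hom_closed[OF \<phi>] that by auto
    have eq: "\<phi> x = x \<otimes>\<^bsub>A\<^esub> (\<Oplus>\<^bsub>A\<^esub>i\<in>{..<n}. b i \<otimes>\<^bsub>A\<^esub> \<phi> (a i))" if x: "x \<in> \<A> g" for x
    proof -
      have "\<phi> x = \<phi> (\<Oplus>\<^bsub>?M\<^esub>i\<in>{..<n}. x \<otimes>\<^bsub>A\<^esub> b i \<otimes>\<^bsub>A\<^esub> a i)"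
        by (simp add: exp x)
      also have "\<dots> = (\<Oplus>\<^bsub>?M\<^esub>i\<in>{..<n}. \<phi> (x \<otimes>\<^bsub>A\<^esub> b i \<otimes>\<^bsub>A\<^esub> a i))"
        using x ba by (intro add_hom_finsum[OF \<phi> M.abelian_group_axioms M.abelian_group_axioms]) auto
      also have "\<dots> = (\<Oplus>\<^bsub>A\<^esub>i\<in>{..<n}. \<phi> (x \<otimes>\<^bsub>A\<^esub> b i \<otimes>\<^bsub>A\<^esub> a i))"
        using x ba by (intro finsum_sub_bimod[OF sb]) auto
      also have "\<dots> = (\<Oplus>\<^bsub>A\<^esub>i\<in>{..<n}. x \<otimes>\<^bsub>A\<^esub> (b i \<otimes>\<^bsub>A\<^esub> \<phi> (a i)))"
        using x a b2 by (intro A.finsum_cong') (auto simp: \<phi>r simp flip: A.m_assoc)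
      also have "\<dots> = x \<otimes>\<^bsub>A\<^esub> (\<Oplus>\<^bsub>A\<^esub>i\<in>{..<n}. b i \<otimes>\<^bsub>A\<^esub> \<phi> (a i))"
        using x a by (intro A.finsum_rdistr[symmetric]) auto
      finally show ?thesis .
    qed
    have "(\<Oplus>\<^bsub>A\<^esub>i\<in>{..<n}. b i \<otimes>\<^bsub>A\<^esub> \<phi> (a i)) \<in> \<A> \<one>\<^bsub>G\<^esub>"
      using a b1 by (intro A.finsum_additive_subgroup component) auto
    then show "\<exists>r\<in>carrier (op_ring R). \<forall>x\<in>carrier (op_bimod ?M). \<phi> x = r \<odot>\<^bsub>op_bimod ?M\<^esub> x"
      unfolding carrier_op_ring carrier_op_bimod smult_op_bimod carrier_sub_bimod rsmult_sub_bimod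
        principal_component_simps
      by (rule bexI[rotated]) (intro ballI eq)
  qed
qed

lemma partially_invertible_component: "g \<in> carrier G \<Longrightarrow> partially_invertible R (sub_bimod A (\<A> g))"
  by (simp add: partially_invertible_iff right_invertible_component right_invertible_op_component)

section \<open>The identities of the partial representation\<close>

lemma iso_class_component_mult_inv:
  assumes g: "g \<in> carrier G"
  shows "iso_class R (sub_bimod A (\<A> g)) \<otimes>\<^bsub>PicS R\<^esub> iso_class R (sub_bimod A (\<A> (inv\<^bsub>G\<^esub> g)))
    = iso_class R (sub_bimod R ((\<lambda>a. a \<otimes>\<^bsub>R\<^esub> \<epsilon> g) ` carrier R))"
proof -
  \<comment> \<open>The degrees \<open>g\<close> and \<open>inv g\<close> multiply to the unit
    degree, so the product of the two components is a cut of \<open>\<A> \<one>\<close>; by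
    centrality this cut is the ideal generated by \<open>\<epsilon> g\<close>.\<close>
  have "left_cut g \<one>\<^bsub>G\<^esub> = (\<lambda>a. a \<otimes>\<^bsub>A\<^esub> \<epsilon> g) ` \<A> \<one>\<^bsub>G\<^esub>"
  proof (intro equalityI subsetI)
    fix z assume "z \<in> left_cut g \<one>\<^bsub>G\<^esub>"
    then show "z \<in> (\<lambda>a. a \<otimes>\<^bsub>A\<^esub> \<epsilon> g) ` \<A> \<one>\<^bsub>G\<^esub>"
      using epsilon_central[OF g, of z] by (intro image_eqI[of _ _ z]) (auto simp: left_cut_def)
  next
    fix z assume "z \<in> (\<lambda>a. a \<otimes>\<^bsub>A\<^esub> \<epsilon> g) ` \<A> \<one>\<^bsub>G\<^esub>"
    then obtain r where r: "r \<in> \<A> \<one>\<^bsub>G\<^esub>" "z = \<epsilon> g \<otimes>\<^bsub>A\<^esub> r"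
      using epsilon_central[OF g] by auto
    moreover have "\<epsilon> g \<otimes>\<^bsub>A\<^esub> r \<in> \<A> \<one>\<^bsub>G\<^esub>"
      using epsilon_in_one[OF g] r(1) by (rule component_mult_eq) simp_all
    ultimately show "z \<in> left_cut g \<one>\<^bsub>G\<^esub>"
      using g component_closed[of "\<one>\<^bsub>G\<^esub>" r]
      by (simp add: left_cut_def epsilon_closed epsilon_idem flip: A.m_assoc)
  qed
  \<comment> \<open>\<open>R\<close> differs from \<open>A\<close> only in the carrier, which
    \<open>sub_bimod\<close> replaces, so both sides are the same record.\<close>
  then have eq: "sub_bimod R ((\<lambda>a. a \<otimes>\<^bsub>R\<^esub> \<epsilon> g) ` carrier R) = sub_bimod A (left_cut g \<one>\<^bsub>G\<^esub>)"
    by (simp add: sub_bimod_def) (simp add: principal_component_def)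
  show ?thesis
    unfolding eq
    using tensor_components_left[OF g, of "inv\<^bsub>G\<^esub> g"] g
      bimodule_sub[OF sub_bimodule_component]
    by (simp add: iso_class_mult partially_invertible_component iso_class_cong bimodule_pair.bimodule_tensor
        bimodule_pair.intro)
qed

text \<open>The first two factors give the cut of the unit component by
  \<open>\<epsilon> (inv g)\<close>, and the factor \<open>\<A> h\<close> turns it into the cut of
  \<open>\<A> h\<close>. On the other side \<open>inv g (g h) = h\<close> gives that cut in one
  step.\<close>

lemma iso_class_component_left_mult:
  assumes g: "g \<in> carrier G" and h: "h \<in> carrier G"
  shows "iso_class R (sub_bimod A (\<A> (inv\<^bsub>G\<^esub> g))) \<otimes>\<^bsub>PicS R\<^esub> iso_class R (sub_bimod A (\<A> g))
      \<otimes>\<^bsub>PicS R\<^esub> iso_class R (sub_bimod A (\<A> h))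
    = iso_class R (sub_bimod A (\<A> (inv\<^bsub>G\<^esub> g))) \<otimes>\<^bsub>PicS R\<^esub> iso_class R (sub_bimod A (\<A> (g \<otimes>\<^bsub>G\<^esub> h)))"
proof -
  let ?M = "\<lambda>g. sub_bimod A (\<A> g)" and ?g' = "inv\<^bsub>G\<^esub> g"
  have g': "?g' \<in> carrier G" and gh: "g \<otimes>\<^bsub>G\<^esub> h \<in> carrier G" using g h by simp_all
  note PI = partially_invertible_component and T = partially_invertible_tensor
  note bim = partially_invertible_imp_bimodule
  have cut: "bimodule R (sub_bimod A (left_cut ?g' \<one>\<^bsub>G\<^esub>))"
    using g' by (simp add: bimodule_sub sub_bimodule_left_cut)
  have L: "bimod_isomorphic R (tensor R (tensor R (?M ?g') (?M g)) (?M h)) (sub_bimod A (left_cut ?g' h))"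
  proof (rule bimod_isomorphic_trans[OF _ tensor_cut_left[OF g' h]])
    show "bimod_isomorphic R (tensor R (tensor R (?M ?g') (?M g)) (?M h))
        (tensor R (sub_bimod A (left_cut ?g' \<one>\<^bsub>G\<^esub>)) (?M h))"
      using tensor_components_left[OF g' g] g
      by (intro tensor_cong bim[OF T] bim[OF PI] PI g g' h cut bimod_isomorphic_refl) simp
  qed
  have Rt: "bimod_isomorphic R (tensor R (?M ?g') (?M (g \<otimes>\<^bsub>G\<^esub> h))) (sub_bimod A (left_cut ?g' h))"
    using tensor_components_left[OF g' gh] g h by (simp add: inv_mult_cancel)
  have "iso_class R (tensor R (tensor R (?M ?g') (?M g)) (?M h)) = iso_class R (tensor R (?M ?g') (?M (g \<otimes>\<^bsub>G\<^esub> h)))"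
    using iso_class_cong[OF L bim[OF T[OF T[OF PI[OF g'] PI[OF g]] PI[OF h]]]]
      iso_class_cong[OF Rt bim[OF T[OF PI[OF g'] PI[OF gh]]]] by simp
  then show ?thesis
    by (simp only: iso_class_mult PI T g g' h gh)
qed

text \<open>Here the idempotent \<open>\<epsilon> h\<close> arises from the last two factors and
  cuts on the right, so the product is reassociated by the monoid law; both sides are then the class
  of \<open>\<A> g \<epsilon> h\<close>.\<close>

lemma iso_class_component_right_mult:
  assumes g: "g \<in> carrier G" and h: "h \<in> carrier G"
  shows "iso_class R (sub_bimod A (\<A> g)) \<otimes>\<^bsub>PicS R\<^esub> iso_class R (sub_bimod A (\<A> h))
      \<otimes>\<^bsub>PicS R\<^esub> iso_class R (sub_bimod A (\<A> (inv\<^bsub>G\<^esub> h)))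
    = iso_class R (sub_bimod A (\<A> (g \<otimes>\<^bsub>G\<^esub> h))) \<otimes>\<^bsub>PicS R\<^esub> iso_class R (sub_bimod A (\<A> (inv\<^bsub>G\<^esub> h)))"
proof -
  let ?M = "\<lambda>g. sub_bimod A (\<A> g)" and ?h' = "inv\<^bsub>G\<^esub> h"
  have h': "?h' \<in> carrier G" and gh: "g \<otimes>\<^bsub>G\<^esub> h \<in> carrier G" using g h by simp_all
  note PI = partially_invertible_component and T = partially_invertible_tensor
  note bim = partially_invertible_imp_bimodule
  have cut: "bimodule R (sub_bimod A (right_cut \<one>\<^bsub>G\<^esub> h))"
    using h by (simp add: bimodule_sub sub_bimodule_right_cut)
  have L: "bimod_isomorphic R (tensor R (?M g) (tensor R (?M h) (?M ?h'))) (sub_bimod A (right_cut g h))"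
  proof (rule bimod_isomorphic_trans[OF _ tensor_cut_right[OF g h]])
    show "bimod_isomorphic R (tensor R (?M g) (tensor R (?M h) (?M ?h')))
        (tensor R (?M g) (sub_bimod A (right_cut \<one>\<^bsub>G\<^esub> h)))"
      using tensor_components_right[OF h h] h
      by (intro tensor_cong bim[OF T] bim[OF PI] PI g h h' cut bimod_isomorphic_refl) simp
  qed
  have Rt: "bimod_isomorphic R (tensor R (?M (g \<otimes>\<^bsub>G\<^esub> h)) (?M ?h')) (sub_bimod A (right_cut g h))"
    using tensor_components_right[OF gh h] g h by (simp add: mult_inv_cancel)
  have "iso_class R (tensor R (?M g) (tensor R (?M h) (?M ?h'))) = iso_class R (tensor R (?M (g \<otimes>\<^bsub>G\<^esub> h)) (?M ?h'))"
    using iso_class_cong[OF L bim[OF T[OF PI[OF g] T[OF PI[OF h] PI[OF h']]]]]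
      iso_class_cong[OF Rt bim[OF T[OF PI[OF gh] PI[OF h']]]] by simp
  moreover have "iso_class R (?M g) \<otimes>\<^bsub>PicS R\<^esub> iso_class R (?M h) \<otimes>\<^bsub>PicS R\<^esub> iso_class R (?M ?h')
      = iso_class R (?M g) \<otimes>\<^bsub>PicS R\<^esub> (iso_class R (?M h) \<otimes>\<^bsub>PicS R\<^esub> iso_class R (?M ?h'))"
    by (intro monoid.m_assoc[OF monoid_PicS[OF ring_R]] iso_class_in_PicS PI g h h')
  ultimately show ?thesis
    by (simp only: iso_class_mult PI T g h h' gh)
qed

lemma unital_partial_representation_component:
  "unital_partial_representation G (PicS R) (\<lambda>g. iso_class R (sub_bimod A (\<A> g)))"
proof (intro unital_partial_representation.intro unital_partial_representation_axioms.intro)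
  \<comment> \<open>Unitality is an equality of records: the unit component, taken as a bimodule
    inside \<open>A\<close>, is \<open>regular_bimod R\<close>.\<close>
  show "iso_class R (sub_bimod A (\<A> \<one>\<^bsub>G\<^esub>)) = \<one>\<^bsub>PicS R\<^esub>"
    by (simp add: PicS_def sub_bimod_def) (simp add: principal_component_def)
qed (auto simp: G.group_axioms monoid_PicS ring_R iso_class_in_PicS partially_invertible_component
    iso_class_component_left_mult iso_class_component_right_mult)

end

theorem proposition3p5:
  fixes G :: "('g, 'h) monoid_scheme" and A :: "('a, 'r) ring_scheme"
    and \<A> :: "'g \<Rightarrow> 'a set" and \<epsilon> :: "'g \<Rightarrow> 'a"
  assumes "group G"
    and "epsilon_strongly_graded G A \<A>"
    and "epsilon_family G A \<A> \<epsilon>"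
  defines "R \<equiv> principal_component G A \<A>"
  defines "\<Phi> \<equiv> \<lambda>g. iso_class R (sub_bimod A (\<A> g))"
  shows "unital_partial_representation G (PicS R) \<Phi> \<and>
    (\<forall>g\<in>carrier G. \<Phi> g \<otimes>\<^bsub>PicS R\<^esub> \<Phi> (inv\<^bsub>G\<^esub> g) =
      iso_class R (sub_bimod R ((\<lambda>a. a \<otimes>\<^bsub>R\<^esub> \<epsilon> g) ` carrier R)))"
proof -
  interpret epsilon_graded G A \<A> \<epsilon>
    using assms(2,3) by (intro epsilon_graded.intro epsilon_graded_axioms.intro)
      (simp_all add: epsilon_strongly_graded_def)
  show ?thesis
    unfolding R_def \<Phi>_def
    using unital_partial_representation_component iso_class_component_mult_inv by blast
qed

end
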